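(* Let $\mathcal{F}=\{f_0,\ldots,f_{N-1}\}$ be a finite family of $C^{1+\beta}$ diffeomorphisms of the circle $\mathbb{S}^1$, for some $\beta>0$, such that $\mathcal{F}$ is proximal on $(\mathbb{S}^1,d)$ and there is no Borel probability measure $m$ on $\mathbb{S}^1$ satisfying $f_*m=m$ for every $f\in\mathcal{F}$. Let $\mu$ be any non-degenerate probability measure on $\mathcal{I}=\{0,\ldots,N-1\}$ (that is, $\mu(\{i\})>0$ for every $i\in\mathcal{I}$), and let $\gamma(\mu)$ be the fiber-Lyapunov exponent of $(\mathcal{F},\mu)$. Then for every $x,y\in\mathbb{S}^1$ with $x\ne y$, $$\lim_{n\to\infty}\frac1n\int\log d\big(X_n^x(\mathbf{i}),X_n^y(\mathbf{i})\big)\,d\mu^{\mathbb{N}}(\mathbf{i})=\lim_{n\to\infty}\frac1n\int\log|(f_{\mathbf{i}}^n)'(x)|\,d\mu^{\mathbb{N}}(\mathbf{i})=\gamma(\mu)<0.$$ Moreover, there exist positive constants $h,\varepsilon_0,c$ such that for all $x\in\mathbb{S}^1$, $\varepsilon\in(0,\varepsilon_0)$ and $n\in\mathbb{N}$, $$\mu^{\mathbb{N}}\Big(\Big\{\mathbf{i}\in\mathcal{I}^{\mathbb{N}}\colon\Big|\frac1n\log|(f_{\mathbf{i}}^n)'(x)|-\gamma(\mu)\Big|>\varepsilon\Big\}\Big)\le c\,e^{-nh\varepsilon^2},$$ and for all $y\in\mathbb{S}^1$, $y\ne x$, $$\mu^{\mathbb{N}}\Big(\Big\{\mathbf{i}\in\mathcal{I}^{\mathbb{N}}\colon\Big|\frac1n\log\frac{d(X_n^x(\mathbf{i}),X_n^y(\mathbf{i}))}{d(x,y)}-\gamma(\mu)\Big|>\varepsilon\Big\}\Big)\le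 c\,e^{-nh\varepsilon^2/4}.$$
   Context: $\mathbb{S}^1=[0,1)$ (i.e. $\mathbb{R}/\mathbb{Z}$) with $d(x,y)=\min\{|x-y|,1-|x-y|\}$. A $C^{1+\beta}$ diffeomorphism is a $C^1$ diffeomorphism whose derivative is Hölder continuous with exponent $\beta$. $\mu^{\mathbb{N}}$ is the product (Bernoulli) measure on $\mathcal{I}^{\mathbb{N}}$. For $\mathbf{i}=(i_1,i_2,\ldots)\in\mathcal{I}^{\mathbb{N}}$ and $n\in\mathbb{N}$ put $f_{\mathbf{i}}^n=f_{i_n}\circ\cdots\circ f_{i_1}$ and $X_n^x(\mathbf{i})=f_{\mathbf{i}}^n(x)$. Proximal: for every $x,y\in \mathbb{S}^1$ there exist $\mathbf{i}\in\mathcal{I}^{\mathbb{N}}$ and a (strictly increasing) sequence $(n_k)_{k}$ with $\lim_{k\to\infty}d(f_{\mathbf{i}}^{n_k}(x),f_{\mathbf{i}}^{n_k}(y))=0$. A Borel probability measure $\nu$ on $\mathbb{S}^1$ is $\mu$-stationary if $\nu=\sum_{i\in\mathcal{I}}\mu(\{i\})\,(f_i)_*\nu$, where $(f_i)_*\nu=\nu\circ f_i^{-1}$. Under the hypotheses of the claim the $\mu$-stationary probability measure $\nu$ is unique, and the fiber-Lyapunov exponent is $$\gamma(\mu)=\int\log|(f_{i_1})'(x)|\,d(\mu^{\mathbb{N}}\otimes\nu)(\mathbf{i},x).$$ *)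

theory Defs
  imports "HOL-Probability.Probability"
begin

typedef circle = "{0..<1::real}"
  morphisms coord of_coord
  by (rule exI[of _ 0]) simp

instantiation circle :: metric_space
begin

definition dist_circle :: "circle \<Rightarrow> circle \<Rightarrow> real" where
  "dist_circle x y = min \<bar>coord x - coord y\<bar> (1 - \<bar>coord x - coord y\<bar>)"

definition uniformity_circle :: "(circle \<times> circle) filter" where
  "uniformity_circle = (INF e\<in>{0<..}. principal {(x, y). dist x y < e})"

definition open_circle :: "circle set \<Rightarrow> bool" where
  "open_circle U \<longleftrightarrow> (\<forall>x\<in>U. eventually (\<lambda>(x', y). x' = x \<longrightarrow> y \<in> U) uniformity)"

instance
proof
  fix x y z :: circle
  have *: "0 \<le> coord w" "coord w < 1" for w
    using coord[of w] by auto
  show "dist x y = 0 \<longleftrightarrow> x = y"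
    using *[of x] *[of y] by (auto simp: dist_circle_def min_def coord_inject[symmetric])
  show "dist x y \<le> dist x z + dist y z"
    using *[of x] *[of y] *[of z] unfolding dist_circle_def by linarith
qed (simp_all add: uniformity_circle_def open_circle_def)

end

definition circle_proj :: "real \<Rightarrow> circle" where
  "circle_proj t = of_coord (frac t)"

definition circle_lift :: "(circle \<Rightarrow> circle) \<Rightarrow> (real \<Rightarrow> real) \<Rightarrow> bool" where
  "circle_lift g G \<longleftrightarrow> continuous_on UNIV G \<and> (\<forall>t. circle_proj (G t) = g (circle_proj t))"

text \<open>
  Derivatives are taken in the coordinate on \<open>\<real>/\<int>\<close>, that is, along a continuous lift to the
  real line; by \<open>circle_has_deriv_unique\<close> below they do not depend on the lift.
\<close>

definition circle_has_deriv :: "(circle \<Rightarrow> circle) \<Rightarrow> real \<Rightarrow> circle \<Rightarrow> bool" where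
  "circle_has_deriv g D x \<longleftrightarrow>
     (\<exists>G. circle_lift g G \<and> (G has_real_derivative D) (at (coord x)))"

definition circle_deriv :: "(circle \<Rightarrow> circle) \<Rightarrow> circle \<Rightarrow> real" where
  "circle_deriv g x = (THE D. circle_has_deriv g D x)"

lemma circle_proj_eq_imp_Ints:
  assumes "circle_proj s = circle_proj t"
  shows "s - t \<in> \<int>"
proof -
  have "frac s = frac t"
    using assms of_coord_inject[of "frac s" "frac t"]
    by (simp add: circle_proj_def frac_ge_0 frac_lt_1)
  then have "s - t = of_int (\<lfloor>s\<rfloor> - \<lfloor>t\<rfloor>)"
    by (simp add: frac_def)
  then show ?thesis
    by (metis Ints_of_int)
qed

lemma circle_has_deriv_unique:
  assumes "circle_has_deriv g D x" "circle_has_deriv g D' x"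
  shows "D = D'"
proof -
  obtain G where G: "circle_lift g G" "(G has_real_derivative D) (at (coord x))"
    using assms(1) by (auto simp: circle_has_deriv_def)
  obtain H where H: "circle_lift g H" "(H has_real_derivative D') (at (coord x))"
    using assms(2) by (auto simp: circle_has_deriv_def)
  have int: "G t - H t \<in> \<int>" for t
    using G(1) H(1) by (intro circle_proj_eq_imp_Ints) (simp add: circle_lift_def)
  have "continuous_on UNIV (\<lambda>t. G t - H t)"
    using G(1) H(1) by (auto simp: circle_lift_def intro!: continuous_intros)
  moreover have "\<exists>e>0. \<forall>s. s \<in> UNIV \<and> G s - H s \<noteq> G t - H t
      \<longrightarrow> e \<le> norm ((G s - H s) - (G t - H t))" for t
  proof (intro exI[of _ 1] conjI allI impI)
    fix s assume "s \<in> UNIV \<and> G s - H s \<noteq> G t - H t"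
    then show "1 \<le> norm ((G s - H s) - (G t - H t))"
      using Ints_nonzero_abs_ge1[of "(G s - H s) - (G t - H t)"] int[of s] int[of t]
      by (metis Ints_diff real_norm_def right_minus_eq)
  qed simp
  ultimately have "(\<lambda>t. G t - H t) constant_on UNIV"
    by (intro continuous_discrete_range_constant) auto
  then obtain k where "\<And>t. G t - H t = k"
    by (auto simp: constant_on_def)
  then have "G = (\<lambda>t. H t + k)"
    by (auto simp: fun_eq_iff algebra_simps)
  then have "(G has_real_derivative D') (at (coord x))"
    using H(2) by (auto intro!: derivative_eq_intros)
  with G(2) show ?thesis
    by (rule DERIV_unique)
qed

lemma circle_deriv_eq: "circle_has_deriv g D x \<Longrightarrow> circle_deriv g x = D"
  unfolding circle_deriv_def using circle_has_deriv_unique by blast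

definition circle_C1 :: "(circle \<Rightarrow> circle) \<Rightarrow> bool" where
  "circle_C1 g \<longleftrightarrow> (\<forall>x. \<exists>D. circle_has_deriv g D x) \<and> continuous_on UNIV (circle_deriv g)"

definition circle_C1_diffeo :: "(circle \<Rightarrow> circle) \<Rightarrow> bool" where
  "circle_C1_diffeo g \<longleftrightarrow> bij g \<and> circle_C1 g \<and> circle_C1 (inv g)"

definition circle_C1_holder_diffeo :: "real \<Rightarrow> (circle \<Rightarrow> circle) \<Rightarrow> bool" where
  "circle_C1_holder_diffeo \<beta> g \<longleftrightarrow> circle_C1_diffeo g \<and>
     (\<exists>C. \<forall>x y. \<bar>circle_deriv g x - circle_deriv g y\<bar> \<le> C * dist x y powr \<beta>)"

text \<open>
  Sequences are indexed from 0, so \<open>w n\<close> is the symbol written \<open>i\<close> with index \<open>n + 1\<close> in one-based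
  notation, and \<open>fiber_iter f w n\<close> is \<open>f (w (n - 1)) \<circ> \<dots> \<circ> f (w 0)\<close>.
\<close>

primrec fiber_iter :: "(nat \<Rightarrow> 'a \<Rightarrow> 'a) \<Rightarrow> (nat \<Rightarrow> nat) \<Rightarrow> nat \<Rightarrow> 'a \<Rightarrow> 'a" where
  "fiber_iter f w 0 = id"
| "fiber_iter f w (Suc n) = f (w n) \<circ> fiber_iter f w n"

definition proximal :: "nat \<Rightarrow> (nat \<Rightarrow> 'a::metric_space \<Rightarrow> 'a) \<Rightarrow> bool" where
  "proximal N f \<longleftrightarrow> (\<forall>x y. \<exists>w r. (\<forall>n. w n < N) \<and> strict_mono r \<and>
     (\<lambda>k. dist (fiber_iter f w (r k) x) (fiber_iter f w (r k) y)) \<longlonglongrightarrow> 0)"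

definition borel_prob :: "'a::topological_space measure \<Rightarrow> bool" where
  "borel_prob m \<longleftrightarrow> prob_space m \<and> sets m = sets borel"

definition nondegenerate_prob :: "nat \<Rightarrow> nat measure \<Rightarrow> bool" where
  "nondegenerate_prob N \<mu> \<longleftrightarrow>
     prob_space \<mu> \<and> sets \<mu> = Pow {..<N} \<and> (\<forall>i<N. measure \<mu> {i} > 0)"

definition bernoulli_measure :: "nat measure \<Rightarrow> (nat \<Rightarrow> nat) measure" where
  "bernoulli_measure \<mu> = PiM UNIV (\<lambda>_::nat. \<mu>)"

definition stationary ::
    "nat \<Rightarrow> (nat \<Rightarrow> 'a::topological_space \<Rightarrow> 'a) \<Rightarrow> nat measure \<Rightarrow> 'a measure \<Rightarrow> bool" where
  "stationary N f \<mu> \<nu> \<longleftrightarrow> borel_prob \<nu> \<and>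
     (\<forall>A\<in>sets borel. measure \<nu> A = (\<Sum>i<N. measure \<mu> {i} * measure (distr \<nu> borel (f i)) A))"

text \<open>
  The definite description is meaningful only when the stationary probability measure exists and
  is unique.
\<close>

definition stationary_measure ::
    "nat \<Rightarrow> (nat \<Rightarrow> 'a::topological_space \<Rightarrow> 'a) \<Rightarrow> nat measure \<Rightarrow> 'a measure" where
  "stationary_measure N f \<mu> = (THE \<nu>. stationary N f \<mu> \<nu>)"

definition fiber_lyapunov_exponent ::
    "nat \<Rightarrow> (nat \<Rightarrow> circle \<Rightarrow> circle) \<Rightarrow> nat measure \<Rightarrow> real" where
  "fiber_lyapunov_exponent N f \<mu> =
     (\<integral>(w, x). ln \<bar>circle_deriv (f (w 0)) x\<bar>
        \<partial>(bernoulli_measure \<mu> \<Otimes>\<^sub>M stationary_measure N f \<mu>))"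

end

theory Submission
  imports Defs
begin

text \<open>
  Write \<open>T\<close> for the transfer operator of the random walk and lift it to pairs of points. On the
  compact space of pairs, \<open>\<Phi> i (x, y) = ln (d(f i x, f i y) / d(x, y))\<close> extends to the diagonal
  by \<open>ln \<bar>(f i)' x\<bar>\<close>, so both cocycles of the theorem are Birkhoff sums of one function, which is
  Hoelder continuous at the diagonal.

  First, the Cesaro means of the expected distance of two trajectories tend to 0 uniformly: by
  subharmonicity an extremal value propagates along all words, hence by proximality to
  a diagonal pair, and then along its whole orbit; disjoint arcs having disjoint images, that orbit
  would be a finite invariant set. Second, the drift of \<open>ln \<bar>f'\<bar>\<close> is negative somewhere: otherwise
  averaged log-derivatives provide densities that are almost invariant by the strict
  concavity of the logarithm, and a weak limit would be an invariant measure. Both facts together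
  make the averaged drift negative at every pair, so a power of the distance, multiplied by
  a cohomological correction, is contracted by \<open>T\<close>. This spectral gap gives the unique stationary
  measure, exponential convergence of \<open>T\<close>-iterates, and a bounded solution of the Poisson equation;
  the latter turns the Birkhoff sums into martingales with bounded increments, to which Chernoff's
  method applies.
\<close>

section \<open>Coordinates on the circle\<close>

text \<open>\<open>\<gamma>\<close> is defined through a stationary measure whose uniqueness is
  itself a consequence of contraction. Everything before the contraction therefore does without it:
  the drift is compared with 0 along Lebesgue densities, and only later is it averaged against the
  stationary measure.

  The obstacle is that the lack of an invariant measure yields a negative mean drift at a single
  point only. Synchronization spreads it: drifts at two places differ by at most a multiple of
  \<open>dist powr \<beta>\<close>, and this power is below a small constant plus a multiple of
  \<open>dist\<close>, whose means tend to 0 uniformly. For this the bound at the special point has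
  to be uniform in the length of the average, since synchronization dictates that length.

  Finiteness of the orbit is a packing argument: disjoint arcs within one period have images of
  total length at most 1 under every composition, so mean lengths near a > 0 can occur around at
  most 1/a points at the same time.

  The contracted power of the distance is small, as the second order term of the exponential must
  not consume the drift.\<close>

lemma coord_ge_0: "0 \<le> coord x" and coord_lt_1: "coord x < 1"
  using coord[of x] by auto

lemma coord_circle_proj: "coord (circle_proj t) = frac t"
  by (simp add: circle_proj_def of_coord_inverse frac_lt_1)

lemma circle_proj_coord [simp]: "circle_proj (coord x) = x"
proof -
  have "frac (coord x) = coord x"
    using coord_ge_0 coord_lt_1 by (simp add: frac_eq)
  then show ?thesis
    by (simp add: circle_proj_def coord_inverse)
qed

lemma circle_proj_eq_iff: "circle_proj s = circle_proj t \<longleftrightarrow> s - t \<in> \<int>"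
proof
  assume "s - t \<in> \<int>"
  then obtain k :: int where "s = t + of_int k"
    by (metis Ints_cases add.commute diff_add_cancel)
  then have "frac s = frac t"
    by (simp add: frac_def)
  then show "circle_proj s = circle_proj t"
    by (simp add: circle_proj_def)
qed (rule circle_proj_eq_imp_Ints)

lemma circle_proj_add_int [simp]: "circle_proj (t + of_int k) = circle_proj t"
  by (simp add: circle_proj_eq_iff)

lemma circle_proj_add_1 [simp]: "circle_proj (t + 1) = circle_proj t"
  using circle_proj_add_int[of t 1] by simp

text \<open>\<open>s - t\<close> differs from the difference of the fractional parts by -1, 0 or 1.
  In the outer cases \<open>\<bar>s - t\<bar>\<close> and the absolute difference of the fractional
  parts add up to 1, and the minimum is symmetric under this exchange.\<close>

lemma dist_circle_proj:
  assumes "\<bar>s - t\<bar> \<le> 1"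
  shows "dist (circle_proj s) (circle_proj t) = min \<bar>s - t\<bar> (1 - \<bar>s - t\<bar>)"
proof -
  define k where "k = \<lfloor>s\<rfloor> - \<lfloor>t\<rfloor>"
  have eq: "s - t = frac s - frac t + of_int k"
    by (simp add: k_def frac_def)
  have b: "0 \<le> frac s" "frac s < 1" "0 \<le> frac t" "frac t < 1"
    by (auto simp: frac_lt_1)
  have "-2 < (of_int k :: real)" "(of_int k :: real) < 2"
    using assms eq b by linarith+
  then have "k = -1 \<or> k = 0 \<or> k = 1"
    by linarith
  then show ?thesis
    using eq b assms unfolding dist_circle_def coord_circle_proj by (elim disjE; simp; linarith)
qed

lemma dist_circle_proj_le: "dist (circle_proj s) (circle_proj t) \<le> \<bar>s - t\<bar>"
proof (cases "\<bar>s - t\<bar> \<le> 1")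
  case False
  moreover have "\<bar>frac s - frac t\<bar> \<le> 1"
    using frac_ge_0[of s] frac_lt_1[of s] frac_ge_0[of t] frac_lt_1[of t] by linarith
  ultimately show ?thesis
    unfolding dist_circle_def coord_circle_proj by linarith
qed (simp add: dist_circle_proj)

lemma dist_circle_le_half: "dist x y \<le> 1/2" for x y :: circle
  unfolding dist_circle_def by linarith

text \<open>Trades points of the circle for reals at the same distance, so that mean value arguments
  can be carried out on a lift.\<close>

lemma circle_proj_surj_near:
  obtains t where "circle_proj t = y" "\<bar>s - t\<bar> = dist (circle_proj s) y"
proof -
  \<comment> \<open>The representative of \<open>y\<close> in the unit interval of \<open>s\<close>;
    when it is more than 1/2 away, the next one towards \<open>s\<close> is taken instead.\<close>
  define t0 where "t0 = coord y + of_int \<lfloor>s\<rfloor>"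
  have y: "circle_proj t0 = y" by (simp add: t0_def)
  have b: "\<bar>s - t0\<bar> < 1"
    using frac_lt_1[of s] frac_ge_0[of s] coord_ge_0[of y] coord_lt_1[of y]
    unfolding t0_def frac_def by linarith
  have d: "dist (circle_proj s) y = min \<bar>s - t0\<bar> (1 - \<bar>s - t0\<bar>)"
    using dist_circle_proj[of s t0] b y by simp
  consider "\<bar>s - t0\<bar> \<le> 1/2" | "s - t0 > 1/2" | "s - t0 < -1/2" by linarith
  then show thesis
  proof cases
    case 1
    then show ?thesis using that[of t0] y d by auto
  next
    case 2
    then show ?thesis
      using that[of "t0 + of_int 1"] y d b unfolding circle_proj_add_int by (auto simp: abs_if min_def)
  next
    case 3
    then show ?thesis
      using that[of "t0 + of_int (-1)"] y d b unfolding circle_proj_add_int by (auto simp: abs_if min_def)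
  qed
qed

lemma continuous_on_circle_proj [continuous_intros]:
  "continuous_on A g \<Longrightarrow> continuous_on A (\<lambda>x. circle_proj (g x))"
proof -
  have "continuous_on UNIV circle_proj"
    unfolding continuous_on_iff
  proof (intro ballI allI impI)
    fix x e :: real assume "e > 0"
    then show "\<exists>d>0. \<forall>x'\<in>UNIV. dist x' x < d \<longrightarrow> dist (circle_proj x') (circle_proj x) < e"
      using dist_circle_proj_le by (intro exI[of _ e]) (auto simp: dist_real_def intro: le_less_trans)
  qed
  then show "continuous_on A g \<Longrightarrow> continuous_on A (\<lambda>x. circle_proj (g x))"
    using continuous_on_compose2 by blast
qed

lemma compact_circle: "compact (UNIV :: circle set)"
proof -
  have "circle_proj ` {0..1} = UNIV"
  proof (intro equalityI subset_UNIV subsetI)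
    fix x
    have "coord x \<in> {0..1}" using coord_ge_0[of x] coord_lt_1[of x] by simp
    then show "x \<in> circle_proj ` {0..1}"
      by (intro image_eqI[of _ _ "coord x"]) simp_all
  qed
  moreover have "compact (circle_proj ` {0..1})"
    by (intro compact_continuous_image continuous_on_circle_proj continuous_on_id) simp
  ultimately show ?thesis by simp
qed

text \<open>Every point near \<open>x\<close> has a representative equally near to
  \<open>coord x\<close>, so continuity may be tested on the line, where the jump of
  \<open>coord\<close> at 0 is invisible.\<close>

lemma continuous_on_circleI:
  fixes g :: "circle \<Rightarrow> 'a::metric_space"
  assumes "continuous_on UNIV (\<lambda>t. g (circle_proj t))"
  shows "continuous_on UNIV g"
  unfolding continuous_on_iff
proof (intro ballI allI impI)
  fix x :: circle and e :: real assume "e > 0"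
  then obtain d where d: "d > 0"
      "\<And>t. dist t (coord x) < d \<Longrightarrow> dist (g (circle_proj t)) (g (circle_proj (coord x))) < e"
    using assms unfolding continuous_on_iff by blast
  have "dist (g y) (g x) < e" if "dist y x < d" for y
  proof -
    obtain t where "circle_proj t = y" "\<bar>coord x - t\<bar> = dist (circle_proj (coord x)) y"
      by (rule circle_proj_surj_near)
    then show ?thesis using that d(2)[of t]
      by (simp add: dist_real_def dist_commute abs_minus_commute)
  qed
  with d(1) show "\<exists>d>0. \<forall>x'\<in>UNIV. dist x' x < d \<longrightarrow> dist (g x') (g x) < e"
    by blast
qed

lemma continuous_on_circle_bounded:
  fixes v :: "circle \<Rightarrow> real"
  assumes "continuous_on UNIV v"
  obtains B where "\<And>x. \<bar>v x\<bar> \<le> B"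
  using compact_imp_bounded[OF compact_continuous_image[OF assms compact_circle]]
  by (auto simp: bounded_iff)

section \<open>Lifts and derivatives\<close>

text \<open>The difference of two lifts is continuous and integer-valued, hence constant. Applied to
  a lift and its own translate by 1, this also yields the degree.\<close>

lemma circle_lift_diff_const:
  assumes "circle_lift g G" "circle_lift g H"
  obtains k :: int where "\<And>t. G t = H t + of_int k"
proof -
  have int: "G t - H t \<in> \<int>" for t
    using assms by (intro circle_proj_eq_imp_Ints) (simp add: circle_lift_def)
  have "continuous_on UNIV (\<lambda>t. G t - H t)"
    using assms by (auto simp: circle_lift_def intro!: continuous_intros)
  moreover have "\<exists>e>0. \<forall>s. s \<in> UNIV \<and> G s - H s \<noteq> G t - H t
      \<longrightarrow> e \<le> norm ((G s - H s) - (G t - H t))" for t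
  proof (intro exI[of _ 1] conjI allI impI)
    fix s assume "s \<in> UNIV \<and> G s - H s \<noteq> G t - H t"
    then show "1 \<le> norm ((G s - H s) - (G t - H t))"
      using Ints_nonzero_abs_ge1[of "(G s - H s) - (G t - H t)"] int[of s] int[of t]
      by (metis Ints_diff real_norm_def right_minus_eq)
  qed simp
  ultimately have "(\<lambda>t. G t - H t) constant_on UNIV"
    by (intro continuous_discrete_range_constant) auto
  then obtain c where c: "\<And>t. G t - H t = c"
    by (auto simp: constant_on_def)
  then have "c \<in> \<int>" using int by metis
  then obtain k where "c = of_int k" by (auto elim: Ints_cases)
  with c that[of k] show thesis by (simp add: algebra_simps)
qed

lemma circle_lift_shift: "circle_lift g G \<Longrightarrow> circle_lift g (\<lambda>t. G (t + of_int k))"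
  unfolding circle_lift_def
  by (auto intro!: continuous_on_compose2[of UNIV G] continuous_intros)

lemma circle_lift_comp: "circle_lift g G \<Longrightarrow> circle_lift h H \<Longrightarrow> circle_lift (g \<circ> h) (G \<circ> H)"
  unfolding circle_lift_def comp_def
  by (auto intro: continuous_on_compose2[of UNIV G])

lemma circle_lift_imp_continuous: "circle_lift g G \<Longrightarrow> continuous_on UNIV g"
  using continuous_on_circle_proj[of UNIV G]
  by (intro continuous_on_circleI) (simp add: circle_lift_def)

text \<open>\<open>circle_has_deriv\<close> supplies one lift, differentiable at the coordinate of
  the point. A translation by the floor of \<open>t\<close> and an additive integer carry the
  derivative to any lift and any representative.\<close>

lemma circle_lift_deriv:
  assumes "circle_lift g G" "circle_has_deriv g D (circle_proj t)"
  shows "(G has_real_derivative D) (at t)"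
proof -
  obtain G0 where G0: "circle_lift g G0" "(G0 has_real_derivative D) (at (frac t))"
    using assms(2) by (auto simp: circle_has_deriv_def coord_circle_proj)
  have "t + of_int (- \<lfloor>t\<rfloor>) = frac t" by (simp add: frac_def)
  then have D: "((\<lambda>t. G0 (t + of_int (- \<lfloor>t'\<rfloor>))) has_real_derivative D) (at t)" if "t' = t" for t'
    using G0(2) that DERIV_shift by metis
  obtain k where "\<And>s. G s = G0 (s + of_int (- \<lfloor>t\<rfloor>)) + of_int k"
    using circle_lift_diff_const[OF assms(1) circle_lift_shift[OF G0(1)]] by metis
  then have "G = (\<lambda>s. G0 (s + of_int (- \<lfloor>t\<rfloor>)) + of_int k)" by auto
  then show ?thesis
    using D[OF refl] by (auto intro!: derivative_eq_intros)
qed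

lemma circle_has_derivI:
  assumes "circle_lift g G" "(G has_real_derivative D) (at t)"
  shows "circle_has_deriv g D (circle_proj t)"
proof -
  have "frac t + of_int \<lfloor>t\<rfloor> = t" by (simp add: frac_def)
  then have "((\<lambda>s. G (s + of_int \<lfloor>t\<rfloor>)) has_real_derivative D) (at (frac t))"
    using assms(2) DERIV_shift by metis
  then show ?thesis
    unfolding circle_has_deriv_def coord_circle_proj
    using circle_lift_shift[OF assms(1)] by blast
qed

lemma circle_has_deriv_comp:
  assumes "circle_has_deriv g E (h x)" "circle_has_deriv h D x"
  shows "circle_has_deriv (g \<circ> h) (E * D) x"
proof -
  obtain H where H: "circle_lift h H" using assms(2) by (auto simp: circle_has_deriv_def)
  obtain G where G: "circle_lift g G" using assms(1) by (auto simp: circle_has_deriv_def)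
  have dH: "(H has_real_derivative D) (at (coord x))"
    using assms(2) by (intro circle_lift_deriv[OF H]) simp
  have "circle_proj (H (coord x)) = h x"
    using H by (simp add: circle_lift_def)
  then have dG: "(G has_real_derivative E) (at (H (coord x)))"
    using assms(1) by (intro circle_lift_deriv[OF G]) simp
  show ?thesis
    using circle_has_derivI[OF circle_lift_comp[OF G H], of "E * D" "coord x"]
      DERIV_chain[OF dG dH] by simp
qed

lemma circle_C1_has_deriv: "circle_C1 g \<Longrightarrow> circle_has_deriv g (circle_deriv g x) x"
  using circle_deriv_eq unfolding circle_C1_def by metis

lemma circle_C1_diffeo_C1: "circle_C1_diffeo g \<Longrightarrow> circle_C1 g"
  by (simp add: circle_C1_diffeo_def)

lemma circle_C1_lift:
  assumes "circle_C1 g"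
  obtains G where "circle_lift g G"
    "\<And>t. (G has_real_derivative circle_deriv g (circle_proj t)) (at t)"
proof -
  obtain G where G: "circle_lift g G"
    using circle_C1_has_deriv[OF assms] by (auto simp: circle_has_deriv_def)
  show thesis
    using that[OF G] circle_lift_deriv[OF G] circle_C1_has_deriv[OF assms] by blast
qed

lemma circle_C1_lipschitz:
  assumes "circle_C1 g"
  obtains L where "L \<ge> 1" "\<And>x. \<bar>circle_deriv g x\<bar> \<le> L" "\<And>x y. dist (g x) (g y) \<le> L * dist x y"
proof -
  obtain G where G: "circle_lift g G"
    "\<And>t. (G has_real_derivative circle_deriv g (circle_proj t)) (at t)"
    using circle_C1_lift[OF assms] by blast
  obtain B where B: "\<And>x. \<bar>circle_deriv g x\<bar> \<le> B"
    using assms continuous_on_circle_bounded unfolding circle_C1_def by blast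
  define L where "L = max 1 B"
  have L: "\<bar>circle_deriv g x\<bar> \<le> L" for x
    using B[of x] by (simp add: L_def)
  have "dist (g x) (g y) \<le> L * dist x y" for x y
  proof -
    obtain t where t: "circle_proj t = y" "\<bar>coord x - t\<bar> = dist (circle_proj (coord x)) y"
      by (rule circle_proj_surj_near)
    have "norm (G (coord x) - G t) \<le> L * norm (coord x - t)"
      using G(2) L by (intro field_differentiable_bound[of UNIV G "\<lambda>t. circle_deriv g (circle_proj t)"]) auto
    moreover have "dist (g x) (g y) \<le> \<bar>G (coord x) - G t\<bar>"
      using dist_circle_proj_le[of "G (coord x)" "G t"] G(1) t by (simp add: circle_lift_def)
    ultimately show ?thesis
      using t by simp
  qed
  with L that[of L] show thesis by (simp add: L_def)
qed

lemma circle_deriv_inv: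
  assumes "circle_C1_diffeo g"
  shows "circle_deriv (inv g) (g x) * circle_deriv g x = 1"
proof -
  have "inv g \<circ> g = id"
    using assms by (auto simp: circle_C1_diffeo_def bij_def)
  then have "circle_has_deriv id (circle_deriv (inv g) (g x) * circle_deriv g x) x"
    using circle_has_deriv_comp[of "inv g" _ g x] circle_C1_has_deriv assms
    unfolding circle_C1_diffeo_def by metis
  moreover have "circle_has_deriv id 1 x"
    unfolding circle_has_deriv_def circle_lift_def
    by (intro exI[of _ id]) (auto simp: id_def intro!: continuous_intros derivative_eq_intros)
  ultimately show ?thesis
    using circle_has_deriv_unique by blast
qed

text \<open>The lower bounds are the upper bounds of the inverse map, whose derivative is the
  reciprocal by the chain rule.\<close>

lemma circle_C1_diffeo_bilipschitz:
  assumes "circle_C1_diffeo g"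
  obtains L where "L \<ge> 1" "\<And>x. 1 / L \<le> \<bar>circle_deriv g x\<bar>" "\<And>x. \<bar>circle_deriv g x\<bar> \<le> L"
    "\<And>x y. dist (g x) (g y) \<le> L * dist x y" "\<And>x y. dist x y \<le> L * dist (g x) (g y)"
proof -
  obtain L1 where L1: "L1 \<ge> 1" "\<And>x. \<bar>circle_deriv g x\<bar> \<le> L1" "\<And>x y. dist (g x) (g y) \<le> L1 * dist x y"
    using circle_C1_lipschitz assms unfolding circle_C1_diffeo_def by metis
  obtain L2 where L2: "L2 \<ge> 1" "\<And>x. \<bar>circle_deriv (inv g) x\<bar> \<le> L2"
    "\<And>x y. dist (inv g x) (inv g y) \<le> L2 * dist x y"
    using circle_C1_lipschitz assms unfolding circle_C1_diffeo_def by metis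
  define L where "L = max L1 L2"
  have ge: "L1 \<le> L" "L2 \<le> L" "1 \<le> L" using L1(1) by (auto simp: L_def)
  show thesis
  proof (rule that[OF ge(3)])
    fix x y
    show "\<bar>circle_deriv g x\<bar> \<le> L" using L1(2)[of x] ge by simp
    have "1 = \<bar>circle_deriv (inv g) (g x)\<bar> * \<bar>circle_deriv g x\<bar>"
      using circle_deriv_inv[OF assms, of x] by (simp flip: abs_mult)
    also have "\<dots> \<le> L * \<bar>circle_deriv g x\<bar>"
      using L2(2)[of "g x"] ge by (intro mult_right_mono) auto
    finally show "1 / L \<le> \<bar>circle_deriv g x\<bar>"
      using ge by (simp add: field_simps)
    show "dist (g x) (g y) \<le> L * dist x y"
      using L1(3)[of x y] mult_right_mono[OF ge(1), of "dist x y"] by simp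
    have "inv g (g x) = x" "inv g (g y) = y"
      using assms by (auto simp: circle_C1_diffeo_def bij_def)
    then show "dist x y \<le> L * dist (g x) (g y)"
      using L2(3)[of "g x" "g y"] mult_right_mono[OF ge(2), of "dist (g x) (g y)"] by simp
  qed
qed

lemma circle_deriv_nonzero: "circle_C1_diffeo g \<Longrightarrow> circle_deriv g x \<noteq> 0"
  using circle_deriv_inv[of g x] by auto

lemma circle_C1_diffeo_continuous:
  assumes "circle_C1_diffeo g"
  shows "continuous_on UNIV g"
  using circle_C1_lift[OF circle_C1_diffeo_C1[OF assms]] circle_lift_imp_continuous by metis

text \<open>\<open>s\<close> is the degree. Its sign is left open because the diffeomorphisms may
  reverse orientation; injectivity and continuity then force strict monotonicity in either
  direction.\<close>

definition monotone_circle_lift :: "(circle \<Rightarrow> circle) \<Rightarrow> (real \<Rightarrow> real) \<Rightarrow> bool" where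
  "monotone_circle_lift g G \<longleftrightarrow>
     circle_lift g G \<and> inj G \<and> (\<exists>s. \<bar>s\<bar> = 1 \<and> (\<forall>t. G (t + 1) = G t + s))"

lemma monotone_circle_lift_comp:
  assumes "monotone_circle_lift g G" "monotone_circle_lift h H"
  shows "monotone_circle_lift (g \<circ> h) (G \<circ> H)"
proof -
  obtain s where s: "\<bar>s\<bar> = 1" "\<And>t. G (t + 1) = G t + s"
    using assms(1) by (auto simp: monotone_circle_lift_def)
  obtain r where r: "\<bar>r\<bar> = 1" "\<And>t. H (t + 1) = H t + r"
    using assms(2) by (auto simp: monotone_circle_lift_def)
  have "G (t - 1) = G t - s" for t using s(2)[of "t - 1"] by simp
  moreover have "r = 1 \<or> r = -1" using r(1) by linarith
  ultimately have "(\<forall>t. (G \<circ> H) (t + 1) = (G \<circ> H) t + s) \<or> (\<forall>t. (G \<circ> H) (t + 1) = (G \<circ> H) t + (- s))"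
    using s(2) r(2) by auto
  then have "\<exists>s. \<bar>s\<bar> = 1 \<and> (\<forall>t. (G \<circ> H) (t + 1) = (G \<circ> H) t + s)"
    using s(1) by (metis abs_minus_cancel)
  then show ?thesis
    using assms unfolding monotone_circle_lift_def by (auto intro!: circle_lift_comp inj_compose)
qed

text \<open>The derivative has no zero, so the mean value theorem makes the lift injective and its
  degree nonzero. With a degree of modulus at least 2 the lift would move by exactly 1 already
  before a full period, and \<open>g\<close> would identify two distinct points.\<close>

lemma circle_C1_diffeo_lift:
  assumes "circle_C1_diffeo g"
  obtains G where "monotone_circle_lift g G"
    "\<And>t. (G has_real_derivative circle_deriv g (circle_proj t)) (at t)"
proof -
  obtain G where G: "circle_lift g G"
    "\<And>t. (G has_real_derivative circle_deriv g (circle_proj t)) (at t)"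
    using circle_C1_lift[OF circle_C1_diffeo_C1[OF assms]] by blast
  have neq: "G a \<noteq> G b" if ab: "a < b" for a b
  proof
    assume "G a = G b"
    moreover obtain z where "G b - G a = (b - a) * circle_deriv g (circle_proj z)"
      using MVT2[of a b G "\<lambda>t. circle_deriv g (circle_proj t)"] ab G(2) by blast
    ultimately show False
      using ab circle_deriv_nonzero[OF assms] by simp
  qed
  then have inj: "inj G" by (metis injI linorder_neqE)
  have cont: "continuous_on UNIV G" using G(1) by (simp add: circle_lift_def)
  obtain k where k: "\<And>t. G (t + 1) = G t + of_int k"
    using circle_lift_diff_const[OF circle_lift_shift[OF G(1), of 1] G(1)] by auto
  have "k \<noteq> 0" using k[of 0] neq[of 0 1] by auto
  moreover have "\<not> \<bar>k\<bar> \<ge> 2"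
  proof
    assume k2: "\<bar>k\<bar> \<ge> 2"
    have "\<exists>c. 0 \<le> c \<and> c \<le> 1 \<and> G c = G 0 + of_int (sgn k)"
    proof (cases "k > 0")
      case True
      then have "k \<ge> 2" using k2 by simp
      then have "G 0 + 1 \<le> G 1" using k[of 0] by simp
      then show ?thesis
        using IVT'[of G 0 "G 0 + 1" 1] True cont by (auto intro: continuous_on_subset)
    next
      case False
      then have "k \<le> -2" using k2 by simp
      then have "real_of_int k \<le> -2" by linarith
      then have "G 1 \<le> G 0 - 1" using k[of 0] by simp
      then show ?thesis
        using IVT2'[of G 1 "G 0 - 1" 0] False \<open>k \<noteq> 0\<close> cont by (auto intro: continuous_on_subset)
    qed
    then obtain c where c: "0 \<le> c" "c \<le> 1" "G c = G 0 + of_int (sgn k)" by blast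
    have "c \<noteq> 0" "c \<noteq> 1" using c(3) k[of 0] \<open>k \<noteq> 0\<close> k2 by (auto simp: sgn_if split: if_splits)
    have "g (circle_proj c) = g (circle_proj 0)"
      using c(3) G(1) by (metis circle_lift_def circle_proj_add_int)
    then have "circle_proj c = circle_proj 0"
      using assms by (auto simp: circle_C1_diffeo_def bij_def dest: injD)
    then have "c \<in> \<int>" by (simp add: circle_proj_eq_iff)
    then show False using c(1,2) \<open>c \<noteq> 0\<close> \<open>c \<noteq> 1\<close> by (auto elim!: Ints_cases)
  qed
  ultimately have "\<bar>k\<bar> = 1" by linarith
  then have "\<bar>real_of_int k\<bar> = 1" by linarith
  then have "monotone_circle_lift g G"
    unfolding monotone_circle_lift_def using G(1) inj k by blast
  with that G(2) show thesis by blast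
qed

section \<open>Logarithmic distortion of distances\<close>

definition log_ratio :: "(circle \<Rightarrow> circle) \<Rightarrow> circle \<Rightarrow> circle \<Rightarrow> real" where
  "log_ratio g x y =
     (if x = y then ln \<bar>circle_deriv g x\<bar> else ln (dist (g x) (g y) / dist x y))"

lemma log_ratio_bounded:
  assumes "circle_C1_diffeo g"
  obtains B where "\<And>x y. \<bar>log_ratio g x y\<bar> \<le> B"
proof -
  obtain L where L: "L \<ge> 1" "\<And>x. 1 / L \<le> \<bar>circle_deriv g x\<bar>" "\<And>x. \<bar>circle_deriv g x\<bar> \<le> L"
    "\<And>x y. dist (g x) (g y) \<le> L * dist x y" "\<And>x y. dist x y \<le> L * dist (g x) (g y)"
    using circle_C1_diffeo_bilipschitz[OF assms] by blast
  have ln: "\<bar>ln a\<bar> \<le> ln L" if "1 / L \<le> a" "a \<le> L" for a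
  proof -
    have "0 < a" using that(1) L(1) by (meson less_le_trans zero_less_divide_1_iff zero_less_one)
    then have "ln (1 / L) \<le> ln a" "ln a \<le> ln L" using that L(1) by auto
    then show ?thesis using L(1) by (simp add: ln_div)
  qed
  have "\<bar>log_ratio g x y\<bar> \<le> ln L" for x y
  proof (cases "x = y")
    case False
    then have "dist x y > 0" by simp
    then have "1 / L \<le> dist (g x) (g y) / dist x y" "dist (g x) (g y) / dist x y \<le> L"
      using L(1) L(4)[of x y] L(5)[of x y] by (auto simp: field_simps)
    with False ln show ?thesis by (simp add: log_ratio_def)
  qed (use ln L(2,3) in \<open>simp add: log_ratio_def\<close>)
  then show thesis by (rule that)
qed

lemma abs_ln_diff_le:
  fixes a b :: real
  assumes "L > 0" "1 / L \<le> a" "1 / L \<le> b"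
  shows "\<bar>ln a - ln b\<bar> \<le> L * \<bar>a - b\<bar>"
proof -
  have *: "ln a - ln b \<le> L * \<bar>a - b\<bar>" if "1 / L \<le> a" "1 / L \<le> b" for a b
  proof -
    have pos: "0 < a" "0 < b" using that assms(1) by (meson less_le_trans zero_less_divide_1_iff)+
    then have "ln a - ln b \<le> (a - b) / b"
      using ln_le_minus_one[of "a / b"] by (simp add: ln_div field_simps)
    also have "\<dots> \<le> \<bar>a - b\<bar> * (1 / b)"
      using pos by (simp add: divide_right_mono)
    also have "\<dots> \<le> \<bar>a - b\<bar> * L"
      using that pos assms(1) by (intro mult_left_mono) (auto simp: field_simps)
    finally show ?thesis by (simp add: mult.commute)
  qed
  show ?thesis
    using *[OF assms(2,3)] *[OF assms(3,2)] by (simp add: abs_minus_commute abs_le_iff)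
qed

text \<open>Near the diagonal the distance ratio is the modulus of the derivative at an intermediate
  point, which is no farther from \<open>x\<close> than \<open>y\<close> is, and Hoelder continuity
  of the derivative applies. Away from the diagonal boundedness suffices. The exponent is free below
  \<beta> because the later contraction may hold for a smaller power only.\<close>

lemma log_ratio_holder:
  assumes "circle_C1_holder_diffeo \<beta> g" "0 < \<alpha>" "\<alpha> \<le> \<beta>"
  obtains C where "C \<ge> 0"
    "\<And>x y. \<bar>log_ratio g x y - log_ratio g x x\<bar> \<le> C * dist x y powr \<alpha>"
    "\<And>x y. \<bar>log_ratio g x x - log_ratio g y y\<bar> \<le> C * dist x y powr \<alpha>"
proof -
  have g: "circle_C1_diffeo g" using assms by (simp add: circle_C1_holder_diffeo_def)
  obtain C0 where C0: "\<And>x y. \<bar>circle_deriv g x - circle_deriv g y\<bar> \<le> C0 * dist x y powr \<beta>"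
    using assms by (auto simp: circle_C1_holder_diffeo_def)
  define C1 where "C1 = max 0 C0"
  have C1: "\<bar>circle_deriv g x - circle_deriv g y\<bar> \<le> C1 * dist x y powr \<alpha>" for x y
  proof -
    have "dist x y powr \<beta> \<le> dist x y powr \<alpha>"
      using dist_circle_le_half[of x y] assms by (intro powr_mono') auto
    then show ?thesis
      using C0[of x y] mult_mono[of C0 C1 "dist x y powr \<beta>" "dist x y powr \<alpha>"]
      by (simp add: C1_def)
  qed
  obtain L where L: "L \<ge> 1" "\<And>x. 1 / L \<le> \<bar>circle_deriv g x\<bar>" "\<And>x. \<bar>circle_deriv g x\<bar> \<le> L"
    "\<And>x y. dist (g x) (g y) \<le> L * dist x y" "\<And>x y. dist x y \<le> L * dist (g x) (g y)"
    using circle_C1_diffeo_bilipschitz[OF g] by blast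
  obtain B where B: "\<And>x y. \<bar>log_ratio g x y\<bar> \<le> B" using log_ratio_bounded[OF g] by blast
  have "B \<ge> 0" using B[of undefined undefined] by linarith
  obtain G where G: "monotone_circle_lift g G"
    "\<And>t. (G has_real_derivative circle_deriv g (circle_proj t)) (at t)"
    using circle_C1_diffeo_lift[OF g] by blast
  have lift: "circle_proj (G t) = g (circle_proj t)" for t
    using G(1) by (simp add: monotone_circle_lift_def circle_lift_def)
  have lnC: "\<bar>ln \<bar>circle_deriv g x\<bar> - ln \<bar>circle_deriv g y\<bar>\<bar> \<le> L * C1 * dist x y powr \<alpha>" for x y
  proof -
    have "\<bar>ln \<bar>circle_deriv g x\<bar> - ln \<bar>circle_deriv g y\<bar>\<bar> \<le> L * \<bar>\<bar>circle_deriv g x\<bar> - \<bar>circle_deriv g y\<bar>\<bar>"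
      using L by (intro abs_ln_diff_le) auto
    also have "\<dots> \<le> L * (C1 * dist x y powr \<alpha>)"
      using C1[of x y] L(1) by (intro mult_left_mono) linarith+
    finally show ?thesis by (simp add: mult.assoc)
  qed
  \<comment> \<open>The second term serves distances above \<open>1 / (2 * L)\<close>, where
    \<open>(2 * L * dist x y) powr \<alpha>\<close> is at least 1.\<close>
  define C where "C = max (L * C1) (2 * B * (2 * L) powr \<alpha>)"
  have Cge: "L * C1 \<le> C" "2 * B * (2 * L) powr \<alpha> \<le> C" "0 \<le> C"
    using \<open>B \<ge> 0\<close> by (auto simp: C_def intro: max.coboundedI2)
  show thesis
  proof (rule that[OF Cge(3)])
    fix x y
    show "\<bar>log_ratio g x x - log_ratio g y y\<bar> \<le> C * dist x y powr \<alpha>"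
      using lnC[of x y] mult_right_mono[OF Cge(1), of "dist x y powr \<alpha>"] by (simp add: log_ratio_def)
    show "\<bar>log_ratio g x y - log_ratio g x x\<bar> \<le> C * dist x y powr \<alpha>"
    proof (cases "x = y")
      case neq: False
      \<comment> \<open>Below this threshold the lifted images are at most 1/2 apart, so their
        distance on the line is their distance on the circle.\<close>
      show ?thesis
      proof (cases "dist x y \<le> 1 / (2 * L)")
        case True
        obtain t where t: "circle_proj t = y" "\<bar>coord x - t\<bar> = dist (circle_proj (coord x)) y"
          by (rule circle_proj_surj_near)
        define s where "s = coord x"
        have st: "\<bar>s - t\<bar> = dist x y" "circle_proj s = x" using t by (auto simp: s_def)
        then have "s \<noteq> t" using neq t by auto
        obtain u where u: "\<bar>u - s\<bar> \<le> \<bar>s - t\<bar>" "G s - G t = (s - t) * circle_deriv g (circle_proj u)"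
        proof (cases "s < t")
          case True
          then obtain z where "s < z" "z < t" "G t - G s = (t - s) * circle_deriv g (circle_proj z)"
            using MVT2[of s t G "\<lambda>t. circle_deriv g (circle_proj t)"] G(2) by blast
          then show ?thesis using that[of z] by (auto simp: algebra_simps)
        next
          case False
          then have "t < s" using \<open>s \<noteq> t\<close> by simp
          then obtain z where "t < z" "z < s" "G s - G t = (s - t) * circle_deriv g (circle_proj z)"
            using MVT2[of t s G "\<lambda>t. circle_deriv g (circle_proj t)"] G(2) by blast
          then show ?thesis using that[of z] by (auto simp: algebra_simps)
        qed
        define z where "z = circle_proj u"
        have dz: "dist x z \<le> dist x y"
          using dist_circle_proj_le[of s u] st u(1) by (simp add: z_def abs_minus_commute)
        have Gd: "\<bar>G s - G t\<bar> = dist x y * \<bar>circle_deriv g z\<bar>"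
          using u(2) st by (simp add: abs_mult z_def)
        also have "\<dots> \<le> 1 / (2 * L) * L"
          using True L by (intro mult_mono) auto
        finally have "\<bar>G s - G t\<bar> \<le> 1 / 2" using L(1) by simp
        then have "dist (g x) (g y) = \<bar>G s - G t\<bar>"
          using dist_circle_proj[of "G s" "G t"] lift st t by simp
        then have "log_ratio g x y = ln \<bar>circle_deriv g z\<bar>"
          using Gd neq by (simp add: log_ratio_def)
        then have "\<bar>log_ratio g x y - log_ratio g x x\<bar> \<le> L * C1 * dist x z powr \<alpha>"
          using lnC[of x z] by (simp add: log_ratio_def abs_minus_commute)
        also have "\<dots> \<le> C * dist x y powr \<alpha>"
          using dz assms Cge L(1) by (intro mult_mono powr_mono2) (auto simp: C1_def)
        finally show ?thesis .
      next
        case False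
        then have "1 \<le> 2 * L * dist x y" using L(1) by (simp add: field_simps)
        then have "1 \<le> (2 * L * dist x y) powr \<alpha>" using assms by (simp add: ge_one_powr_ge_zero)
        then have "1 \<le> (2 * L) powr \<alpha> * dist x y powr \<alpha>" using L(1) by (simp add: powr_mult)
        then have "2 * B * 1 \<le> 2 * B * ((2 * L) powr \<alpha> * dist x y powr \<alpha>)"
          using \<open>B \<ge> 0\<close> by (intro mult_left_mono) auto
        also have "\<dots> \<le> C * dist x y powr \<alpha>"
          using mult_right_mono[OF Cge(2), of "dist x y powr \<alpha>"] by (simp add: mult.assoc)
        finally show ?thesis using B[of x y] B[of x x] by linarith
      qed
    qed (use Cge in simp)
  qed
qed

section \<open>Random iteration of finitely many maps\<close>

locale nondegenerate_system =
  fixes N :: nat and \<mu> :: "nat measure"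
  assumes nondegenerate: "nondegenerate_prob N \<mu>"
begin

abbreviation p :: "nat \<Rightarrow> real" where "p i \<equiv> measure \<mu> {i}"
abbreviation P :: "(nat \<Rightarrow> nat) measure" where "P \<equiv> bernoulli_measure \<mu>"

lemma prob_space_\<mu>: "prob_space \<mu>" and sets_\<mu> [simp]: "sets \<mu> = Pow {..<N}"
  and p_pos: "i < N \<Longrightarrow> p i > 0"
  using nondegenerate by (auto simp: nondegenerate_prob_def)

lemma space_\<mu> [simp]: "space \<mu> = {..<N}"
  using sets_eq_imp_space_eq[of \<mu> "count_space {..<N}"] by simp

lemma integrable_\<mu>: "integrable \<mu> (h :: nat \<Rightarrow> real)"
  and integral_\<mu>: "integral\<^sup>L \<mu> h = (\<Sum>i<N. p i * h i)"
proof -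
  interpret prob_space \<mu> by (rule prob_space_\<mu>)
  have *: "h i = (\<Sum>j<N. h j * indicator {j} i)" if "i \<in> space \<mu>" for i
    using that by (simp add: indicator_def if_distrib cong: if_cong)
  have int: "integrable \<mu> (\<lambda>i. \<Sum>j<N. h j * indicator {j} i)"
    by (intro Bochner_Integration.integrable_sum integrable_mult_right integrable_real_indicator)
      (auto simp: emeasure_eq_measure)
  then show "integrable \<mu> h"
    by (subst Bochner_Integration.integrable_cong[OF refl *])
  have "integral\<^sup>L \<mu> h = (\<integral>i. (\<Sum>j<N. h j * indicator {j} i) \<partial>\<mu>)"
    by (intro Bochner_Integration.integral_cong *) simp_all
  also have "\<dots> = (\<Sum>j<N. \<integral>i. h j * indicator {j} i \<partial>\<mu>)"
    by (intro Bochner_Integration.integral_sum integrable_mult_right integrable_real_indicator)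
      (auto simp: emeasure_eq_measure)
  also have "\<dots> = (\<Sum>j<N. p j * h j)"
  proof (intro sum.cong refl)
    fix j assume "j \<in> {..<N}"
    then have "{j} \<inter> space \<mu> = {j}" by auto
    moreover have "(\<integral>i. h j * indicator {j} i \<partial>\<mu>) = h j * measure \<mu> ({j} \<inter> space \<mu>)" by simp
    ultimately show "(\<integral>i. h j * indicator {j} i \<partial>\<mu>) = p j * h j" by simp
  qed
  finally show "integral\<^sup>L \<mu> h = (\<Sum>i<N. p i * h i)" .
qed

lemma sum_p [simp]: "(\<Sum>i<N. p i) = 1"
  using integral_\<mu>[of "\<lambda>_. 1"] prob_space.prob_space[OF prob_space_\<mu>] by simp

lemma N_pos: "N > 0"
  using sum_p by (cases N) auto

lemma sum_p_const [simp]: "(\<Sum>i<N. p i * c) = c"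
  by (simp flip: sum_distrib_right)

section \<open>The transfer operator and Birkhoff sums\<close>

definition transfer :: "(nat \<Rightarrow> 'z \<Rightarrow> 'z) \<Rightarrow> ('z \<Rightarrow> real) \<Rightarrow> 'z \<Rightarrow> real" where
  "transfer s v z = (\<Sum>i<N. p i * v (s i z))"

abbreviation transfer_pow :: "(nat \<Rightarrow> 'z \<Rightarrow> 'z) \<Rightarrow> nat \<Rightarrow> ('z \<Rightarrow> real) \<Rightarrow> 'z \<Rightarrow> real" where
  "transfer_pow s n v \<equiv> (transfer s ^^ n) v"

lemma transfer_mono: "(\<And>z. v z \<le> w z) \<Longrightarrow> transfer s v z \<le> transfer s w z"
  unfolding transfer_def using p_pos by (intro sum_mono mult_left_mono) (auto intro: less_imp_le)

lemma transfer_const [simp]: "transfer s (\<lambda>_. c) = (\<lambda>_. c)"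
  by (simp add: transfer_def fun_eq_iff)

lemma transfer_linear:
  "transfer s (\<lambda>z. a * v z + b * w z) z = a * transfer s v z + b * transfer s w z"
  unfolding transfer_def by (simp add: sum_distrib_left algebra_simps sum.distrib)

lemma transfer_sum: "transfer s (\<lambda>z. \<Sum>k\<in>A. v k z) z = (\<Sum>k\<in>A. transfer s (v k) z)"
  unfolding transfer_def by (subst sum.swap) (simp add: sum_distrib_left)

lemma transfer_cmult: "transfer s (\<lambda>z. a * v z) z = a * transfer s v z"
  using transfer_linear[of s a v 0 v z] by simp

lemma transfer_diff: "transfer s (\<lambda>z. v z - w z) z = transfer s v z - transfer s w z"
  using transfer_linear[of s 1 v "-1" w z] by simp

lemma transfer_pow_mono: "(\<And>z. v z \<le> w z) \<Longrightarrow> transfer_pow s n v z \<le> transfer_pow s n w z"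
proof (induction n arbitrary: z)
  case (Suc n)
  then show ?case by (auto intro: transfer_mono)
qed simp

lemma transfer_pow_const [simp]: "transfer_pow s n (\<lambda>_. c) = (\<lambda>_. c)"
  by (induction n) auto

lemma transfer_pow_linear:
  "transfer_pow s n (\<lambda>z. a * v z + b * w z) z = a * transfer_pow s n v z + b * transfer_pow s n w z"
proof (induction n arbitrary: z)
  case (Suc n)
  have "transfer_pow s n (\<lambda>z. a * v z + b * w z)
      = (\<lambda>z. a * transfer_pow s n v z + b * transfer_pow s n w z)"
    using Suc by blast
  then show ?case by (simp add: transfer_linear)
qed simp

lemma transfer_pow_Suc: "transfer_pow s (Suc n) v z = (\<Sum>i<N. p i * transfer_pow s n v (s i z))"
  by (simp add: transfer_def)

lemma transfer_pow_le: "(\<And>z. v z \<le> c) \<Longrightarrow> transfer_pow s n v z \<le> c"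
  using transfer_pow_mono[where v=v and w="\<lambda>_. c" and s=s and n=n and z=z] by simp

lemma transfer_pow_ge: "(\<And>z. c \<le> v z) \<Longrightarrow> c \<le> transfer_pow s n v z"
  using transfer_pow_mono[where v="\<lambda>_. c" and w=v and s=s and n=n and z=z] by simp

lemma transfer_pow_abs_le: "(\<And>z. \<bar>v z\<bar> \<le> c) \<Longrightarrow> \<bar>transfer_pow s n v z\<bar> \<le> c"
  using transfer_pow_le[where v=v and c=c and s=s and n=n and z=z] transfer_pow_ge[where v=v and c="- c" and s=s and n=n and z=z] by (simp add: abs_le_iff minus_le_iff)

text \<open>Iterates of \<open>transfer\<close> are linear, monotone and fix constants. The majorant
  is affine in \<open>u\<close> because it is used both with a multiple of \<open>pair_dist\<close>
  plus a small constant and with a multiple of a power of \<open>pair_dist\<close> alone.\<close>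

lemma transfer_pow_abs_diff_le:
  assumes "\<And>z. \<bar>v z - w z\<bar> \<le> a * u z + b"
  shows "\<bar>transfer_pow s n v z - transfer_pow s n w z\<bar> \<le> a * transfer_pow s n u z + b"
proof -
  have d: "transfer_pow s n (\<lambda>z. 1 * v z + (- 1) * w z) z = transfer_pow s n v z - transfer_pow s n w z"
    by (subst transfer_pow_linear) simp
  have d': "transfer_pow s n (\<lambda>z. (- 1) * v z + 1 * w z) z = transfer_pow s n w z - transfer_pow s n v z"
    by (subst transfer_pow_linear) simp
  have e: "transfer_pow s n (\<lambda>z. a * u z + b * 1) z = a * transfer_pow s n u z + b"
    by (subst transfer_pow_linear) simp
  have "transfer_pow s n (\<lambda>z. 1 * v z + (- 1) * w z) z \<le> transfer_pow s n (\<lambda>z. a * u z + b * 1) z"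
    "transfer_pow s n (\<lambda>z. (- 1) * v z + 1 * w z) z \<le> transfer_pow s n (\<lambda>z. a * u z + b * 1) z"
    using assms by (auto intro!: transfer_pow_mono simp: abs_le_iff)
  then show ?thesis
    unfolding d d' e by (simp add: abs_le_iff)
qed

lemma continuous_transfer_pow:
  fixes v :: "'z::metric_space \<Rightarrow> real"
  assumes "\<And>i. i < N \<Longrightarrow> continuous_on UNIV (s i)" "continuous_on UNIV v"
  shows "continuous_on UNIV (transfer_pow s n v)"
proof (induction n)
  case (Suc n)
  show ?case
    unfolding transfer_pow_Suc
    by (intro continuous_intros continuous_on_compose2[OF Suc] assms) auto
qed (use assms in simp)

text \<open>A function is cohomologous to its Birkhoff averages, with transfer function \<open>birkhoff_mean\<close>.\<close>

definition birkhoff :: "(nat \<Rightarrow> 'z \<Rightarrow> 'z) \<Rightarrow> nat \<Rightarrow> ('z \<Rightarrow> real) \<Rightarrow> 'z \<Rightarrow> real" where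
  "birkhoff s n v z = (\<Sum>k<n. transfer_pow s k v z)"

definition birkhoff_mean :: "(nat \<Rightarrow> 'z \<Rightarrow> 'z) \<Rightarrow> nat \<Rightarrow> ('z \<Rightarrow> real) \<Rightarrow> 'z \<Rightarrow> real" where
  "birkhoff_mean s n v z = (\<Sum>k<n. birkhoff s k v z) / real n"

lemma transfer_birkhoff: "transfer s (birkhoff s n v) z = birkhoff s (Suc n) v z - v z"
proof -
  have "birkhoff s n v = (\<lambda>z. \<Sum>k<n. transfer_pow s k v z)"
    by (simp add: birkhoff_def fun_eq_iff)
  then have "transfer s (birkhoff s n v) z = (\<Sum>k<n. transfer_pow s (Suc k) v z)"
    by (simp add: transfer_sum)
  then show ?thesis
    unfolding birkhoff_def by (subst sum.lessThan_Suc_shift) simp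
qed

text \<open>By \<open>transfer_birkhoff\<close> the operator lengthens each Birkhoff sum by one term
  and removes \<open>v\<close>; the differences of consecutive sums telescope to the sum of length
  \<open>n\<close>.\<close>

lemma birkhoff_mean_cohomology:
  assumes "n > 0"
  shows "v z + transfer s (birkhoff_mean s n v) z - birkhoff_mean s n v z = birkhoff s n v z / real n"
proof -
  have "birkhoff_mean s n v = (\<lambda>z. (1 / real n) * (\<Sum>k<n. birkhoff s k v z))"
    by (simp add: birkhoff_mean_def fun_eq_iff)
  then have "transfer s (birkhoff_mean s n v) z = (1 / real n) * (\<Sum>k<n. birkhoff s (Suc k) v z - v z)"
    using transfer_cmult[of s "1 / real n" "\<lambda>z. \<Sum>k<n. birkhoff s k v z" z]
    by (simp add: transfer_sum transfer_birkhoff)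
  also have "\<dots> = (1 / real n) * ((\<Sum>k<n. birkhoff s (Suc k) v z) - n * v z)"
    by (simp add: sum_subtractf)
  finally have "v z + transfer s (birkhoff_mean s n v) z - birkhoff_mean s n v z
      = ((\<Sum>k<n. birkhoff s (Suc k) v z) - (\<Sum>k<n. birkhoff s k v z)) / real n"
    using assms by (simp add: birkhoff_mean_def field_simps)
  also have "(\<Sum>k<n. birkhoff s (Suc k) v z) - (\<Sum>k<n. birkhoff s k v z) = birkhoff s n v z"
    unfolding sum_subtractf[symmetric] by (subst sum_lessThan_telescope) (simp add: birkhoff_def)
  finally show ?thesis .
qed

lemma birkhoff_abs_le:
  assumes "\<And>z. \<bar>v z\<bar> \<le> c"
  shows "\<bar>birkhoff s n v z\<bar> \<le> n * c"
proof -
  have "\<bar>birkhoff s n v z\<bar> \<le> (\<Sum>k<n. \<bar>transfer_pow s k v z\<bar>)"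
    unfolding birkhoff_def by (rule sum_abs)
  also have "\<dots> \<le> (\<Sum>k<n. c)"
    by (intro sum_mono transfer_pow_abs_le assms)
  finally show ?thesis by simp
qed

lemma birkhoff_mean_bounded:
  assumes "\<And>z. \<bar>v z\<bar> \<le> c"
  obtains B where "\<And>z. \<bar>birkhoff_mean s n v z\<bar> \<le> B"
proof -
  have "\<bar>birkhoff_mean s n v z\<bar> \<le> (\<Sum>k<n. real k * c) / real n" for z
  proof -
    have "\<bar>\<Sum>k<n. birkhoff s k v z\<bar> \<le> (\<Sum>k<n. real k * c)"
      by (intro order.trans[OF sum_abs] sum_mono birkhoff_abs_le assms)
    then show ?thesis
      unfolding birkhoff_mean_def by (simp add: divide_right_mono)
  qed
  with that show thesis by blast
qed

lemma birkhoff_abs_diff_le: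
  assumes "\<And>z. \<bar>v z - w z\<bar> \<le> a * u z + b"
  shows "\<bar>birkhoff s n v z - birkhoff s n w z\<bar> \<le> a * birkhoff s n u z + n * b"
proof -
  have "\<bar>birkhoff s n v z - birkhoff s n w z\<bar> \<le> (\<Sum>k<n. \<bar>transfer_pow s k v z - transfer_pow s k w z\<bar>)"
    unfolding birkhoff_def sum_subtractf[symmetric] by (rule sum_abs)
  also have "\<dots> \<le> (\<Sum>k<n. a * transfer_pow s k u z + b)"
    by (intro sum_mono transfer_pow_abs_diff_le assms)
  finally show ?thesis by (simp add: birkhoff_def sum.distrib sum_distrib_left)
qed

lemma continuous_birkhoff:
  fixes v :: "'z::metric_space \<Rightarrow> real"
  assumes "\<And>i. i < N \<Longrightarrow> continuous_on UNIV (s i)" "continuous_on UNIV v"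
  shows "continuous_on UNIV (birkhoff s n v)"
  unfolding birkhoff_def by (intro continuous_intros continuous_transfer_pow assms)

section \<open>Integration over the Bernoulli measure\<close>

lemma prob_space_P: "prob_space P"
  unfolding bernoulli_measure_def by (intro prob_space_PiM prob_space_\<mu>)

lemma space_P: "space P = {w. \<forall>k. w k < N}"
  by (auto simp: bernoulli_measure_def space_PiM PiE_def Pi_def)

text \<open>Only random variables depending on finitely many symbols occur; for these measurability and
  integrability are automatic.\<close>

definition finitary :: "nat \<Rightarrow> ((nat \<Rightarrow> nat) \<Rightarrow> 'b) \<Rightarrow> bool" where
  "finitary n G \<longleftrightarrow> (\<forall>w w'. (\<forall>k<n. w k = w' k) \<longrightarrow> G w = G w')"

lemma finitaryD: "finitary n G \<Longrightarrow> (\<And>k. k < n \<Longrightarrow> w k = w' k) \<Longrightarrow> G w = G w'"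
  by (auto simp: finitary_def)

lemma measurable_prefix: "(\<lambda>w. map w [0..<n]) \<in> measurable P (count_space UNIV)"
proof (subst measurable_count_space_eq2_countable, intro conjI ballI)
  fix l :: "nat list"
  have "map w [0..<n] = l \<longleftrightarrow> length l = n \<and> (\<forall>k<n. w k = l ! k)" for w
    unfolding list_eq_iff_nth_eq by auto
  \<comment> \<open>The intersection with \<open>{..<N}\<close> keeps the conditions on single
    symbols measurable: the sigma-algebra of \<open>\<mu>\<close> contains only subsets of
    \<open>{..<N}\<close>.\<close>
  then have "(\<lambda>w. map w [0..<n]) -` {l} \<inter> space P
      = {w \<in> space P. length l = n \<and> (\<forall>k\<in>{..<n}. w k \<in> {l ! k} \<inter> {..<N})}"
    unfolding space_P by (intro set_eqI) (simp, blast)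
  also have "\<dots> \<in> sets P"
  proof -
    have "(\<lambda>w. w k) \<in> measurable P \<mu>" for k
      unfolding bernoulli_measure_def by (rule measurable_component_singleton) simp
    then have "(\<lambda>w. w k) -` A \<inter> space P \<in> sets P" if "A \<subseteq> {..<N}" for k A
      using that by (intro measurable_sets[of _ P \<mu>]) auto
    then have *: "{w \<in> space P. w k \<in> A} \<in> sets P" if "A \<subseteq> {..<N}" for k A
      using that by (simp add: vimage_def Int_def conj.commute)
    show ?thesis
      by (intro sets.sets_Collect_conj sets.sets_Collect_const sets.sets_Collect_finite_All *) simp_all
  qed
  finally show "(\<lambda>w. map w [0..<n]) -` {l} \<inter> space P \<in> sets P" .
qed auto

lemma finitary_prefix:
  assumes "finitary n G"
  obtains h where "G = (\<lambda>w. h (map w [0..<n]))"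
  by (rule that[of "\<lambda>l. G (\<lambda>k. l ! k)"]) (auto simp: fun_eq_iff intro!: finitaryD[OF assms])

lemma measurable_finitary:
  assumes "finitary n G" "space M = UNIV"
  shows "G \<in> measurable P M"
proof -
  obtain h where h: "G = (\<lambda>w. h (map w [0..<n]))" using finitary_prefix[OF assms(1)] by blast
  show ?thesis
    unfolding h by (rule measurable_compose[OF measurable_prefix]) (auto simp: assms(2))
qed

lemma finitary_bounded:
  fixes G :: "(nat \<Rightarrow> nat) \<Rightarrow> real"
  assumes "finitary n G"
  obtains B where "\<And>w. w \<in> space P \<Longrightarrow> \<bar>G w\<bar> \<le> B"
proof -
  obtain h where h: "G = (\<lambda>w. h (map w [0..<n]))" using finitary_prefix[OF assms(1)] by blast
  have fin: "finite ((\<lambda>l. \<bar>h l\<bar>) ` {l. set l \<subseteq> {..<N} \<and> length l = n})"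
    by (intro finite_imageI finite_lists_length_eq) simp
  show thesis
  proof (rule that)
    fix w assume "w \<in> space P"
    then have "map w [0..<n] \<in> {l. set l \<subseteq> {..<N} \<and> length l = n}"
      by (auto simp: space_P)
    then show "\<bar>G w\<bar> \<le> Max ((\<lambda>l. \<bar>h l\<bar>) ` {l. set l \<subseteq> {..<N} \<and> length l = n})"
      unfolding h by (intro Max_ge fin) blast
  qed
qed

lemma integrable_finitary:
  fixes G :: "(nat \<Rightarrow> nat) \<Rightarrow> real"
  assumes "finitary n G"
  shows "integrable P G"
proof -
  interpret prob_space P by (rule prob_space_P)
  obtain B where "\<And>w. w \<in> space P \<Longrightarrow> \<bar>G w\<bar> \<le> B" using finitary_bounded[OF assms] by blast
  then show ?thesis
    by (intro integrable_const_bound[of _ B] measurable_finitary[OF assms]) auto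
qed

text \<open>Prepending an independent symbol with law \<open>\<mu>\<close> preserves the Bernoulli
  measure, and Fubini's theorem integrates over that symbol last. All expectations of finitary
  variables are computed by induction from this identity.\<close>

lemma integral_P_unfold:
  fixes G :: "(nat \<Rightarrow> nat) \<Rightarrow> real"
  assumes "finitary n G"
  shows "integral\<^sup>L P G = (\<Sum>i<N. p i * (\<integral>w. G (case_nat i w) \<partial>P))"
proof -
  interpret \<mu>: prob_space \<mu> by (rule prob_space_\<mu>)
  interpret P': prob_space P by (rule prob_space_P)
  interpret S: sequence_space \<mu> by unfold_locales
  interpret PP: pair_prob_space \<mu> P by unfold_locales
  let ?c = "\<lambda>(i, w). case_nat i w :: nat \<Rightarrow> nat"
  have D: "distr (\<mu> \<Otimes>\<^sub>M P) P ?c = P"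
    using S.PiM_iter by (simp add: bernoulli_measure_def)
  have meas: "?c \<in> measurable (\<mu> \<Otimes>\<^sub>M P) P"
    unfolding bernoulli_measure_def by measurable
  have G: "G \<in> borel_measurable P" by (rule measurable_finitary[OF assms]) simp
  have int: "integrable (\<mu> \<Otimes>\<^sub>M P) (\<lambda>z. G (?c z))"
    using integrable_distr_eq[OF meas G] integrable_finitary[OF assms] D by simp
  have "integral\<^sup>L P G = integral\<^sup>L (\<mu> \<Otimes>\<^sub>M P) (\<lambda>z. G (?c z))"
    using integral_distr[OF meas G] D by simp
  also have "\<dots> = (\<integral>i. (\<integral>w. G (case_nat i w) \<partial>P) \<partial>\<mu>)"
    using PP.integral_fst'[OF int] by simp
  finally show ?thesis by (simp add: integral_\<mu>)
qed

lemma fiber_iter_case_nat: "fiber_iter s (case_nat i w) (Suc n) z = fiber_iter s w n (s i z)"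
  by (induction n) (auto simp del: fiber_iter.simps(2) simp: fiber_iter.simps(2)[of s "case_nat i w"]
    fiber_iter.simps(2)[of s w])

lemma finitary_fiber_iter: "finitary n (\<lambda>w. F (fiber_iter s w n z))"
proof -
  have "fiber_iter s w n z = fiber_iter s w' n z" if "\<forall>k<n. w k = w' k" for w w'
    using that by (induction n) auto
  then show ?thesis unfolding finitary_def by metis
qed

lemma integral_fiber_iter: "(\<integral>w. F (fiber_iter s w n z) \<partial>P) = transfer_pow s n F z"
proof (induction n arbitrary: z)
  case 0
  show ?case using prob_space.prob_space[OF prob_space_P] by simp
next
  case (Suc n)
  show ?case
    by (subst integral_P_unfold[OF finitary_fiber_iter])
      (simp only: fiber_iter_case_nat Suc transfer_pow_Suc)
qed

section \<open>Additive cocycles and their expectations\<close>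

definition cocycle :: "(nat \<Rightarrow> 'z \<Rightarrow> 'z) \<Rightarrow> (nat \<Rightarrow> 'z \<Rightarrow> real) \<Rightarrow> (nat \<Rightarrow> nat) \<Rightarrow> nat \<Rightarrow> 'z \<Rightarrow> real" where
  "cocycle s \<Phi> w n z = (\<Sum>k<n. \<Phi> (w k) (fiber_iter s w k z))"

lemma cocycle_case_nat:
  "cocycle s \<Phi> (case_nat i w) (Suc n) z = \<Phi> i z + cocycle s \<Phi> w n (s i z)"
  unfolding cocycle_def by (subst sum.lessThan_Suc_shift) (simp add: fiber_iter_case_nat del: fiber_iter.simps(2))

lemma finitary_cocycle: "finitary n (\<lambda>w. F (cocycle s \<Phi> w n z))"
proof -
  have "cocycle s \<Phi> w n z = cocycle s \<Phi> w' n z" if "\<forall>k<n. w k = w' k" for w w'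
    unfolding cocycle_def using that
    by (intro sum.cong refl arg_cong2[of _ _ _ _ \<Phi>] finitaryD[OF finitary_fiber_iter]) auto
  then show ?thesis unfolding finitary_def by metis
qed

lemma integral_cocycle:
  "(\<integral>w. cocycle s \<Phi> w n z \<partial>P) = birkhoff s n (\<lambda>z. \<Sum>i<N. p i * \<Phi> i z) z"
proof (induction n arbitrary: z)
  case 0
  show ?case by (simp add: cocycle_def birkhoff_def)
next
  case (Suc n)
  interpret prob_space P by (rule prob_space_P)
  have "(\<integral>w. cocycle s \<Phi> w (Suc n) z \<partial>P) = (\<Sum>i<N. p i * (\<Phi> i z + (\<integral>w. cocycle s \<Phi> w n (s i z) \<partial>P)))"
    by (subst integral_P_unfold[OF finitary_cocycle[where F="\<lambda>x. x"]], unfold cocycle_case_nat,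
        intro sum.cong refl arg_cong2[of _ _ _ _ "(*)"])
      (simp add: integrable_finitary[OF finitary_cocycle[where F="\<lambda>x. x"]] prob_space)
  also have "\<dots> = (\<Sum>i<N. p i * \<Phi> i z) + transfer s (birkhoff s n (\<lambda>z. \<Sum>i<N. p i * \<Phi> i z)) z"
    unfolding Suc by (simp add: transfer_def algebra_simps sum.distrib)
  finally show ?case by (simp add: transfer_birkhoff)
qed

end

section \<open>Synchronization\<close>

lemma monotone_circle_lift_between:
  assumes "monotone_circle_lift g G" "c \<le> t" "t \<le> c + 1"
  shows "min (G c) (G (c + 1)) \<le> G t" "G t \<le> max (G c) (G (c + 1))"
proof -
  have "continuous_on UNIV G" "inj_on G UNIV"
    using assms(1) by (auto simp: monotone_circle_lift_def circle_lift_def)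
  then have "strict_mono_on UNIV G \<or> strict_antimono_on UNIV G"
    using injective_eq_monotone_map[of UNIV G] by (auto simp: is_interval_univ)
  then have "(G c \<le> G t \<and> G t \<le> G (c + 1)) \<or> (G (c + 1) \<le> G t \<and> G t \<le> G c)"
  proof
    assume "strict_mono_on UNIV G"
    then have "mono G" by (simp add: strict_mono_mono)
    then show ?thesis using assms by (auto dest: monoD)
  next
    assume "strict_antimono_on UNIV G"
    then have "antimono G" unfolding monotone_on_def by (metis UNIV_I antimonoI order_le_less)
    then show ?thesis using assms by (auto dest: antimonoD)
  qed
  then show "min (G c) (G (c + 1)) \<le> G t" "G t \<le> max (G c) (G (c + 1))" by auto
qed

text \<open>The injective lift sends the disjoint intervals, all within one period, to disjoint sets
  within one image period, which has length 1; comparing Lebesgue measures gives the bound. Minima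
  and maxima appear since \<open>G\<close> may decrease and \<open>a k\<close>, \<open>b k\<close>
  come in either order.\<close>

lemma sum_dist_lift_le_1:
  assumes g: "monotone_circle_lift g G" and "finite K"
    and disj: "disjoint_family_on (\<lambda>k. {l k..u k}) K"
    and sub: "\<And>k. k \<in> K \<Longrightarrow> {l k..u k} \<subseteq> {c..c + 1}"
    and ab: "\<And>k. k \<in> K \<Longrightarrow> a k \<in> {l k..u k}" "\<And>k. k \<in> K \<Longrightarrow> b k \<in> {l k..u k}"
  shows "(\<Sum>k\<in>K. dist (g (circle_proj (a k))) (g (circle_proj (b k)))) \<le> 1"
proof -
  define lo hi where "lo k = min (G (a k)) (G (b k))" and "hi k = max (G (a k)) (G (b k))" for k
  have cont: "continuous_on A G" for A
    using g by (auto simp: monotone_circle_lift_def circle_lift_def intro: continuous_on_subset)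
  have J: "{lo k..hi k} \<subseteq> G ` {l k..u k}" if "k \<in> K" for k
  proof -
    have "connected (G ` {l k..u k})" by (intro connected_continuous_image cont) simp
    moreover have "lo k \<in> G ` {l k..u k}" "hi k \<in> G ` {l k..u k}"
      using ab[OF that] by (auto simp: lo_def hi_def min_def max_def)
    ultimately show ?thesis by (rule connected_contains_Icc)
  qed
  have "disjoint_family_on (\<lambda>k. {lo k..hi k}) K"
    unfolding disjoint_family_on_def
  proof (intro ballI impI)
    fix k m assume km: "k \<in> K" "m \<in> K" "k \<noteq> m"
    then have "{l k..u k} \<inter> {l m..u m} = {}" using disj by (auto simp: disjoint_family_on_def)
    moreover have "inj G" using g by (simp add: monotone_circle_lift_def)
    ultimately have "G ` {l k..u k} \<inter> G ` {l m..u m} = {}" by (metis image_Int image_empty)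
    then show "{lo k..hi k} \<inter> {lo m..hi m} = {}" using J[OF km(1)] J[OF km(2)] by blast
  qed
  then have "(\<Sum>k\<in>K. emeasure lborel {lo k..hi k}) = emeasure lborel (\<Union>k\<in>K. {lo k..hi k})"
    using \<open>finite K\<close> by (intro sum_emeasure) auto
  also have "\<dots> \<le> emeasure lborel {min (G c) (G (c + 1))..max (G c) (G (c + 1))}"
  proof (intro emeasure_mono UN_least)
    fix k assume "k \<in> K"
    then have "a k \<in> {c..c + 1}" "b k \<in> {c..c + 1}" using sub ab by blast+
    then show "{lo k..hi k} \<subseteq> {min (G c) (G (c + 1))..max (G c) (G (c + 1))}"
      using monotone_circle_lift_between[OF g, of c "a k"] monotone_circle_lift_between[OF g, of c "b k"]
      unfolding lo_def hi_def by (intro atLeastatMost_subset_iff[THEN iffD2] disjI2 conjI) auto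
  qed simp
  also have "\<dots> = ennreal (max (G c) (G (c + 1)) - min (G c) (G (c + 1)))" by simp
  also have "max (G c) (G (c + 1)) - min (G c) (G (c + 1)) = 1"
  proof -
    obtain s where "\<bar>s\<bar> = 1" "G (c + 1) = G c + s" using g by (auto simp: monotone_circle_lift_def)
    then show ?thesis by (auto simp: min_def max_def)
  qed
  finally have "(\<Sum>k\<in>K. ennreal (hi k - lo k)) \<le> 1"
    by (simp add: lo_def hi_def)
  then have "ennreal (\<Sum>k\<in>K. hi k - lo k) \<le> ennreal 1"
    by (subst (asm) sum_ennreal) (auto simp: lo_def hi_def)
  then have "(\<Sum>k\<in>K. hi k - lo k) \<le> 1" by (subst (asm) ennreal_le_iff) auto
  moreover
  have "dist (g (circle_proj (a k))) (g (circle_proj (b k))) \<le> hi k - lo k" for k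
    using g dist_circle_proj_le[of "G (a k)" "G (b k)"]
    by (auto simp: monotone_circle_lift_def circle_lift_def lo_def hi_def)
  then have "(\<Sum>k\<in>K. dist (g (circle_proj (a k))) (g (circle_proj (b k)))) \<le> (\<Sum>k\<in>K. hi k - lo k)"
    by (intro sum_mono)
  ultimately show ?thesis by linarith
qed

locale circle_system = nondegenerate_system N \<mu> for N \<mu> +
  fixes f :: "nat \<Rightarrow> circle \<Rightarrow> circle"
  assumes diffeo: "i < N \<Longrightarrow> circle_C1_diffeo (f i)"
    and proximal: "proximal N f"
    and no_invariant: "\<not> (\<exists>m. borel_prob m \<and> (\<forall>i<N. distr m borel (f i) = m))"
begin

section \<open>Pairs of trajectories driven by the same word\<close>

definition pair_step :: "nat \<Rightarrow> circle \<times> circle \<Rightarrow> circle \<times> circle" where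
  "pair_step i z = (f i (fst z), f i (snd z))"

definition pair_dist :: "circle \<times> circle \<Rightarrow> real" where
  "pair_dist z = dist (fst z) (snd z)"

lemma pair_dist_bounds: "0 \<le> pair_dist z" "pair_dist z \<le> 1/2" "\<bar>pair_dist z\<bar> \<le> 1/2"
  using dist_circle_le_half by (auto simp: pair_dist_def)

lemma fiber_iter_pair_step:
  "fiber_iter pair_step w n z = (fiber_iter f w n (fst z), fiber_iter f w n (snd z))"
  by (induction n) (auto simp: pair_step_def)

lemma continuous_f: "i < N \<Longrightarrow> continuous_on UNIV (f i)"
  by (intro circle_C1_diffeo_continuous diffeo)

lemma continuous_fiber_iter:
  assumes "\<And>k. w k < N"
  shows "continuous_on UNIV (fiber_iter f w n)"
proof (induction n)
  case (Suc n)
  then show ?case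
    using continuous_on_compose[OF Suc continuous_on_subset[OF continuous_f]] assms by auto
qed (simp add: id_def)

lemma measurable_f: "i < N \<Longrightarrow> f i \<in> borel_measurable borel"
  by (intro borel_measurable_continuous_onI continuous_f)

lemma transfer_pair_fst: "transfer_pow pair_step n (\<lambda>z. v (fst z)) z = transfer_pow f n v (fst z)"
proof (induction n arbitrary: z)
  case (Suc n)
  then show ?case by (simp add: transfer_pow_Suc pair_step_def del: funpow.simps)
qed simp

lemma transfer_pair_snd: "transfer_pow pair_step n (\<lambda>z. v (snd z)) z = transfer_pow f n v (snd z)"
proof (induction n arbitrary: z)
  case (Suc n)
  then show ?case by (simp add: transfer_pow_Suc pair_step_def del: funpow.simps)
qed simp

text \<open>An injective self-map of a finite set permutes it, so the uniform distribution on
  \<open>A\<close> would be invariant under all the maps.\<close>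

lemma no_finite_invariant_set:
  assumes "finite A" "A \<noteq> {}" "\<And>i. i < N \<Longrightarrow> f i ` A \<subseteq> A"
  shows False
proof -
  have eq: "f i ` A = A" and inj: "inj_on (f i) A" if "i < N" for i
  proof -
    show inj: "inj_on (f i) A"
      using diffeo[OF that] by (auto simp: circle_C1_diffeo_def bij_def intro: inj_on_subset)
    show "f i ` A = A" using endo_inj_surj[OF assms(1) assms(3)[OF that] inj] .
  qed
  \<comment> \<open>The push-forward under the identity only replaces the discrete sigma-algebra by
    the Borel one.\<close>
  define m where "m = distr (measure_pmf (pmf_of_set A)) borel (\<lambda>x. x)"
  have "borel_prob m"
    unfolding borel_prob_def m_def by (simp add: measure_pmf.prob_space_distr)
  moreover have "distr m borel (f i) = m" if "i < N" for i
  proof -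
    have "distr m borel (f i) = distr (measure_pmf (pmf_of_set A)) borel (f i)"
      unfolding m_def by (subst distr_distr) (auto simp: measurable_f[OF that] comp_def)
    also have "\<dots> = distr (distr (measure_pmf (pmf_of_set A)) (count_space UNIV) (f i)) borel (\<lambda>x. x)"
      by (subst distr_distr) (auto simp: comp_def)
    also have "distr (measure_pmf (pmf_of_set A)) (count_space UNIV) (f i) = measure_pmf (pmf_of_set A)"
      unfolding map_pmf_rep_eq[symmetric] using map_pmf_of_set_inj[OF inj[OF that] assms(2,1)] eq[OF that] by simp
    finally show ?thesis by (simp add: m_def)
  qed
  ultimately show False using no_invariant by blast
qed

text \<open>The arcs are seen through a map \<open>g\<close> already applied, so that the induction
  can compose \<open>g\<close> with the next \<open>f i\<close>; the packing bound holds for every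
  word and hence on average.\<close>

lemma sum_transfer_dist_le_1:
  assumes "monotone_circle_lift g G" "finite K"
    and "disjoint_family_on (\<lambda>k. {l k..u k}) K"
    and "\<And>k. k \<in> K \<Longrightarrow> {l k..u k} \<subseteq> {c..c + 1}"
    and "\<And>k. k \<in> K \<Longrightarrow> a k \<in> {l k..u k}" "\<And>k. k \<in> K \<Longrightarrow> b k \<in> {l k..u k}"
  shows "(\<Sum>k\<in>K. transfer_pow pair_step n pair_dist (g (circle_proj (a k)), g (circle_proj (b k)))) \<le> 1"
  using assms(1)
proof (induction n arbitrary: g G)
  case 0
  show ?case
    using sum_dist_lift_le_1[OF 0 assms(2-6)] by (simp add: pair_dist_def)
next
  case (Suc n)
  have "(\<Sum>k\<in>K. transfer_pow pair_step n pair_dist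
      (f i (g (circle_proj (a k))), f i (g (circle_proj (b k))))) \<le> 1" if i: "i < N" for i
  proof -
    obtain F where "monotone_circle_lift (f i) F" using circle_C1_diffeo_lift[OF diffeo[OF i]] by blast
    from Suc.IH[OF monotone_circle_lift_comp[OF this Suc.prems]] show ?thesis by simp
  qed
  then have "(\<Sum>i<N. p i * (\<Sum>k\<in>K. transfer_pow pair_step n pair_dist
      (f i (g (circle_proj (a k))), f i (g (circle_proj (b k)))))) \<le> (\<Sum>i<N. p i * 1)"
    by (intro sum_mono mult_left_mono) auto
  then show ?case
    unfolding transfer_pow_Suc pair_step_def
    by (subst sum.swap) (simp add: sum_distrib_left)
qed

section \<open>Time averages of the expected distance\<close>

definition mean_dist :: "nat \<Rightarrow> circle \<times> circle \<Rightarrow> real" where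
  "mean_dist n z = birkhoff pair_step n pair_dist z / real n"

lemma mean_dist_le: "mean_dist n z \<le> 1 / 2"
proof (cases "n = 0")
  case False
  then show ?thesis
    using birkhoff_abs_le[of pair_dist "1/2" pair_step n z] pair_dist_bounds
    by (simp add: mean_dist_def field_simps abs_le_iff)
qed (simp add: mean_dist_def)

text \<open>Starting one step later shifts the averaging window by one. The term gained at its end
  is nonnegative and the term lost at its beginning is at most 1, whence the error
  \<open>1 / real n\<close>.\<close>

lemma mean_dist_subharmonic:
  assumes "n > 0"
  shows "mean_dist n z \<le> (\<Sum>i<N. p i * mean_dist n (pair_step i z)) + 1 / real n"
proof -
  have "birkhoff pair_step n pair_dist z \<le> birkhoff pair_step (Suc n) pair_dist z"
    using transfer_pow_ge[where c=0 and v=pair_dist and s=pair_step and n=n and z=z] pair_dist_bounds by (simp add: birkhoff_def)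
  also have "\<dots> = transfer pair_step (birkhoff pair_step n pair_dist) z + pair_dist z"
    by (simp add: transfer_birkhoff)
  also have "\<dots> \<le> transfer pair_step (birkhoff pair_step n pair_dist) z + 1"
    using pair_dist_bounds(2)[of z] by simp
  finally have "mean_dist n z \<le> (transfer pair_step (birkhoff pair_step n pair_dist) z + 1) / n"
    using assms by (simp add: mean_dist_def divide_right_mono)
  then show ?thesis
    by (simp add: transfer_def mean_dist_def add_divide_distrib sum_divide_distrib)
qed

lemma sum_mean_dist_le_1:
  assumes "finite K" "disjoint_family_on (\<lambda>k. {l k..u k}) K"
    and "\<And>k. k \<in> K \<Longrightarrow> {l k..u k} \<subseteq> {c..c + 1}"
    and "\<And>k. k \<in> K \<Longrightarrow> a k \<in> {l k..u k}" "\<And>k. k \<in> K \<Longrightarrow> b k \<in> {l k..u k}"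
  shows "(\<Sum>k\<in>K. mean_dist n (circle_proj (a k), circle_proj (b k))) \<le> 1"
proof (cases "n = 0")
  case False
  have id: "monotone_circle_lift id id"
    by (auto simp: monotone_circle_lift_def circle_lift_def id_def continuous_on_id intro!: exI[of _ 1])
  have "(\<Sum>k\<in>K. birkhoff pair_step n pair_dist (circle_proj (a k), circle_proj (b k)))
      = (\<Sum>j<n. \<Sum>k\<in>K. transfer_pow pair_step j pair_dist (circle_proj (a k), circle_proj (b k)))"
    unfolding birkhoff_def by (rule sum.swap)
  also have "\<dots> \<le> (\<Sum>j<n. 1)"
    using sum_transfer_dist_le_1[OF id assms] by (intro sum_mono) simp
  finally show ?thesis
    using False by (simp add: mean_dist_def sum_divide_distrib[symmetric])
qed (simp add: mean_dist_def)

end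

text \<open>\<open>\<rho>\<close> is a third of the smallest gap between coordinates and from a
  coordinate to 1. The gaps to 1 make all intervals fit into the single period starting at
  \<open>- \<rho>\<close>; the extra element 1 keeps the set of gaps nonempty.\<close>

lemma separated_intervals:
  fixes K :: "circle set"
  assumes "finite K"
  obtains \<rho> where "\<rho> > 0"
    "disjoint_family_on (\<lambda>x. {coord x - \<rho>..coord x + \<rho>}) K"
    "\<And>x. x \<in> K \<Longrightarrow> {coord x - \<rho>..coord x + \<rho>} \<subseteq> {- \<rho>..- \<rho> + 1}"
proof -
  define D where "D = insert 1 ((\<lambda>x. 1 - coord x) ` K \<union>
    ((\<lambda>(x, y). \<bar>coord x - coord y\<bar>) ` {(x, y) \<in> K \<times> K. x \<noteq> y}))"
  have fin: "finite D"
  proof -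
    have "finite {(x, y) \<in> K \<times> K. x \<noteq> y}"
      by (rule finite_subset[of _ "K \<times> K"]) (use assms in auto)
    then show ?thesis using assms by (simp add: D_def)
  qed
  have pos: "d > 0" if dD: "d \<in> D" for d
  proof -
    have "1 - coord x > 0" for x using coord_lt_1[of x] by simp
    moreover have "\<bar>coord x - coord y\<bar> > 0" if "x \<noteq> y" for x y
      using that coord_inject[of x y] by simp
    ultimately show ?thesis
      using dD unfolding D_def
      by (elim insertE UnE imageE) (simp_all del: zero_less_abs_iff split: prod.splits)
  qed
  define \<rho> where "\<rho> = Min D / 3"
  have ne: "D \<noteq> {}" by (simp add: D_def)
  have \<rho>: "\<rho> > 0" using pos Min_in[OF fin ne] by (simp add: \<rho>_def)
  have le: "3 * \<rho> \<le> d" if "d \<in> D" for d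
    using Min_le[OF fin that] by (simp add: \<rho>_def)
  show thesis
  proof (rule that[OF \<rho>])
    show "disjoint_family_on (\<lambda>x. {coord x - \<rho>..coord x + \<rho>}) K"
      unfolding disjoint_family_on_def
    proof (intro ballI impI)
      fix x y assume xy: "x \<in> K" "y \<in> K" "x \<noteq> y"
      then have "\<bar>coord x - coord y\<bar> \<in> D" unfolding D_def by force
      then have "3 * \<rho> \<le> \<bar>coord x - coord y\<bar>" by (rule le)
      then show "{coord x - \<rho>..coord x + \<rho>} \<inter> {coord y - \<rho>..coord y + \<rho>} = {}"
        using \<rho> by auto
    qed
  next
    fix x assume "x \<in> K"
    then have "1 - coord x \<in> D" by (simp add: D_def)
    then have "3 * \<rho> \<le> 1 - coord x" by (rule le)
    then show "{coord x - \<rho>..coord x + \<rho>} \<subseteq> {- \<rho>..- \<rho> + 1}"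
      using \<rho> coord_ge_0[of x] by auto
  qed
qed

lemma compact_circle_pairs: "compact (UNIV :: (circle \<times> circle) set)"
  using compact_Times[OF compact_circle compact_circle] by simp

context circle_system
begin

text \<open>Used for the asymptotic maximum \<open>a\<close> of \<open>mean_dist\<close>, where subharmonicity propagates the
  extremal values along all words.\<close>

definition near_extremal :: "real \<Rightarrow> circle \<times> circle \<Rightarrow> bool" where
  "near_extremal a z \<longleftrightarrow>
     (\<forall>e>0. \<forall>\<delta>>0. \<forall>m. \<exists>n\<ge>m. \<exists>z'. dist z' z < \<delta> \<and> mean_dist n z' > a - e)"

text \<open>A diagonal argument: the large means are only required at points near the pair, which
  makes the near extremal pairs a closed set without any equicontinuity of the means.\<close>

lemma near_extremal_limit:
  assumes "\<And>k. near_extremal a (z k)" "z \<longlonglongrightarrow> l"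
  shows "near_extremal a l"
  unfolding near_extremal_def
proof (intro allI impI)
  fix e \<delta> :: real and m assume "e > 0" "\<delta> > 0"
  then obtain k where k: "dist (z k) l < \<delta> / 2"
    using assms(2) unfolding lim_sequentially by (meson half_gt_zero order_refl)
  obtain n z' where "n \<ge> m" "dist z' (z k) < \<delta> / 2" "mean_dist n z' > a - e"
    using assms(1)[of k] \<open>e > 0\<close> \<open>\<delta> > 0\<close> unfolding near_extremal_def by (meson half_gt_zero)
  then show "\<exists>n\<ge>m. \<exists>z'. dist z' l < \<delta> \<and> mean_dist n z' > a - e"
    using k by (metis dist_triangle_half_r dist_commute)
qed

text \<open>The sequence form fixes times \<open>\<nu> j\<close> once and for all. Packing needs
  large mean distances around many points of an orbit at one common time, and the times stay the
  same when a word is applied.\<close>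

lemma near_extremal_sequence:
  assumes up: "\<And>e. e > 0 \<Longrightarrow> \<exists>m. \<forall>n\<ge>m. \<forall>z. mean_dist n z \<le> a + e"
    and "near_extremal a z"
  obtains \<nu> y where "filterlim \<nu> at_top sequentially" "y \<longlonglongrightarrow> z" "(\<lambda>j. mean_dist (\<nu> j) (y j)) \<longlonglongrightarrow> a"
proof -
  have "\<exists>n z'. n \<ge> j \<and> dist z' z < 1 / Suc j \<and> mean_dist n z' > a - 1 / Suc j" for j
    using assms(2)[unfolded near_extremal_def, rule_format, of "1 / Suc j" "1 / Suc j" j] by auto
  then obtain \<nu> y where *: "\<And>j. \<nu> j \<ge> j" "\<And>j. dist (y j) z < 1 / Suc j" "\<And>j. mean_dist (\<nu> j) (y j) > a - 1 / Suc j"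
    by metis
  have inv0: "(\<lambda>j. 1 / real (Suc j)) \<longlonglongrightarrow> 0" using LIMSEQ_inverse_real_of_nat by (simp add: inverse_eq_divide)
  show thesis
  proof (rule that)
    show lim: "filterlim \<nu> at_top sequentially"
      using *(1) by (intro filterlim_at_top_mono[OF filterlim_ident]) auto
    show "y \<longlonglongrightarrow> z"
    proof (rule metric_LIMSEQ_I)
      fix r :: real assume "r > 0"
      then obtain k where "\<And>j. j \<ge> k \<Longrightarrow> 1 / real (Suc j) < r" using LIMSEQ_D[OF inv0] by fastforce
      then have "\<And>j. j \<ge> k \<Longrightarrow> dist (y j) z < r" using *(2) less_trans by blast
      then show "\<exists>no. \<forall>n\<ge>no. dist (y n) z < r" by blast
    qed
    show "(\<lambda>j. mean_dist (\<nu> j) (y j)) \<longlonglongrightarrow> a"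
    proof (rule LIMSEQ_I)
      fix r :: real assume "r > 0"
      obtain m where m: "\<And>n z. n \<ge> m \<Longrightarrow> mean_dist n z \<le> a + r / 2" using up[of "r / 2"] \<open>r > 0\<close> by auto
      obtain k where k: "\<And>j. j \<ge> k \<Longrightarrow> 1 / real (Suc j) < r"
        using LIMSEQ_D[OF inv0 \<open>r > 0\<close>] by auto
      show "\<exists>no. \<forall>n\<ge>no. norm (mean_dist (\<nu> n) (y n) - a) < r"
      proof (intro exI[of _ "max m k"] allI impI)
        fix j assume j: "j \<ge> max m k"
        then have "mean_dist (\<nu> j) (y j) \<le> a + r / 2" using m *(1)[of j] by (meson max.boundedE order.trans)
        moreover have "mean_dist (\<nu> j) (y j) > a - r" using *(3)[of j] k[of j] j by linarith
        ultimately show "norm (mean_dist (\<nu> j) (y j) - a) < r" using \<open>r > 0\<close> by (simp add: abs_less_iff)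
      qed
    qed
  qed
qed

text \<open>If a weighted average is close to \<open>a\<close> while no value exceeds
  \<open>a\<close> by much, then each value of positive weight is close to \<open>a\<close>.\<close>

lemma extremal_sequence_step:
  assumes up: "\<And>e. e > 0 \<Longrightarrow> \<exists>m. \<forall>n\<ge>m. \<forall>z. mean_dist n z \<le> a + e"
    and \<nu>: "filterlim \<nu> at_top sequentially" and y: "(\<lambda>j. mean_dist (\<nu> j) (y j)) \<longlonglongrightarrow> a" and i: "i < N"
  shows "(\<lambda>j. mean_dist (\<nu> j) (pair_step i (y j))) \<longlonglongrightarrow> a"
proof (rule LIMSEQ_I)
  fix r :: real assume "r > 0"
  \<comment> \<open>The lower bound at \<open>y j\<close>, the error of subharmonicity and the
    excess of the other values cost at most \<open>3 * e\<close> together, which is less than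
    \<open>p i * r = 4 * e\<close>.\<close>
  define e where "e = r * p i / 4"
  have e: "e > 0" using \<open>r > 0\<close> p_pos[OF i] by (simp add: e_def)
  have pi1: "p i \<le> 1" using prob_space.prob_le_1[OF prob_space_\<mu>] .
  obtain m where m: "\<And>n z. n \<ge> m \<Longrightarrow> mean_dist n z \<le> a + e" using up[OF e] by auto
  have "\<forall>\<^sub>F j in sequentially. \<nu> j \<ge> max m (nat \<lceil>1 / e\<rceil> + 1)"
    using \<nu> unfolding filterlim_at_top by blast
  moreover have "\<forall>\<^sub>F j in sequentially. mean_dist (\<nu> j) (y j) > a - e"
    using y e by (intro order_tendstoD(1)[OF y]) simp
  ultimately have "\<forall>\<^sub>F j in sequentially. norm (mean_dist (\<nu> j) (pair_step i (y j)) - a) < r"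
  proof eventually_elim
    case (elim j)
    define n where "n = \<nu> j"
    have n: "n \<ge> m" "n > 0" using elim(1) by (auto simp: n_def)
    have "1 / e \<le> real n" using elim(1) unfolding n_def by linarith
    then have "1 / real n \<le> e" using e n(2) by (simp add: field_simps)
    have "a - e < (\<Sum>l<N. p l * mean_dist n (pair_step l (y j))) + e"
      using mean_dist_subharmonic[OF n(2), of "y j"] elim(2) \<open>1 / real n \<le> e\<close> by (simp add: n_def)
    also have "(\<Sum>l<N. p l * mean_dist n (pair_step l (y j)))
        \<le> p i * mean_dist n (pair_step i (y j)) + (\<Sum>l\<in>{..<N} - {i}. p l * (a + e))"
    proof -
      have "(\<Sum>l\<in>{..<N} - {i}. p l * mean_dist n (pair_step l (y j))) \<le> (\<Sum>l\<in>{..<N} - {i}. p l * (a + e))"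
        by (intro sum_mono mult_left_mono m n(1)) auto
      then show ?thesis using i by (subst sum.remove[of _ i]) auto
    qed
    also have "(\<Sum>l\<in>{..<N} - {i}. p l * (a + e)) = (1 - p i) * (a + e)"
      using i sum_p by (simp add: sum_diff1 flip: sum_distrib_right)
    finally have "a - e < p i * mean_dist n (pair_step i (y j)) + (1 - p i) * (a + e) + e"
      by simp
    moreover have "0 < p i * e" "4 * e = p i * r" "0 < e" using e p_pos[OF i] by (auto simp: e_def)
    ultimately have "p i * (a - r) < p i * mean_dist n (pair_step i (y j))"
      by (simp add: algebra_simps)
    then have "a - r < mean_dist n (pair_step i (y j))" using p_pos[OF i] by simp
    moreover have "mean_dist n (pair_step i (y j)) \<le> a + e" by (rule m[OF n(1)])
    moreover have "e < r" using mult_left_mono[OF pi1, of r] \<open>r > 0\<close> by (simp add: e_def)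
    ultimately show ?case by (simp add: n_def abs_less_iff)
  qed
  then show "\<exists>no. \<forall>n\<ge>no. norm (mean_dist (\<nu> n) (pair_step i (y n)) - a) < r"
    by (simp add: eventually_sequentially)
qed

lemma extremal_sequence_fiber_iter:
  assumes up: "\<And>e. e > 0 \<Longrightarrow> \<exists>m. \<forall>n\<ge>m. \<forall>z. mean_dist n z \<le> a + e"
    and \<nu>: "filterlim \<nu> at_top sequentially" and y: "(\<lambda>j. mean_dist (\<nu> j) (y j)) \<longlonglongrightarrow> a"
    and w: "\<And>k. w k < N"
  shows "(\<lambda>j. mean_dist (\<nu> j) (fiber_iter pair_step w n (y j))) \<longlonglongrightarrow> a"
proof (induction n)
  case (Suc n)
  then show ?case using extremal_sequence_step[OF up \<nu> _ w] by simp
qed (use y in simp)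

lemma tendsto_fiber_iter_pair:
  assumes "y \<longlonglongrightarrow> z" "\<And>k. w k < N"
  shows "(\<lambda>j. fiber_iter pair_step w n (y j)) \<longlonglongrightarrow> fiber_iter pair_step w n z"
proof -
  have "isCont (fiber_iter f w n) x" for x
    using continuous_fiber_iter[of w n] assms(2) by (simp add: continuous_on_eq_continuous_at)
  then show ?thesis
    unfolding fiber_iter_pair_step using assms(1)
    by (intro tendsto_Pair isCont_tendsto_compose[of _ "fiber_iter f w n"] tendsto_fst tendsto_snd) auto
qed

lemma near_extremal_fiber_iter:
  assumes up: "\<And>e. e > 0 \<Longrightarrow> \<exists>m. \<forall>n\<ge>m. \<forall>z. mean_dist n z \<le> a + e"
    and "near_extremal a z" "\<And>k. w k < N"
  shows "near_extremal a (fiber_iter pair_step w n z)"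
proof -
  obtain \<nu> y where \<nu>: "filterlim \<nu> at_top sequentially" and y: "y \<longlonglongrightarrow> z"
    and v: "(\<lambda>j. mean_dist (\<nu> j) (y j)) \<longlonglongrightarrow> a"
    using near_extremal_sequence[OF up assms(2)] by blast
  show ?thesis
    unfolding near_extremal_def
  proof (intro allI impI)
    fix e \<delta> :: real and m assume "e > 0" "\<delta> > 0"
    have "\<forall>\<^sub>F j in sequentially. \<nu> j \<ge> m" using \<nu> by (auto simp: filterlim_at_top)
    moreover have "\<forall>\<^sub>F j in sequentially. mean_dist (\<nu> j) (fiber_iter pair_step w n (y j)) > a - e"
      using order_tendstoD(1)[OF extremal_sequence_fiber_iter[OF up \<nu> v assms(3)]] \<open>e > 0\<close> by simp
    moreover have "\<forall>\<^sub>F j in sequentially. dist (fiber_iter pair_step w n (y j)) (fiber_iter pair_step w n z) < \<delta>"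
      using tendstoD[OF tendsto_fiber_iter_pair[OF y assms(3)] \<open>\<delta> > 0\<close>] .
    ultimately have "\<forall>\<^sub>F j in sequentially. \<nu> j \<ge> m \<and>
        dist (fiber_iter pair_step w n (y j)) (fiber_iter pair_step w n z) < \<delta> \<and>
        mean_dist (\<nu> j) (fiber_iter pair_step w n (y j)) > a - e"
      by eventually_elim simp
    then obtain j where "\<nu> j \<ge> m \<and>
        dist (fiber_iter pair_step w n (y j)) (fiber_iter pair_step w n z) < \<delta> \<and>
        mean_dist (\<nu> j) (fiber_iter pair_step w n (y j)) > a - e"
      using eventually_happens[of _ sequentially] by auto
    then show "\<exists>k\<ge>m. \<exists>z'. dist z' (fiber_iter pair_step w n z) < \<delta> \<and> mean_dist k z' > a - e"
      by blast
  qed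
qed

text \<open>Proximality moves the extremal pair to the diagonal, and every point of the orbit of the
  limit carries an arc of mean length close to \<open>a\<close>. As these arcs may be taken disjoint, the orbit is
  finite.\<close>

lemma no_extremal_diagonal:
  assumes up: "\<And>e. e > 0 \<Longrightarrow> \<exists>m. \<forall>n\<ge>m. \<forall>z. mean_dist n z \<le> a + e"
    and "near_extremal a (x, x)" "a > 0"
  shows False
proof -
  obtain \<nu> y where \<nu>: "filterlim \<nu> at_top sequentially" and y: "y \<longlonglongrightarrow> (x, x)"
    and v: "(\<lambda>j. mean_dist (\<nu> j) (y j)) \<longlonglongrightarrow> a"
    using near_extremal_sequence[OF up assms(2)] by blast
  define orbit where "orbit = {fiber_iter f w n x | w n. \<forall>k. w k < N}"
  have card: "card K * a \<le> 1" if K: "finite K" "K \<subseteq> orbit" for K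
  proof -
    have "\<exists>w n. fiber_iter f w n x = o' \<and> (\<forall>k. w k < N)" if "o' \<in> K" for o'
      using that K(2) unfolding orbit_def by blast
    then obtain w n where wn: "\<And>o'. o' \<in> K \<Longrightarrow> fiber_iter f (w o') (n o') x = o'"
      "\<And>o' k. o' \<in> K \<Longrightarrow> w o' k < N"
      by metis
    define q where "q o' j = fiber_iter pair_step (w o') (n o') (y j)" for o' j
    have q: "q o' \<longlonglongrightarrow> (o', o')" if "o' \<in> K" for o'
      using tendsto_fiber_iter_pair[OF y, of "w o'" "n o'"] wn(1)[OF that] wn(2)[OF that]
      unfolding q_def fiber_iter_pair_step by simp
    have qv: "(\<lambda>j. mean_dist (\<nu> j) (q o' j)) \<longlonglongrightarrow> a" if "o' \<in> K" for o'
      unfolding q_def by (intro extremal_sequence_fiber_iter[OF up \<nu> v] wn(2)[OF that])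
    obtain \<rho> where \<rho>: "\<rho> > 0" "disjoint_family_on (\<lambda>x. {coord x - \<rho>..coord x + \<rho>}) K"
      "\<And>x. x \<in> K \<Longrightarrow> {coord x - \<rho>..coord x + \<rho>} \<subseteq> {- \<rho>..- \<rho> + 1}"
      using separated_intervals[OF K(1)] by blast
    have "\<forall>\<^sub>F j in sequentially. \<forall>o'\<in>K. dist o' (fst (q o' j)) < \<rho> \<and> dist o' (snd (q o' j)) < \<rho>"
    proof (intro eventually_ball_finite K(1) ballI eventually_conj)
      fix o' assume "o' \<in> K"
      show "\<forall>\<^sub>F j in sequentially. dist o' (fst (q o' j)) < \<rho>"
        using tendstoD[OF tendsto_fst[OF q[OF \<open>o' \<in> K\<close>]] \<rho>(1)] by (simp add: dist_commute)
      show "\<forall>\<^sub>F j in sequentially. dist o' (snd (q o' j)) < \<rho>"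
        using tendstoD[OF tendsto_snd[OF q[OF \<open>o' \<in> K\<close>]] \<rho>(1)] by (simp add: dist_commute)
    qed
    \<comment> \<open>All pairs \<open>q o' j\<close> are evaluated at the same time
      \<open>\<nu> j\<close>, and both entries have representatives in the interval around
      \<open>coord o'\<close>; these intervals are disjoint.\<close>
    then have "\<forall>\<^sub>F j in sequentially. (\<Sum>o'\<in>K. mean_dist (\<nu> j) (q o' j)) \<le> 1"
    proof eventually_elim
      case (elim j)
      have *: "\<exists>t. circle_proj t = z \<and> t \<in> {coord o' - \<rho>..coord o' + \<rho>}" if "dist o' z < \<rho>" for o' z
      proof -
        obtain t where "circle_proj t = z" "\<bar>coord o' - t\<bar> = dist (circle_proj (coord o')) z"
          by (rule circle_proj_surj_near)
        with that show ?thesis by (intro exI[of _ t]) auto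
      qed
      have "\<forall>o'\<in>K. \<exists>s. circle_proj s = fst (q o' j) \<and> s \<in> {coord o' - \<rho>..coord o' + \<rho>}"
        "\<forall>o'\<in>K. \<exists>t. circle_proj t = snd (q o' j) \<and> t \<in> {coord o' - \<rho>..coord o' + \<rho>}"
        using elim * by blast+
      then obtain s t where st:
          "\<And>o'. o' \<in> K \<Longrightarrow> circle_proj (s o') = fst (q o' j) \<and> s o' \<in> {coord o' - \<rho>..coord o' + \<rho>}"
          "\<And>o'. o' \<in> K \<Longrightarrow> circle_proj (t o') = snd (q o' j) \<and> t o' \<in> {coord o' - \<rho>..coord o' + \<rho>}"
        unfolding bchoice_iff by blast
      have "(\<Sum>o'\<in>K. mean_dist (\<nu> j) (q o' j)) = (\<Sum>o'\<in>K. mean_dist (\<nu> j) (circle_proj (s o'), circle_proj (t o')))"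
        using st by (intro sum.cong refl) (metis prod.collapse)
      also have "\<dots> \<le> 1"
        using st by (intro sum_mean_dist_le_1[OF K(1) \<rho>(2) \<rho>(3)]) auto
      finally show ?case .
    qed
    moreover have "(\<lambda>j. \<Sum>o'\<in>K. mean_dist (\<nu> j) (q o' j)) \<longlonglongrightarrow> (\<Sum>o'\<in>K. a)"
      by (intro tendsto_sum qv)
    ultimately have "(\<Sum>o'\<in>K. a) \<le> 1"
      by (intro tendsto_upperbound[of _ "\<Sum>o'\<in>K. a" sequentially 1]) simp_all
    then show ?thesis by simp
  qed
  have "finite orbit"
  proof (rule ccontr)
    assume "infinite orbit"
    then obtain K where K: "K \<subseteq> orbit" "finite K" "card K = nat \<lceil>1 / a\<rceil> + 1"
      using infinite_arbitrarily_large by blast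
    have "1 / a < real (card K)" unfolding K(3) by linarith
    then show False using card[OF K(2,1)] \<open>a > 0\<close> by (simp add: field_simps)
  qed
  moreover have "x \<in> orbit"
    unfolding orbit_def using N_pos by (auto intro!: exI[of _ "\<lambda>_. 0"] exI[of _ 0])
  moreover have "f i ` orbit \<subseteq> orbit" if "i < N" for i
  proof (intro image_subsetI)
    fix z assume "z \<in> orbit"
    then obtain w n where w: "z = fiber_iter f w n x" "\<And>k. w k < N" by (auto simp: orbit_def)
    \<comment> \<open>The symbol at position \<open>n\<close> does not affect the first
      \<open>n\<close> steps, so it may be chosen to be \<open>i\<close>.\<close>
    have "fiber_iter f (w(n := i)) n x = fiber_iter f w n x"
      by (rule finitaryD[OF finitary_fiber_iter[of n "\<lambda>x. x"]]) simp
    then have "f i z = fiber_iter f (w(n := i)) (Suc n) x" using w by simp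
    moreover have "\<forall>k. (w(n := i)) k < N" using w(2) that by simp
    ultimately show "f i z \<in> orbit" unfolding orbit_def by blast
  qed
  ultimately show False using no_finite_invariant_set[of orbit] by auto
qed

text \<open>\<open>A\<close> consists of the eventual uniform upper bounds of the means, so
  \<open>a\<close> is the limit superior of their suprema; \<open>up\<close> and \<open>low\<close>
  are its two characterizing properties. Failure of the claim makes \<open>a\<close> at least
  \<eta>.\<close>

lemma mean_dist_tendsto_0:
  assumes "\<eta> > 0"
  shows "\<exists>m. \<forall>n\<ge>m. \<forall>z. mean_dist n z \<le> \<eta>"
proof (rule ccontr)
  assume neg: "\<not> ?thesis"
  define A where "A = {a. \<exists>m. \<forall>n\<ge>m. \<forall>z. mean_dist n z \<le> a}"
  have "1 / 2 \<in> A" using mean_dist_le by (auto simp: A_def)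
  have A_ge: "\<eta> \<le> a" if aA: "a \<in> A" for a
  proof (rule ccontr)
    assume "\<not> \<eta> \<le> a"
    moreover obtain m where "\<And>n z. n \<ge> m \<Longrightarrow> mean_dist n z \<le> a" using aA unfolding A_def by blast
    ultimately have "\<forall>n\<ge>m. \<forall>z. mean_dist n z \<le> \<eta>" by (meson linorder_le_cases order.trans)
    with neg show False by blast
  qed
  define a where "a = Inf A"
  have "\<eta> \<le> a" unfolding a_def using \<open>1 / 2 \<in> A\<close> A_ge by (intro cInf_greatest) auto
  then have "a > 0" using assms by simp
  have bdd: "bdd_below A" using A_ge by (auto simp: bdd_below_def)
  have up: "\<exists>m. \<forall>n\<ge>m. \<forall>z. mean_dist n z \<le> a + e" if "e > 0" for e
  proof -
    have "Inf A < a + e" "A \<noteq> {}" using that \<open>1 / 2 \<in> A\<close> by (auto simp: a_def)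
    then obtain b where "b \<in> A" "b < a + e" using cInf_lessD by blast
    moreover from \<open>b \<in> A\<close> obtain m where "\<And>n z. n \<ge> m \<Longrightarrow> mean_dist n z \<le> b" unfolding A_def by blast
    ultimately show ?thesis by (meson less_imp_le order.trans)
  qed
  have low: "\<exists>n\<ge>m. \<exists>z. mean_dist n z > a - e" if "e > 0" for e m
  proof (rule ccontr)
    assume "\<not> ?thesis"
    then have "\<forall>n\<ge>m. \<forall>z. mean_dist n z \<le> a - e" by (meson not_less)
    then have "a - e \<in> A" unfolding A_def by blast
    then have "a \<le> a - e" unfolding a_def using bdd by (intro cInf_lower)
    with that show False by simp
  qed
  have "\<exists>n z. n \<ge> j \<and> mean_dist n z > a - 1 / Suc j" for j
    using low[of "1 / Suc j" j] by auto
  then obtain \<nu> y where \<nu>: "\<And>j. \<nu> j \<ge> j" and v: "\<And>j. mean_dist (\<nu> j) (y j) > a - 1 / Suc j"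
    by metis
  obtain l r where lr: "strict_mono (r :: nat \<Rightarrow> nat)" "(y \<circ> r) \<longlonglongrightarrow> l"
    using compact_imp_seq_compact[OF compact_circle_pairs] unfolding seq_compact_def by (metis UNIV_I)
  have ext: "near_extremal a l"
    unfolding near_extremal_def
  proof (intro allI impI)
    fix e \<delta> :: real and m assume "e > 0" "\<delta> > 0"
    obtain j1 where j1: "\<And>j. j \<ge> j1 \<Longrightarrow> dist (y (r j)) l < \<delta>"
      using lr(2) \<open>\<delta> > 0\<close> unfolding lim_sequentially by (auto simp: comp_def)
    obtain j2 where j2: "1 / real (Suc j2) < e" using \<open>e > 0\<close> nat_approx_posE by metis
    define j where "j = max (max j1 j2) m"
    have rj: "j \<le> r j" using seq_suble[OF lr(1)] .
    have "1 / real (Suc (r j)) \<le> 1 / real (Suc j2)" using rj by (intro divide_left_mono) (auto simp: j_def)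
    then have "mean_dist (\<nu> (r j)) (y (r j)) > a - e" using v[of "r j"] j2 by linarith
    moreover have "\<nu> (r j) \<ge> m" using \<nu>[of "r j"] rj by (simp add: j_def)
    moreover have "dist (y (r j)) l < \<delta>" using j1 by (simp add: j_def)
    ultimately show "\<exists>n\<ge>m. \<exists>z'. dist z' l < \<delta> \<and> mean_dist n z' > a - e" by blast
  qed
  \<comment> \<open>Proximality gives convergence of the distances along some times; a further
    subsequence makes the pairs themselves converge, necessarily to the diagonal, and closedness
    keeps the limit near extremal.\<close>
  obtain w s where w: "\<And>n. w n < N" "strict_mono s"
    and prox: "(\<lambda>k. dist (fiber_iter f w (s k) (fst l)) (fiber_iter f w (s k) (snd l))) \<longlonglongrightarrow> 0"
    using proximal unfolding proximal_def by metis
  define q where "q k = fiber_iter pair_step w (s k) l" for k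
  obtain l' r' where lr': "strict_mono (r' :: nat \<Rightarrow> nat)" "(q \<circ> r') \<longlonglongrightarrow> l'"
    using compact_imp_seq_compact[OF compact_circle_pairs] unfolding seq_compact_def by (metis UNIV_I)
  have "near_extremal a l'"
    by (rule near_extremal_limit[OF _ lr'(2)]) (simp add: q_def near_extremal_fiber_iter[OF up ext w(1)])
  moreover have "dist (fst l') (snd l') = 0"
  proof (rule LIMSEQ_unique)
    show "(\<lambda>k. dist (fst (q (r' k))) (snd (q (r' k)))) \<longlonglongrightarrow> dist (fst l') (snd l')"
      using lr'(2) by (intro tendsto_intros) (auto simp: comp_def)
    show "(\<lambda>k. dist (fst (q (r' k))) (snd (q (r' k)))) \<longlonglongrightarrow> 0"
      using LIMSEQ_subseq_LIMSEQ[OF prox lr'(1)] by (simp add: q_def fiber_iter_pair_step comp_def)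
  qed
  ultimately have "near_extremal a (fst l', fst l')" by (metis dist_eq_0_iff prod.collapse)
  then show False using no_extremal_diagonal[OF up] \<open>a > 0\<close> by blast
qed

end

section \<open>Borel probability measures on the circle\<close>

text \<open>\<open>coord\<close> jumps at 0, but its sublevel sets are closed: empty, the whole
  circle, or the compact image of \<open>{0..a}\<close>.\<close>

lemma borel_measurable_coord: "coord \<in> borel_measurable borel"
proof (rule borel_measurableI_le)
  fix a :: real
  consider "a < 0" | "a \<ge> 1" | "0 \<le> a" "a < 1" by linarith
  then have "closed {x. coord x \<le> a}"
  proof cases
    case 1
    then have "{x. coord x \<le> a} = {}" using coord_ge_0 by (auto simp: not_le intro: less_le_trans)
    then show ?thesis by simp
  next
    case 2
    then have "{x. coord x \<le> a} = UNIV" using coord_lt_1 by (auto intro: less_imp_le less_le_trans)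
    then show ?thesis by simp
  next
    case 3
    have "{x. coord x \<le> a} = circle_proj ` {0..a}"
    proof (intro equalityI subsetI)
      fix x assume "x \<in> {x. coord x \<le> a}"
      then show "x \<in> circle_proj ` {0..a}"
        using coord_ge_0[of x] by (intro image_eqI[of _ _ "coord x"]) auto
    next
      fix x assume "x \<in> circle_proj ` {0..a}"
      then obtain t where "x = circle_proj t" "0 \<le> t" "t \<le> a" by auto
      moreover from this have "frac t = t" using 3 by (simp add: frac_eq)
      ultimately show "x \<in> {x. coord x \<le> a}" by (simp add: coord_circle_proj)
    qed
    moreover have "compact (circle_proj ` {0..a})"
      by (intro compact_continuous_image continuous_on_circle_proj continuous_on_id) simp
    ultimately show ?thesis by (simp add: compact_imp_closed)
  qed
  then show "{x \<in> space borel. coord x \<le> a} \<in> sets borel" by simp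
qed

lemma borel_measurable_circle_proj: "circle_proj \<in> borel_measurable borel"
  by (intro borel_measurable_continuous_onI continuous_on_circle_proj continuous_on_id)

lemma borel_probD:
  assumes "borel_prob m"
  shows "prob_space m" "sets m = sets borel" "space m = UNIV"
  using assms sets_eq_imp_space_eq[of m borel] by (auto simp: borel_prob_def)

lemma borel_prob_measurable:
  "borel_prob m \<Longrightarrow> v \<in> borel_measurable borel \<Longrightarrow> v \<in> borel_measurable m"
  using measurable_cong_sets[OF borel_probD(2) refl] by blast

lemma borel_prob_distr:
  assumes "prob_space m" "g \<in> borel_measurable m"
  shows "borel_prob (distr m borel g)"
  using prob_space.prob_space_distr[OF assms] by (simp add: borel_prob_def)

lemma integrable_continuous_circle:
  fixes v :: "circle \<Rightarrow> real"
  assumes m: "borel_prob m" and v: "continuous_on UNIV v"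
  shows "integrable m v"
proof -
  interpret prob_space m by (rule borel_probD[OF m])
  obtain B where "\<And>x. \<bar>v x\<bar> \<le> B" using continuous_on_circle_bounded[OF v] by blast
  then show ?thesis
    by (intro integrable_const_bound[of _ B] borel_prob_measurable[OF m] borel_measurable_continuous_onI v) auto
qed

text \<open>Helly selection on the line for the laws of the coordinate, which all live on the unit
  interval. A limit may charge the point 1; projecting it back to the circle identifies 1 with 0,
  and test functions that factor through \<open>circle_proj\<close> do not see the
  difference.\<close>

lemma circle_weak_compactness:
  assumes m: "\<And>n. borel_prob (m n :: circle measure)"
  obtains r l where "strict_mono (r :: nat \<Rightarrow> nat)" "borel_prob l"
    "\<And>v :: circle \<Rightarrow> real. continuous_on UNIV v \<Longrightarrow> (\<lambda>n. integral\<^sup>L (m (r n)) v) \<longlonglongrightarrow> integral\<^sup>L l v"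
proof -
  define M where "M n = distr (m n) borel coord" for n
  have coord: "coord \<in> borel_measurable (m n)" for n
    by (intro borel_prob_measurable[OF m] borel_measurable_coord)
  have M: "real_distribution (M n)" for n
    unfolding M_def by (intro prob_space.real_distribution_distr borel_probD(1)[OF m] coord)
  have "tight M"
    unfolding tight_def
  proof (intro conjI allI impI)
    fix \<epsilon> :: real assume "\<epsilon> > 0"
    have "measure (M n) {-1<..1} = 1" for n
    proof -
      have "coord -` {-1<..1} \<inter> space (m n) = space (m n)"
      proof -
        have "coord x \<in> {-1<..1}" for x using coord_ge_0[of x] coord_lt_1[of x] by simp
        then show ?thesis by blast
      qed
      then show ?thesis
        unfolding M_def by (subst measure_distr[OF coord]) (auto simp: prob_space.prob_space[OF borel_probD(1)[OF m]])
    qed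
    then show "\<exists>a b. a < b \<and> (\<forall>n. 1 - \<epsilon> < measure (M n) {a<..b})"
      using \<open>\<epsilon> > 0\<close> by (intro exI[of _ "-1"] exI[of _ 1]) auto
  qed (rule M)
  from tight_imp_convergent_subsubsequence[OF this strict_mono_id] obtain r l
    where r: "strict_mono r" and l: "real_distribution l" and conv: "weak_conv_m (M \<circ> r) l" by auto
  interpret l: real_distribution l by (rule l)
  have proj: "circle_proj \<in> borel_measurable l"
    using borel_measurable_circle_proj by simp
  show thesis
  proof (rule that[OF r])
    show "borel_prob (distr l borel circle_proj)"
      by (rule borel_prob_distr[OF l.prob_space_axioms proj])
    fix v :: "circle \<Rightarrow> real" assume v: "continuous_on UNIV v"
    obtain B where B: "\<And>x. \<bar>v x\<bar> \<le> B" using continuous_on_circle_bounded[OF v] by blast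
    have cont: "continuous_on UNIV (\<lambda>t. v (circle_proj t))"
      by (intro continuous_on_compose2[OF v] continuous_intros) auto
    have v_meas: "v \<in> borel_measurable borel" by (intro borel_measurable_continuous_onI v)
    have "(\<lambda>n. integral\<^sup>L ((M \<circ> r) n) (\<lambda>t. v (circle_proj t))) \<longlonglongrightarrow> integral\<^sup>L l (\<lambda>t. v (circle_proj t))"
      using B cont M by (intro weak_conv_imp_integral_bdd_continuous_conv[OF _ l conv, of _ B])
        (auto simp: continuous_on_eq_continuous_at)
    moreover have "integral\<^sup>L ((M \<circ> r) n) (\<lambda>t. v (circle_proj t)) = integral\<^sup>L (m (r n)) v" for n
      unfolding M_def comp_def
      by (subst integral_distr[OF coord])
        (auto intro!: borel_measurable_continuous_onI cont)
    moreover have "integral\<^sup>L l (\<lambda>t. v (circle_proj t)) = integral\<^sup>L (distr l borel circle_proj) v"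
      by (rule integral_distr[OF proj v_meas, symmetric])
    ultimately show "(\<lambda>n. integral\<^sup>L (m (r n)) v) \<longlonglongrightarrow> integral\<^sup>L (distr l borel circle_proj) v"
      by simp
  qed
qed

section \<open>Lipschitz test functions determine a measure\<close>

lemma closed_indicator_lipschitz_limit:
  fixes A :: "'a::metric_space set"
  assumes "closed A" "A \<noteq> {}"
  shows "(\<lambda>k. max 0 (1 - real k * infdist x A)) \<longlonglongrightarrow> indicator A x"
proof (cases "x \<in> A")
  case True
  then show ?thesis by simp
next
  case False
  then have pos: "infdist x A > 0"
    using in_closed_iff_infdist_zero[OF assms, of x] infdist_nonneg[of x A] by auto
  have "\<forall>\<^sub>F k in sequentially. max 0 (1 - real k * infdist x A) = indicator A x"
    using eventually_ge_at_top[of "nat \<lceil>1 / infdist x A\<rceil>"]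
  proof eventually_elim
    case (elim k)
    then have "1 / infdist x A \<le> real k" by linarith
    then have "1 - real k * infdist x A \<le> 0" using pos by (simp add: field_simps)
    then show ?case using False by simp
  qed
  then show ?thesis by (rule tendsto_eventually)
qed

text \<open>Closed sets form an intersection-stable generator, and their indicators are bounded
  pointwise limits of Lipschitz functions. Lipschitz functions are the right class here because
  contraction gives convergence for Hoelder functions.\<close>

lemma borel_prob_eqI_lipschitz:
  fixes m m' :: "'a::metric_space measure"
  assumes m: "borel_prob m" and m': "borel_prob m'"
    and eq: "\<And>L v. (\<And>x. 0 \<le> v x \<and> v x \<le> 1) \<Longrightarrow> (\<And>x y. \<bar>v x - v y\<bar> \<le> L * dist x y) \<Longrightarrow>
      integral\<^sup>L m v = (integral\<^sup>L m' v :: real)"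
  shows "m = m'"
proof -
  have lim: "(\<lambda>k. \<integral>x. max 0 (1 - real k * infdist x A) \<partial>n) \<longlonglongrightarrow> measure n A"
    if n: "borel_prob n" and A: "closed A" "A \<noteq> {}" for n and A :: "'a set"
  proof -
    interpret prob_space n by (rule borel_probD[OF n])
    have "(\<lambda>k. \<integral>x. max 0 (1 - real k * infdist x A) \<partial>n) \<longlonglongrightarrow> (\<integral>x. indicator A x \<partial>n)"
    proof (rule integral_dominated_convergence[where w="\<lambda>_. 1"])
      show "AE x in n. (\<lambda>k. max 0 (1 - real k * infdist x A)) \<longlonglongrightarrow> indicator A x"
        using closed_indicator_lipschitz_limit[OF A] by simp
      show "AE x in n. norm (max 0 (1 - real k * infdist x A)) \<le> 1" for k
        by (simp add: infdist_nonneg)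
      show "(\<lambda>x. max 0 (1 - real k * infdist x A)) \<in> borel_measurable n" for k
        by (intro borel_prob_measurable[OF n] borel_measurable_continuous_onI continuous_intros)
      show "indicator A \<in> borel_measurable n"
        using A borel_probD[OF n] by (intro borel_measurable_indicator) simp
    qed simp
    then show ?thesis using A borel_probD[OF n] by simp
  qed
  have meas: "measure m A = measure m' A" if A: "closed A" for A
  proof (cases "A = {}")
    case False
    have "integral\<^sup>L m (\<lambda>x. max 0 (1 - real k * infdist x A)) = integral\<^sup>L m' (\<lambda>x. max 0 (1 - real k * infdist x A))" for k
    proof (rule eq)
      fix x y
      have "\<bar>max 0 (1 - real k * infdist x A) - max 0 (1 - real k * infdist y A)\<bar>
          \<le> \<bar>real k * (infdist x A - infdist y A)\<bar>"
        by (simp add: max_def algebra_simps abs_if)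
      also have "\<dots> \<le> real k * dist x y"
        unfolding abs_mult by (intro mult_mono infdist_triangle_abs) auto
      finally show "\<bar>max 0 (1 - real k * infdist x A) - max 0 (1 - real k * infdist y A)\<bar> \<le> real k * dist x y" .
    qed (simp add: infdist_nonneg)
    then show ?thesis using LIMSEQ_unique lim[OF m A False] lim[OF m' A False] by simp
  qed simp
  show ?thesis
  proof (rule measure_eqI_generator_eq[where E="Collect closed" and \<Omega>=UNIV and A="\<lambda>_. UNIV"])
    show "Int_stable (Collect closed :: 'a set set)" by (auto simp: Int_stable_def)
    show "sets m = sigma_sets UNIV (Collect closed)" "sets m' = sigma_sets UNIV (Collect closed)"
      using borel_probD[OF m] borel_probD[OF m'] by (auto simp: borel_eq_closed)
    interpret M: prob_space m by (rule borel_probD[OF m])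
    interpret M': prob_space m' by (rule borel_probD[OF m'])
    show "emeasure m X = emeasure m' X" if "X \<in> Collect closed" for X
      using meas[of X] that by (simp add: M.emeasure_eq_measure M'.emeasure_eq_measure)
    show "emeasure m UNIV \<noteq> \<infinity>" by (simp add: M.emeasure_eq_measure)
  qed auto
qed

lemma lipschitz_imp_continuous_on:
  fixes v :: "'a::metric_space \<Rightarrow> real"
  assumes "\<And>x y. \<bar>v x - v y\<bar> \<le> L * dist x y"
  shows "continuous_on UNIV v"
proof -
  have "(max L 0)-lipschitz_on UNIV v"
  proof (rule lipschitz_onI)
    fix x y
    show "dist (v x) (v y) \<le> max L 0 * dist x y"
      using assms[of x y] mult_right_mono[of L "max L 0" "dist x y"] by (simp add: dist_real_def)
  qed simp
  then show ?thesis by (rule lipschitz_on_continuous_on)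
qed

section \<open>Lebesgue measure and change of variables\<close>

definition circle_lebesgue :: "circle measure" where
  "circle_lebesgue = distr (uniform_measure lborel {0..1}) borel circle_proj"

lemma measurable_circle_proj_uniform:
  "circle_proj \<in> borel_measurable (uniform_measure lborel {0..1})"
proof -
  have "sets (uniform_measure lborel {0..1::real}) = sets borel" by simp
  then show ?thesis
    using borel_measurable_circle_proj measurable_cong_sets[OF _ refl] by blast
qed

lemma borel_prob_circle_lebesgue: "borel_prob circle_lebesgue"
  unfolding circle_lebesgue_def
  by (intro borel_prob_distr prob_space_uniform_measure measurable_circle_proj_uniform) auto

lemma integral_circle_lebesgue:
  fixes v :: "circle \<Rightarrow> real"
  assumes v: "continuous_on UNIV v"
  shows "integral\<^sup>L circle_lebesgue v = integral {0..1} (\<lambda>t. v (circle_proj t))"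
proof -
  have cont: "continuous_on UNIV (\<lambda>t. v (circle_proj t))"
    by (intro continuous_on_compose2[OF v] continuous_intros) auto
  have [measurable]: "(\<lambda>t. v (circle_proj t)) \<in> borel_measurable borel"
    by (intro borel_measurable_continuous_onI cont)
  have "integral\<^sup>L circle_lebesgue v = (\<integral>t. v (circle_proj t) \<partial>uniform_measure lborel {0..1})"
    unfolding circle_lebesgue_def
    by (intro integral_distr borel_measurable_continuous_onI v measurable_circle_proj_uniform)
  also have "\<dots> = (LINT t:{0..1}|lborel. v (circle_proj t))"
  proof -
    have "uniform_measure lborel {0..1::real} = density lborel (\<lambda>t. ennreal (indicator {0..1} t :: real))"
    proof -
      have one: "emeasure lborel {0..1::real} = 1" by simp
      show ?thesis
        unfolding uniform_measure_def one ennreal_indicator divide_ennreal_def by simp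
    qed
    then show ?thesis
      by (simp add: integral_density set_lebesgue_integral_def)
  qed
  also have "\<dots> = integral {0..1} (\<lambda>t. v (circle_proj t))"
    by (intro set_borel_integral_eq_integral borel_integrable_atLeastAtMost' continuous_on_subset[OF cont]) simp
  finally show ?thesis .
qed

lemma circle_change_of_variables:
  fixes F :: "circle \<Rightarrow> real"
  assumes g: "circle_C1_diffeo g" and F: "continuous_on UNIV F"
  shows "(\<integral>x. \<bar>circle_deriv g x\<bar> * F (g x) \<partial>circle_lebesgue) = integral\<^sup>L circle_lebesgue F"
proof -
  obtain G where G: "monotone_circle_lift g G" and G':
    "\<And>t. (G has_real_derivative circle_deriv g (circle_proj t)) (at t)"
    using circle_C1_diffeo_lift[OF g] by blast
  have cd: "continuous_on UNIV (circle_deriv g)"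
    using g by (simp add: circle_C1_diffeo_def circle_C1_def)
  have cdp: "continuous_on UNIV (\<lambda>t. circle_deriv g (circle_proj t))"
    by (intro continuous_on_compose2[OF cd] continuous_intros) auto
  obtain s where s: "\<bar>s\<bar> = 1" "\<And>t. G (t + 1) = G t + s"
    using G by (auto simp: monotone_circle_lift_def)
  have lift: "circle_proj (G t) = g (circle_proj t)" for t
    using G by (simp add: monotone_circle_lift_def circle_lift_def)
  \<comment> \<open>The derivative is continuous without zeros, so \<sigma> is its constant
    sign.\<close>
  have "\<exists>\<sigma>. \<bar>\<sigma>\<bar> = 1 \<and> (\<forall>t. \<bar>circle_deriv g (circle_proj t)\<bar> = \<sigma> * circle_deriv g (circle_proj t))"
  proof (cases "circle_deriv g (circle_proj 0) > 0")
    case True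
    have "circle_deriv g (circle_proj t) > 0" for t
    proof (rule ccontr)
      assume "\<not> ?thesis"
      then have "\<exists>x. circle_deriv g (circle_proj x) = 0"
        using connectedD_interval[OF connected_continuous_image[OF cdp connected_UNIV],
            of "circle_deriv g (circle_proj t)" "circle_deriv g (circle_proj 0)" 0] True by force
      then show False using circle_deriv_nonzero[OF g] by blast
    qed
    then show ?thesis by (intro exI[of _ 1]) (simp add: less_imp_le)
  next
    case False
    have "circle_deriv g (circle_proj t) < 0" for t
    proof (rule ccontr)
      assume "\<not> ?thesis"
      then have "\<exists>x. circle_deriv g (circle_proj x) = 0"
        using connectedD_interval[OF connected_continuous_image[OF cdp connected_UNIV],
            of "circle_deriv g (circle_proj 0)" "circle_deriv g (circle_proj t)" 0] False by force
      then show False using circle_deriv_nonzero[OF g] by blast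
    qed
    then show ?thesis by (intro exI[of _ "-1"]) (simp add: less_imp_le)
  qed
  then obtain \<sigma> where \<sigma>: "\<bar>\<sigma>\<bar> = 1"
    "\<And>t. \<bar>circle_deriv g (circle_proj t)\<bar> = \<sigma> * circle_deriv g (circle_proj t)"
    by blast
  have sigma: "\<sigma> = 1 \<or> \<sigma> = -1" and s_cases: "s = 1 \<or> s = -1" using \<sigma>(1) s(1) by linarith+
  have key: "integral {0..1} (\<lambda>t. \<bar>circle_deriv g (circle_proj t)\<bar> * F (circle_proj (G t)))
      = \<sigma> * s * integral {0..1} (\<lambda>t. F (circle_proj t))" if F: "continuous_on UNIV F" for F :: "circle \<Rightarrow> real"
  proof -
    have cF: "continuous_on UNIV (\<lambda>t. F (circle_proj t))"
      by (intro continuous_on_compose2[OF F] continuous_intros) auto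
    obtain A where A: "\<And>t. (A has_real_derivative F (circle_proj t)) (at t)"
      using einterval_antiderivative[of "-\<infinity>" "\<infinity>" "\<lambda>t. F (circle_proj t)"] cF
      by (auto simp: continuous_on_eq_continuous_at has_real_derivative_iff_has_vector_derivative)
    have "((\<lambda>t. A (t + 1) - A t) has_real_derivative 0) (at t)" for t
    proof -
      have "((\<lambda>t. A (t + 1)) has_real_derivative F (circle_proj t)) (at t)"
        using A[of "t + 1"] by (simp add: DERIV_shift)
      from DERIV_diff[OF this A[of t]] show ?thesis by simp
    qed
    then have const: "A (t + 1) - A t = A (0 + 1) - A 0" for t
      using DERIV_isconst_all[of "\<lambda>t. A (t + 1) - A t" t 0] by simp
    \<comment> \<open>A primitive of a periodic function gains the same amount over every period;
      the gain is reversed when the degree \<open>s\<close> is -1.\<close>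
    then have per: "A (t + s) - A t = s * (A 1 - A 0)" for t
      using s_cases const[of t] const[of "t - 1"] by auto
    have "((\<lambda>t. F (circle_proj t)) has_integral (A 1 - A 0)) {0..1}"
      using fundamental_theorem_of_calculus[of 0 1 A "\<lambda>t. F (circle_proj t)"]
        has_vector_derivative_at_within[OF A[unfolded has_real_derivative_iff_has_vector_derivative]]
      by simp
    then have I1: "integral {0..1} (\<lambda>t. F (circle_proj t)) = A 1 - A 0" by (rule integral_unique)
    have "((\<lambda>t. \<sigma> * A (G t)) has_real_derivative \<bar>circle_deriv g (circle_proj t)\<bar> * F (circle_proj (G t))) (at t)" for t
      using DERIV_cmult[OF DERIV_chain2[OF A G'], of \<sigma> t] \<sigma>(2)[of t] by (simp add: mult_ac)
    then have "((\<lambda>t. \<sigma> * A (G t)) has_vector_derivative \<bar>circle_deriv g (circle_proj t)\<bar> * F (circle_proj (G t)))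
        (at t within {0..1})" for t
      unfolding has_real_derivative_iff_has_vector_derivative by (rule has_vector_derivative_at_within)
    then have "((\<lambda>t. \<bar>circle_deriv g (circle_proj t)\<bar> * F (circle_proj (G t))) has_integral
        (\<sigma> * A (G 1) - \<sigma> * A (G 0))) {0..1}"
      using fundamental_theorem_of_calculus[of 0 1 "\<lambda>t. \<sigma> * A (G t)"] by simp
    then have "integral {0..1} (\<lambda>t. \<bar>circle_deriv g (circle_proj t)\<bar> * F (circle_proj (G t)))
        = \<sigma> * A (G 1) - \<sigma> * A (G 0)"
      by (rule integral_unique)
    also have "\<dots> = \<sigma> * (A (G 1) - A (G 0))"
      by (rule right_diff_distrib[symmetric])
    also have "A (G 1) - A (G 0) = s * (A 1 - A 0)"
      using per[of "G 0"] s(2)[of 0] by simp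
    finally show ?thesis by (simp add: I1)
  qed
  \<comment> \<open>Testing with the constant 1 shows that the sign \<sigma> and the degree
    \<open>s\<close> agree.\<close>
  have "0 \<le> integral {0..1} (\<lambda>t. \<bar>circle_deriv g (circle_proj t)\<bar> * 1)"
    by (intro integral_nonneg integrable_continuous_interval continuous_intros continuous_on_subset[OF cdp]) auto
  then have "0 \<le> \<sigma> * s" using key[of "\<lambda>_. 1"] by simp
  then have 1: "\<sigma> * s = 1" using sigma s_cases by auto
  have cg: "continuous_on UNIV g" by (rule circle_C1_diffeo_continuous[OF g])
  have "continuous_on UNIV (\<lambda>x. \<bar>circle_deriv g x\<bar> * F (g x))"
    by (intro continuous_intros cd continuous_on_compose2[OF F cg]) auto
  then show ?thesis
    using key[OF F] 1 by (simp add: integral_circle_lebesgue F lift)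
qed

section \<open>The drift of the derivative cocycle\<close>

text \<open>Quantitative strict concavity of the logarithm. With s the modulus of
  \<open>sqrt u - 1\<close>, the tangent bound at \<open>sqrt u\<close> gives that
  \<open>u - 1 - ln u\<close> is at least the square of s, while \<open>\<bar>u - 1\<bar>\<close> is
  at most s (s + 2); Young's inequality with parameter \<delta> handles the term linear in
  s.\<close>

lemma abs_diff_one_le:
  fixes u \<delta> :: real
  assumes "u > 0" "\<delta> > 0"
  shows "\<bar>u - 1\<bar> \<le> \<delta> + (1 + 1 / \<delta>) * (u - 1 - ln u)"
proof -
  define s where "s = \<bar>sqrt u - 1\<bar>"
  have "ln (sqrt u) \<le> sqrt u - 1" using assms by (intro ln_le_minus_one) simp
  then have "ln u \<le> 2 * (sqrt u - 1)" using assms by (simp add: ln_sqrt)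
  moreover have "s\<^sup>2 = u - 2 * sqrt u + 1" using assms by (simp add: s_def power2_eq_square algebra_simps)
  ultimately have le: "s\<^sup>2 \<le> u - 1 - ln u" by simp
  have "u - 1 = (sqrt u - 1) * (sqrt u + 1)" using assms by (simp add: algebra_simps)
  then have "\<bar>u - 1\<bar> = s * (sqrt u + 1)" using assms by (simp add: s_def abs_mult)
  also have "\<dots> \<le> s * (s + 2)" by (intro mult_left_mono) (auto simp: s_def)
  also have "\<dots> = s\<^sup>2 + 2 * s" by (simp add: power2_eq_square algebra_simps)
  also have "2 * s \<le> \<delta> + s\<^sup>2 / \<delta>"
  proof -
    have "2 * s * \<delta> \<le> \<delta>\<^sup>2 + s\<^sup>2" using sum_squares_bound[of s \<delta>] by (simp add: ac_simps)
    then show ?thesis using assms by (simp add: field_simps power2_eq_square)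
  qed
  also have "s\<^sup>2 + (\<delta> + s\<^sup>2 / \<delta>) = \<delta> + (1 + 1 / \<delta>) * s\<^sup>2" by (simp add: algebra_simps)
  also have "\<dots> \<le> \<delta> + (1 + 1 / \<delta>) * (u - 1 - ln u)"
    using le assms by (intro add_left_mono mult_left_mono) auto
  finally show ?thesis by simp
qed

context circle_system
begin

section \<open>Almost invariant densities\<close>

definition log_drift :: "circle \<Rightarrow> real" where
  "log_drift x = (\<Sum>i<N. p i * ln \<bar>circle_deriv (f i) x\<bar>)"

lemma continuous_deriv: "i < N \<Longrightarrow> continuous_on UNIV (circle_deriv (f i))"
  using diffeo[of i] by (simp add: circle_C1_diffeo_def circle_C1_def)

lemma deriv_nonzero: "i < N \<Longrightarrow> circle_deriv (f i) x \<noteq> 0"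
  using circle_deriv_nonzero[OF diffeo] .

lemma continuous_log_deriv: "i < N \<Longrightarrow> continuous_on UNIV (\<lambda>x. ln \<bar>circle_deriv (f i) x\<bar>)"
  by (intro continuous_intros continuous_deriv) (auto simp: deriv_nonzero)

lemma continuous_log_drift: "continuous_on UNIV log_drift"
  unfolding log_drift_def by (intro continuous_intros continuous_log_deriv) auto

text \<open>The measure with density proportional to \<open>exp \<phi>\<close> has under \<open>f i\<close> the relative density
  \<open>u i = \<bar>(f i)'\<bar> exp (\<phi> \<circ> f i - \<phi>)\<close> of mean 1, and the hypothesis bounds the average
  of \<open>ln (u i)\<close> from below. By the strict concavity of the logarithm all \<open>u i\<close> are close to 1.\<close>

lemma almost_invariant_measure:
  assumes \<phi>: "continuous_on UNIV \<phi>" and "\<delta> > 0"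
    and ge: "\<And>x. log_drift x + transfer f \<phi> x - \<phi> x \<ge> - \<epsilon>"
  obtains m where "borel_prob m"
    "\<And>v B i. continuous_on UNIV v \<Longrightarrow> (\<And>x. \<bar>v x\<bar> \<le> B) \<Longrightarrow> i < N \<Longrightarrow>
      \<bar>(\<integral>x. v (f i x) \<partial>m) - (\<integral>x. v x \<partial>m)\<bar> \<le> B * (\<delta> + (1 + 1 / \<delta>) * \<epsilon> / p i)"
proof -
  let ?L = circle_lebesgue
  interpret L: prob_space ?L by (rule borel_probD[OF borel_prob_circle_lebesgue])
  have int: "integrable ?L v" if "continuous_on UNIV v" for v :: "circle \<Rightarrow> real"
    by (rule integrable_continuous_circle[OF borel_prob_circle_lebesgue that])
  have cf: "continuous_on UNIV (\<lambda>x. v (f i x))" if "i < N" "continuous_on UNIV v" for i and v :: "circle \<Rightarrow> real"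
    by (rule continuous_on_compose2[OF that(2) continuous_f[OF that(1)]]) simp
  define E where "E x = exp (\<phi> x)" for x
  have E: "continuous_on UNIV E" unfolding E_def by (intro continuous_intros \<phi>)
  have E_pos: "E x > 0" for x by (simp add: E_def)
  define Z where "Z = integral\<^sup>L ?L E"
  have "Z > 0"
  proof -
    obtain x0 where "\<And>x. E x0 \<le> E x"
      using continuous_attains_inf[OF compact_circle _ E] by auto
    then have "(\<integral>x. E x0 \<partial>?L) \<le> Z"
      unfolding Z_def by (intro integral_mono int E) auto
    then show ?thesis using E_pos[of x0] by (simp add: L.prob_space)
  qed
  define u where "u i x = \<bar>circle_deriv (f i) x\<bar> * E (f i x) / E x" for i x
  have u_pos: "u i x > 0" if "i < N" for i x
    using that E_pos deriv_nonzero by (simp add: u_def)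
  have cu: "continuous_on UNIV (u i)" if "i < N" for i
    unfolding u_def using E_pos that
    by (intro continuous_intros cf E continuous_deriv) (auto simp: less_imp_neq[symmetric] dest: less_imp_neq)
  have ln_u: "ln (u i x) = ln \<bar>circle_deriv (f i) x\<bar> + \<phi> (f i x) - \<phi> x" if "i < N" for i x
    using deriv_nonzero[OF that, of x] unfolding u_def E_def by (simp add: ln_mult ln_div)
  have sum_ln: "(\<Sum>i<N. p i * ln (u i x)) \<ge> - \<epsilon>" for x
  proof -
    have "(\<Sum>i<N. p i * ln (u i x)) = log_drift x + transfer f \<phi> x - \<phi> x"
      unfolding log_drift_def transfer_def
      by (simp add: ln_u algebra_simps sum.distrib sum_subtractf flip: sum_distrib_left)
    with ge show ?thesis by simp
  qed
  \<comment> \<open>The gap in the tangent inequality for the logarithm, weighted by the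
    unnormalized density; its integral controls how far \<open>u i\<close> is from 1.\<close>
  define D where "D i x = E x * (u i x - 1 - ln (u i x))" for i x
  have cD: "continuous_on UNIV (D i)" if "i < N" for i
    unfolding D_def using u_pos[OF that] that
    by (intro continuous_intros E cu) (metis less_irrefl)+
  have D_nonneg: "D i x \<ge> 0" if "i < N" for i x
    using E_pos[of x] ln_le_minus_one[OF u_pos[OF that, of x]] by (simp add: D_def)
  have Eu: "E x * u i x = \<bar>circle_deriv (f i) x\<bar> * E (f i x)" for i x
    using E_pos[of x] by (simp add: u_def)
  have int_Eu: "(\<integral>x. v (f i x) * (E x * u i x) \<partial>?L) = (\<integral>x. v x * E x \<partial>?L)"
    if "i < N" "continuous_on UNIV v" for i and v :: "circle \<Rightarrow> real"
    using circle_change_of_variables[OF diffeo[OF that(1)] continuous_on_mult[OF that(2) E]]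
    unfolding Eu by (simp add: mult_ac)
  \<comment> \<open>By change of variables \<open>E * u i\<close> and \<open>E\<close> have the same
    integral, so the linear parts cancel and only the averaged logarithms remain. All gaps are
    nonnegative, so a single one is bounded by the average divided by its weight.\<close>
  have D_le: "(\<integral>x. D i x \<partial>?L) \<le> \<epsilon> * Z / p i" if i: "i < N" for i
  proof -
    have "p i * (\<integral>x. D i x \<partial>?L) \<le> (\<Sum>i<N. p i * (\<integral>x. D i x \<partial>?L))"
      using i D_nonneg by (intro member_le_sum[of i]) (auto intro!: mult_nonneg_nonneg Bochner_Integration.integral_nonneg)
    also have "\<dots> = (\<integral>x. (\<Sum>i<N. p i * D i x) \<partial>?L)"
      by (subst Bochner_Integration.integral_sum) (auto intro!: integrable_mult_right int cD)
    also have "\<dots> \<le> (\<integral>x. (\<Sum>i<N. p i * (E x * u i x - E x)) + \<epsilon> * E x \<partial>?L)"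
    proof (intro integral_mono int continuous_intros cD E cu)
      fix x
      have "(\<Sum>i<N. p i * D i x) = (\<Sum>i<N. p i * (E x * u i x - E x)) - E x * (\<Sum>i<N. p i * ln (u i x))"
        unfolding D_def by (simp add: algebra_simps sum_subtractf sum.distrib sum_distrib_left)
      moreover have "E x * (\<Sum>i<N. p i * ln (u i x)) \<ge> E x * (- \<epsilon>)"
        using sum_ln[of x] E_pos[of x] by (intro mult_left_mono) auto
      ultimately show "(\<Sum>i<N. p i * D i x) \<le> (\<Sum>i<N. p i * (E x * u i x - E x)) + \<epsilon> * E x"
        by (simp add: algebra_simps)
    qed auto
    also have "\<dots> = (\<Sum>i<N. p i * ((\<integral>x. E x * u i x \<partial>?L) - Z)) + \<epsilon> * Z"
    proof -
      have "(\<integral>x. p i * (E x * u i x - E x) \<partial>?L) = p i * ((\<integral>x. E x * u i x \<partial>?L) - Z)" if "i < N" for i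
        unfolding Z_def using that
        by (simp add: Bochner_Integration.integral_diff[OF int[OF continuous_on_mult[OF E cu]] int[OF E]])
      then have "(\<Sum>i<N. (\<integral>x. p i * (E x * u i x - E x) \<partial>?L))
          = (\<Sum>i<N. p i * ((\<integral>x. E x * u i x \<partial>?L) - Z))"
        by (intro sum.cong refl) simp
      moreover have "(\<integral>x. (\<Sum>i<N. p i * (E x * u i x - E x)) + \<epsilon> * E x \<partial>?L)
          = (\<Sum>i<N. (\<integral>x. p i * (E x * u i x - E x) \<partial>?L)) + (\<integral>x. \<epsilon> * E x \<partial>?L)"
      proof -
        have ci: "continuous_on UNIV (\<lambda>x. p i * (E x * u i x - E x))" if "i < N" for i
          by (intro continuous_intros E cu that)
        then have "(\<integral>x. (\<Sum>i<N. p i * (E x * u i x - E x)) \<partial>?L)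
            = (\<Sum>i<N. (\<integral>x. p i * (E x * u i x - E x) \<partial>?L))"
          by (intro Bochner_Integration.integral_sum int) auto
        moreover have "integrable ?L (\<lambda>x. \<Sum>i<N. p i * (E x * u i x - E x))"
          using ci by (intro int continuous_on_sum) auto
        moreover have "integrable ?L (\<lambda>x. \<epsilon> * E x)"
          by (intro int continuous_intros E)
        ultimately show ?thesis by (simp only: Bochner_Integration.integral_add)
      qed
      moreover have "(\<integral>x. \<epsilon> * E x \<partial>?L) = \<epsilon> * Z" by (simp add: Z_def)
      ultimately show ?thesis by (simp only:)
    qed
    also have "\<dots> = \<epsilon> * Z"
      using int_Eu[of _ "\<lambda>_. 1"] by (simp add: Z_def)
    finally show ?thesis using p_pos[OF i] by (simp add: field_simps)
  qed
  define m where "m = density ?L (\<lambda>x. ennreal (E x / Z))"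
  have Em: "(\<lambda>x. E x / Z) \<in> borel_measurable ?L"
    by (intro borel_prob_measurable[OF borel_prob_circle_lebesgue] borel_measurable_continuous_onI continuous_intros E)
      (use \<open>Z > 0\<close> in auto)
  have integral_m: "(\<integral>x. v x \<partial>m) = (\<integral>x. v x * E x \<partial>?L) / Z" if v: "continuous_on UNIV v" for v :: "circle \<Rightarrow> real"
  proof -
    have "v \<in> borel_measurable ?L"
      by (intro borel_prob_measurable[OF borel_prob_circle_lebesgue] borel_measurable_continuous_onI v)
    then have "(\<integral>x. v x \<partial>m) = (\<integral>x. (E x / Z) *\<^sub>R v x \<partial>?L)"
      unfolding m_def using E_pos \<open>Z > 0\<close> Em
      by (intro integral_density) (auto intro!: AE_I2 divide_nonneg_nonneg less_imp_le)
    also have "(\<lambda>x. (E x / Z) *\<^sub>R v x) = (\<lambda>x. v x * E x / Z)" by (simp add: fun_eq_iff)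
    finally show ?thesis by simp
  qed
  show thesis
  proof (rule that)
    show "borel_prob m"
      unfolding borel_prob_def
    proof
      have "emeasure m (space m) = (\<integral>\<^sup>+x. ennreal (E x / Z) \<partial>?L)"
        unfolding m_def using Em by (subst emeasure_density) (auto intro!: nn_integral_cong)
      also have "\<dots> = ennreal (\<integral>x. E x / Z \<partial>?L)"
        using E_pos \<open>Z > 0\<close> int[OF E] by (intro nn_integral_eq_integral) (auto intro!: AE_I2 divide_nonneg_nonneg less_imp_le)
      also have "(\<integral>x. E x / Z \<partial>?L) = 1" using \<open>Z > 0\<close> by (simp add: Z_def)
      finally show "prob_space m" by (intro prob_spaceI) simp
      show "sets m = sets borel" using borel_probD[OF borel_prob_circle_lebesgue] by (simp add: m_def)
    qed
  next
    fix v :: "circle \<Rightarrow> real" and B i assume v: "continuous_on UNIV v" and B: "\<And>x. \<bar>v x\<bar> \<le> B" and i: "i < N"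
    have B0: "B \<ge> 0" using B[of undefined] by linarith
    note cs = continuous_intros cf[OF i v] v E cu[OF i] cD[OF i]
    \<comment> \<open>Change of variables rewrites the integral of \<open>v\<close> with weight
      \<open>E * u i\<close> along \<open>f i\<close>, which turns the defect of invariance into an
      integral of \<open>1 - u i\<close>.\<close>
    have "(\<integral>x. v (f i x) * E x \<partial>?L) - (\<integral>x. v x * E x \<partial>?L)
        = (\<integral>x. v (f i x) * E x \<partial>?L) - (\<integral>x. v (f i x) * (E x * u i x) \<partial>?L)"
      by (simp add: int_Eu[OF i v])
    also have "\<dots> = (\<integral>x. v (f i x) * E x - v (f i x) * (E x * u i x) \<partial>?L)"
      by (intro Bochner_Integration.integral_diff[symmetric] int cs)
    finally have "\<bar>(\<integral>x. v (f i x) * E x \<partial>?L) - (\<integral>x. v x * E x \<partial>?L)\<bar>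
        \<le> (\<integral>x. \<bar>v (f i x) * E x - v (f i x) * (E x * u i x)\<bar> \<partial>?L)"
      using integral_abs_bound[of ?L] by simp
    also have "\<dots> \<le> (\<integral>x. B * (\<delta> * E x + (1 + 1 / \<delta>) * D i x) \<partial>?L)"
    proof (intro integral_mono int cs)
      fix x
      have "\<bar>v (f i x) * E x - v (f i x) * (E x * u i x)\<bar> = \<bar>v (f i x)\<bar> * (E x * \<bar>u i x - 1\<bar>)"
      proof -
        have "v (f i x) * E x - v (f i x) * (E x * u i x) = v (f i x) * (E x * (1 - u i x))"
          by (simp add: algebra_simps)
        then show ?thesis
          using E_pos[of x] by (simp only: abs_mult abs_of_pos abs_minus_commute[of 1])
      qed
      also have "\<dots> \<le> B * (E x * (\<delta> + (1 + 1 / \<delta>) * (u i x - 1 - ln (u i x))))"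
        using B[of "f i x"] E_pos[of x] abs_diff_one_le[OF u_pos[OF i] \<open>\<delta> > 0\<close>, of x]
        by (intro mult_mono mult_left_mono) auto
      also have "\<dots> = B * (\<delta> * E x + (1 + 1 / \<delta>) * D i x)"
        unfolding D_def by (simp add: algebra_simps)
      finally show "\<bar>v (f i x) * E x - v (f i x) * (E x * u i x)\<bar> \<le> B * (\<delta> * E x + (1 + 1 / \<delta>) * D i x)" .
    qed
    also have "\<dots> = B * (\<delta> * Z + (1 + 1 / \<delta>) * (\<integral>x. D i x \<partial>?L))"
      using Bochner_Integration.integral_add[OF integrable_mult_right[OF int[OF E], of \<delta>]
          integrable_mult_right[OF int[OF cD[OF i]], of "1 + 1 / \<delta>"]]
      by (simp add: Z_def)
    also have "\<dots> \<le> B * (\<delta> * Z + (1 + 1 / \<delta>) * (\<epsilon> * Z / p i))"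
      using D_le[OF i] B0 \<open>\<delta> > 0\<close> by (intro mult_left_mono add_left_mono) auto
    also have "\<dots> = B * (\<delta> + (1 + 1 / \<delta>) * \<epsilon> / p i) * Z"
      by (simp add: algebra_simps)
    finally show "\<bar>(\<integral>x. v (f i x) \<partial>m) - (\<integral>x. v x \<partial>m)\<bar> \<le> B * (\<delta> + (1 + 1 / \<delta>) * \<epsilon> / p i)"
      unfolding integral_m[OF v] integral_m[OF cf[OF i v]] diff_divide_distrib[symmetric] abs_divide
      using \<open>Z > 0\<close> by (simp add: pos_divide_le_eq)
  qed
qed

text \<open>If the claim fails, \<open>birkhoff_mean\<close> of the drift meets the hypothesis of
  \<open>almost_invariant_measure\<close> for every \<epsilon>. Taking \<epsilon> as the square of
  \<delta> keeps the error of order \<delta> despite the factor 1/\<delta>, so weak limits are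
  invariant under every map.\<close>

lemma log_drift_somewhere_negative:
  "\<exists>\<epsilon>>0. \<forall>n>0. \<exists>x. birkhoff f n log_drift x / real n < - \<epsilon>"
proof (rule ccontr)
  assume neg: "\<not> ?thesis"
  have *: "\<exists>n>0. \<forall>x. birkhoff f n log_drift x / real n \<ge> - \<epsilon>" if "\<epsilon> > 0" for \<epsilon>
    using neg that by (metis not_le)
  define \<delta> :: "nat \<Rightarrow> real" where "\<delta> k = 1 / Suc k" for k
  have \<delta>_pos: "\<delta> k > 0" for k by (simp add: \<delta>_def)
  have "\<exists>m. borel_prob m \<and> (\<forall>v B i. continuous_on UNIV v \<longrightarrow> (\<forall>x. \<bar>v x\<bar> \<le> B) \<longrightarrow> i < N \<longrightarrow>
      \<bar>(\<integral>x. v (f i x) \<partial>m) - (\<integral>x. v x \<partial>m)\<bar> \<le> B * (\<delta> k + (1 + 1 / \<delta> k) * (\<delta> k)\<^sup>2 / p i))" for k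
  proof -
    obtain n where n: "n > 0" "\<And>x. birkhoff f n log_drift x / real n \<ge> - (\<delta> k)\<^sup>2"
      using *[of "(\<delta> k)\<^sup>2"] \<delta>_pos[of k] by auto
    have "continuous_on UNIV (birkhoff_mean f n log_drift)"
      unfolding birkhoff_mean_def
      by (intro continuous_intros continuous_birkhoff continuous_f continuous_log_drift) (use n in auto)
    moreover have "log_drift x + transfer f (birkhoff_mean f n log_drift) x - birkhoff_mean f n log_drift x \<ge> - (\<delta> k)\<^sup>2" for x
      using n by (subst birkhoff_mean_cohomology) auto
    ultimately show ?thesis
      using almost_invariant_measure[OF _ \<delta>_pos[of k]] by metis
  qed
  then obtain m where m: "\<And>k. borel_prob (m k)"
    "\<And>k v B i. continuous_on UNIV v \<Longrightarrow> (\<And>x. \<bar>v x\<bar> \<le> B) \<Longrightarrow> i < N \<Longrightarrow>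
      \<bar>(\<integral>x. v (f i x) \<partial>m k) - (\<integral>x. v x \<partial>m k)\<bar> \<le> B * (\<delta> k + (1 + 1 / \<delta> k) * (\<delta> k)\<^sup>2 / p i)"
    by metis
  obtain r l where r: "strict_mono (r :: nat \<Rightarrow> nat)" and l: "borel_prob l"
    and lim: "\<And>v :: circle \<Rightarrow> real. continuous_on UNIV v \<Longrightarrow> (\<lambda>n. integral\<^sup>L (m (r n)) v) \<longlonglongrightarrow> integral\<^sup>L l v"
    using circle_weak_compactness[of m, OF m(1)] by blast
  interpret l: prob_space l by (rule borel_probD[OF l])
  have "distr l borel (f i) = l" if i: "i < N" for i
  proof (rule borel_prob_eqI_lipschitz)
    have fi: "f i \<in> borel_measurable l" by (rule borel_prob_measurable[OF l measurable_f[OF i]])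
    show "borel_prob (distr l borel (f i))" by (rule borel_prob_distr[OF l.prob_space_axioms fi])
    show "borel_prob l" by (rule l)
    fix L and v :: "circle \<Rightarrow> real" assume "\<And>x y. \<bar>v x - v y\<bar> \<le> L * dist x y"
    then have v: "continuous_on UNIV v" by (rule lipschitz_imp_continuous_on)
    obtain B where B: "\<And>x. \<bar>v x\<bar> \<le> B" using continuous_on_circle_bounded[OF v] by blast
    have vf: "continuous_on UNIV (\<lambda>x. v (f i x))" 
      by (rule continuous_on_compose2[OF v continuous_f[OF i]]) simp
    have lim0: "(\<lambda>k. B * (\<delta> k + (1 + 1 / \<delta> k) * (\<delta> k)\<^sup>2 / p i)) \<longlonglongrightarrow> 0"
    proof -
      have \<delta>: "\<delta> \<longlonglongrightarrow> 0" unfolding \<delta>_def using LIMSEQ_inverse_real_of_nat by (simp add: inverse_eq_divide)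
      have "(1 + 1 / \<delta> k) * (\<delta> k)\<^sup>2 = (\<delta> k)\<^sup>2 + \<delta> k" for k
        using \<delta>_pos[of k] by (simp add: power2_eq_square field_simps)
      moreover have "(\<lambda>k. B * (\<delta> k + ((\<delta> k)\<^sup>2 + \<delta> k) / p i)) \<longlonglongrightarrow> B * (0 + (0\<^sup>2 + 0) / p i)"
        using p_pos[OF i] by (intro tendsto_intros \<delta>) auto
      ultimately show ?thesis by simp
    qed
    have "(\<lambda>k. (\<integral>x. v (f i x) \<partial>m (r k)) - (\<integral>x. v x \<partial>m (r k))) \<longlonglongrightarrow> 0"
    proof (rule Lim_null_comparison[OF _ LIMSEQ_subseq_LIMSEQ[OF lim0 r]])
      show "\<forall>\<^sub>F k in sequentially. norm ((\<integral>x. v (f i x) \<partial>m (r k)) - (\<integral>x. v x \<partial>m (r k)))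
          \<le> ((\<lambda>k. B * (\<delta> k + (1 + 1 / \<delta> k) * (\<delta> k)\<^sup>2 / p i)) \<circ> r) k"
        using m(2)[OF v B i] by simp
    qed
    moreover have "(\<lambda>k. (\<integral>x. v (f i x) \<partial>m (r k)) - (\<integral>x. v x \<partial>m (r k)))
        \<longlonglongrightarrow> (\<integral>x. v (f i x) \<partial>l) - (\<integral>x. v x \<partial>l)"
      by (intro tendsto_diff lim v vf)
    ultimately have "(\<integral>x. v (f i x) \<partial>l) = (\<integral>x. v x \<partial>l)"
      using LIMSEQ_unique by fastforce
    moreover have "integral\<^sup>L (distr l borel (f i)) v = (\<integral>x. v (f i x) \<partial>l)"
      by (intro integral_distr fi borel_measurable_continuous_onI v)
    ultimately show "integral\<^sup>L (distr l borel (f i)) v = integral\<^sup>L l v" by simp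
  qed
  with l no_invariant show False by blast
qed

end

section \<open>Contraction on average\<close>

lemma exp_le_quadratic:
  fixes t :: real
  assumes "\<bar>t\<bar> \<le> 1"
  shows "exp t \<le> 1 + t + t\<^sup>2"
proof (cases "t \<ge> 0")
  case True
  then show ?thesis using exp_bound[of t] assms by simp
next
  case False
  define s where "s = - t"
  have s: "0 < s" "s \<le> 1" using False assms by (auto simp: s_def)
  have "exp t = 1 / exp s" by (simp add: s_def exp_minus field_simps)
  also have "\<dots> \<le> 1 / (1 + s)"
    using s by (intro divide_left_mono) auto
  also have "\<dots> \<le> 1 - s + s\<^sup>2"
  proof -
    have "(1 - s + s\<^sup>2) * (1 + s) = 1 + s ^ 3" by (simp add: algebra_simps power2_eq_square power3_eq_cube)
    then have "1 \<le> (1 - s + s\<^sup>2) * (1 + s)" using s by simp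
    then show ?thesis using s by (simp add: divide_le_eq)
  qed
  finally show ?thesis by (simp add: s_def)
qed

lemma finite_uniform_bound:
  fixes b :: "nat \<Rightarrow> 'z \<Rightarrow> real"
  assumes "\<And>i. i < N \<Longrightarrow> \<exists>c. \<forall>z. b i z \<le> c * h z" and h: "\<And>z. h z \<ge> 0"
  obtains C where "C \<ge> 0" "\<And>i z. i < N \<Longrightarrow> b i z \<le> C * h z"
proof -
  obtain c where c: "\<And>i z. i < N \<Longrightarrow> b i z \<le> c i * h z" using assms(1) by metis
  show thesis
  proof (rule that)
    show "0 \<le> (\<Sum>i<N. \<bar>c i\<bar>)" by (intro sum_nonneg) simp
    fix i z assume i: "i < N"
    have "c i \<le> (\<Sum>i<N. \<bar>c i\<bar>)" using i member_le_sum[of i "{..<N}" "\<lambda>i. \<bar>c i\<bar>"] by auto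
    then show "b i z \<le> (\<Sum>i<N. \<bar>c i\<bar>) * h z" using c[OF i, of z] mult_right_mono[OF _ h] order.trans by blast
  qed
qed

text \<open>Hoelder estimates produce powers of the distance, whereas synchronization controls the
  mean of the distance itself. Below the threshold \<open>d0\<close> the power is at most \<eta>,
  above it \<open>d / d0\<close> is at least 1.\<close>

lemma powr_le_affine:
  assumes "\<alpha> > 0" "\<eta> > 0"
  obtains K :: real where "K > 0" "\<And>d. 0 \<le> d \<Longrightarrow> d \<le> 1 \<Longrightarrow> d powr \<alpha> \<le> \<eta> + K * d"
proof -
  define d0 where "d0 = \<eta> powr (1 / \<alpha>)"
  have d0: "d0 > 0" "d0 powr \<alpha> = \<eta>" using assms by (auto simp: d0_def powr_powr)
  show thesis
  proof (rule that[of "1 / d0"])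
    fix d :: real assume d: "0 \<le> d" "d \<le> 1"
    show "d powr \<alpha> \<le> \<eta> + 1 / d0 * d"
    proof (cases "d \<le> d0")
      case True
      then have "d powr \<alpha> \<le> \<eta>" using powr_mono2[of \<alpha> d d0] d d0 assms by simp
      then show ?thesis using d d0 by (simp add: add_increasing2)
    next
      case False
      then have "1 \<le> 1 / d0 * d" using d0 by (simp add: field_simps)
      moreover have "d powr \<alpha> \<le> 1" using d assms by (simp add: powr_le1)
      ultimately show ?thesis using assms by linarith
    qed
  qed (use d0 in simp)
qed

locale circle_holder_system = circle_system N \<mu> f for N \<mu> f +
  fixes \<beta> :: real
  assumes \<beta>_pos: "\<beta> > 0" and holder: "i < N \<Longrightarrow> circle_C1_holder_diffeo \<beta> (f i)"
begin

section \<open>Increments on pairs and their drift\<close>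

definition increment :: "nat \<Rightarrow> circle \<times> circle \<Rightarrow> real" where
  "increment i z = log_ratio (f i) (fst z) (snd z)"

definition pair_drift :: "circle \<times> circle \<Rightarrow> real" where
  "pair_drift z = (\<Sum>i<N. p i * increment i z)"

lemma increment_bounded:
  obtains B where "B \<ge> 0" "\<And>i z. i < N \<Longrightarrow> \<bar>increment i z\<bar> \<le> B"
proof -
  have "\<exists>c. \<forall>z. \<bar>increment i z\<bar> \<le> c * 1" if "i < N" for i
    using log_ratio_bounded[OF diffeo[OF that]] unfolding increment_def by (metis mult.right_neutral)
  from finite_uniform_bound[of N "\<lambda>i z. \<bar>increment i z\<bar>" "\<lambda>_. 1", OF this] that show thesis by auto
qed

lemma weighted_abs_le: "(\<And>i. i < N \<Longrightarrow> \<bar>h i\<bar> \<le> B) \<Longrightarrow> \<bar>\<Sum>i<N. p i * h i\<bar> \<le> B"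
proof -
  assume h: "\<And>i. i < N \<Longrightarrow> \<bar>h i\<bar> \<le> B"
  have "\<bar>\<Sum>i<N. p i * h i\<bar> \<le> (\<Sum>i<N. p i * B)"
    by (intro order.trans[OF sum_abs] sum_mono) (auto simp: abs_mult intro!: mult_left_mono h)
  then show ?thesis by simp
qed

lemma pair_drift_bounded:
  obtains B where "\<And>z. \<bar>pair_drift z\<bar> \<le> B"
  using increment_bounded weighted_abs_le unfolding pair_drift_def by metis

lemma pair_drift_diag: "pair_drift (x, x) = log_drift x"
  by (simp add: pair_drift_def log_drift_def increment_def log_ratio_def)

lemma pair_drift_holder:
  assumes "0 < \<alpha>" "\<alpha> \<le> \<beta>"
  obtains C where "C \<ge> 0" "\<And>z. \<bar>pair_drift z - log_drift (fst z)\<bar> \<le> C * pair_dist z powr \<alpha>"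
    "\<And>z. \<bar>log_drift (fst z) - log_drift (snd z)\<bar> \<le> C * pair_dist z powr \<alpha>"
proof -
  \<comment> \<open>The maximum combines the two Hoelder estimates, so that one constant serves both
    and all maps.\<close>
  define b where "b i z = max \<bar>increment i z - increment i (fst z, fst z)\<bar>
    \<bar>increment i (fst z, fst z) - increment i (snd z, snd z)\<bar>" for i z
  have ex: "\<exists>c. \<forall>z. b i z \<le> c * pair_dist z powr \<alpha>" if i: "i < N" for i
  proof -
    obtain C where "\<And>x y. \<bar>log_ratio (f i) x y - log_ratio (f i) x x\<bar> \<le> C * dist x y powr \<alpha>"
      "\<And>x y. \<bar>log_ratio (f i) x x - log_ratio (f i) y y\<bar> \<le> C * dist x y powr \<alpha>"
      using log_ratio_holder[OF holder[OF i] assms] by metis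
    then show ?thesis
      unfolding b_def increment_def pair_dist_def by (intro exI[of _ C]) auto
  qed
  obtain C where C: "C \<ge> 0" "\<And>i z. i < N \<Longrightarrow> b i z \<le> C * pair_dist z powr \<alpha>"
    using finite_uniform_bound[of N b "\<lambda>z. pair_dist z powr \<alpha>", OF ex powr_ge_zero] by blast
  show thesis
  proof (rule that[OF C(1)])
    fix z
    have bz: "\<bar>increment i z - increment i (fst z, fst z)\<bar> \<le> C * pair_dist z powr \<alpha>"
      "\<bar>increment i (fst z, fst z) - increment i (snd z, snd z)\<bar> \<le> C * pair_dist z powr \<alpha>" if "i < N" for i
      using C(2)[OF that, of z] by (simp_all add: b_def)
    have "pair_drift z - log_drift (fst z) = (\<Sum>i<N. p i * (increment i z - increment i (fst z, fst z)))"
      unfolding pair_drift_diag[symmetric] unfolding pair_drift_def by (simp add: right_diff_distrib sum_subtractf)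
    then show "\<bar>pair_drift z - log_drift (fst z)\<bar> \<le> C * pair_dist z powr \<alpha>"
      using bz by (simp add: weighted_abs_le)
    have "log_drift (fst z) - log_drift (snd z)
        = (\<Sum>i<N. p i * (increment i (fst z, fst z) - increment i (snd z, snd z)))"
      unfolding pair_drift_diag[symmetric] unfolding pair_drift_def by (simp add: right_diff_distrib sum_subtractf)
    then show "\<bar>log_drift (fst z) - log_drift (snd z)\<bar> \<le> C * pair_dist z powr \<alpha>"
      using bz by (simp add: weighted_abs_le)
  qed
qed

lemma birkhoff_pair_fst: "birkhoff pair_step n (\<lambda>z. v (fst z)) z = birkhoff f n v (fst z)"
  and birkhoff_pair_snd: "birkhoff pair_step n (\<lambda>z. v (snd z)) z = birkhoff f n v (snd z)"
  by (simp_all add: birkhoff_def transfer_pair_fst transfer_pair_snd)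

text \<open>The means at a pair, at its first point and at the point \<open>x\<close> of negative
  drift are close to one another by synchronization. The length \<open>n\<close> comes from
  synchronization, and \<open>x\<close> depends on it; this is harmless since \<epsilon> does
  not.\<close>

lemma pair_drift_mean_negative:
  obtains n c where "n > 0" "c > 0" "\<And>z. birkhoff pair_step n pair_drift z / real n \<le> - c"
proof -
  obtain \<epsilon> where \<epsilon>: "\<epsilon> > 0" "\<And>n. n > 0 \<Longrightarrow> \<exists>x. birkhoff f n log_drift x / real n < - \<epsilon>"
    using log_drift_somewhere_negative by blast
  obtain C where C: "C \<ge> 0" "\<And>z. \<bar>pair_drift z - log_drift (fst z)\<bar> \<le> C * pair_dist z powr \<beta>"
    "\<And>z. \<bar>log_drift (fst z) - log_drift (snd z)\<bar> \<le> C * pair_dist z powr \<beta>"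
    using pair_drift_holder[OF \<beta>_pos order_refl] by blast
  \<comment> \<open>Two comparisons cost \<open>2 * b\<close> each, half of \<epsilon> in
    total.\<close>
  define b where "b = \<epsilon> / 8"
  have "b > 0" using \<epsilon> by (simp add: b_def)
  have "b / (C + 1) > 0" using \<open>b > 0\<close> C(1) by simp
  then obtain K where K: "K > 0" "\<And>d. 0 \<le> d \<Longrightarrow> d \<le> 1 \<Longrightarrow> d powr \<beta> \<le> b / (C + 1) + K * d"
    using powr_le_affine[OF \<beta>_pos] by metis
  define a where "a = (C + 1) * K"
  have "a > 0" using K C(1) by (simp add: a_def)
  have le: "C * pair_dist z powr \<beta> \<le> a * pair_dist z + b" for z
  proof -
    have "C * pair_dist z powr \<beta> \<le> (C + 1) * (b / (C + 1) + K * pair_dist z)"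
      using K(2)[of "pair_dist z"] pair_dist_bounds[of z] C(1) by (intro mult_mono) auto
    also have "\<dots> = a * pair_dist z + b" using C(1) by (simp add: a_def distrib_left mult.assoc)
    finally show ?thesis .
  qed
  obtain m where m: "\<And>n z. n \<ge> m \<Longrightarrow> mean_dist n z \<le> b / a"
    using mean_dist_tendsto_0[of "b / a"] \<open>a > 0\<close> \<open>b > 0\<close> by auto
  define n where "n = Suc m"
  have n: "n > 0" "n \<ge> m" by (auto simp: n_def)
  have close: "birkhoff pair_step n v z / real n \<le> birkhoff pair_step n w z / real n + 2 * b"
    if "\<And>z. \<bar>v z - w z\<bar> \<le> C * pair_dist z powr \<beta>" for v w z
  proof -
    have "\<bar>birkhoff pair_step n v z - birkhoff pair_step n w z\<bar> \<le> a * birkhoff pair_step n pair_dist z + n * b"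
      by (rule birkhoff_abs_diff_le) (use that le order.trans in blast)
    then have "\<bar>birkhoff pair_step n v z - birkhoff pair_step n w z\<bar> / real n \<le> a * mean_dist n z + b"
      using n by (simp add: mean_dist_def field_simps)
    also have "\<dots> \<le> a * (b / a) + b"
      using m[OF n(2)] \<open>a > 0\<close> by (intro add_right_mono mult_left_mono) auto
    finally have "\<bar>birkhoff pair_step n v z - birkhoff pair_step n w z\<bar> / real n \<le> 2 * b"
      using \<open>a > 0\<close> by simp
    moreover have "(birkhoff pair_step n v z - birkhoff pair_step n w z) / real n
        \<le> \<bar>birkhoff pair_step n v z - birkhoff pair_step n w z\<bar> / real n"
      by (intro divide_right_mono) auto
    ultimately show ?thesis by (simp add: diff_divide_distrib)
  qed
  obtain x where x: "birkhoff f n log_drift x / real n < - \<epsilon>" using \<epsilon>(2)[OF n(1)] by blast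
  show thesis
  proof (rule that[OF n(1), of "\<epsilon> / 2"])
    fix z
    have "birkhoff pair_step n pair_drift z / real n \<le> birkhoff f n log_drift (fst z) / real n + 2 * b"
      using close[of pair_drift "\<lambda>z. log_drift (fst z)" z] C(2) by (simp add: birkhoff_pair_fst)
    moreover have "birkhoff f n log_drift (fst z) / real n \<le> birkhoff f n log_drift x / real n + 2 * b"
      using close[of "\<lambda>z. log_drift (fst z)" "\<lambda>z. log_drift (snd z)" "(fst z, x)"] C(3)
      by (simp add: birkhoff_pair_fst birkhoff_pair_snd)
    ultimately show "birkhoff pair_step n pair_drift z / real n \<le> - (\<epsilon> / 2)"
      using x by (simp add: b_def)
  qed (use \<epsilon> in simp)
qed

lemma pair_dist_step:
  assumes "i < N" "a > 0"
  shows "pair_dist (pair_step i z) powr a = pair_dist z powr a * exp (a * increment i z)"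
proof (cases "fst z = snd z")
  case False
  have "f i (fst z) \<noteq> f i (snd z)"
    using False diffeo[OF assms(1)] by (auto simp: circle_C1_diffeo_def bij_def dest: injD)
  then have pos: "dist (f i (fst z)) (f i (snd z)) > 0" "dist (fst z) (snd z) > 0" using False by auto
  then show ?thesis
    using False by (simp add: pair_dist_def pair_step_def increment_def log_ratio_def powr_def
      exp_add[symmetric] ln_div algebra_simps)
qed (use assms in \<open>simp add: pair_dist_def pair_step_def\<close>)

text \<open>Correcting \<open>pair_dist\<close> by the cohomology \<open>g\<close> makes its drift negative at every step, so a
  small power of it is contracted.\<close>

lemma pair_dist_contraction:
  obtains a C r where "0 < a" "a \<le> \<beta>" "a \<le> 1" "0 \<le> C" "0 < r" "r < 1"
    "\<And>k z. transfer_pow pair_step k (\<lambda>z. pair_dist z powr a) z \<le> C * r ^ k"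
proof -
  obtain n c where n: "n > 0" "c > 0" "\<And>z. birkhoff pair_step n pair_drift z / real n \<le> - c"
    using pair_drift_mean_negative by blast
  obtain B1 where B1: "\<And>z. \<bar>pair_drift z\<bar> \<le> B1" using pair_drift_bounded by blast
  define g where "g = birkhoff_mean pair_step n pair_drift"
  obtain G where "\<And>z. \<bar>birkhoff_mean pair_step n pair_drift z\<bar> \<le> G"
    using birkhoff_mean_bounded[where v=pair_drift and c=B1 and s=pair_step and n=n] B1 by blast
  then have G: "\<bar>g z\<bar> \<le> G" for z by (simp add: g_def)
  have "G \<ge> 0" using G[of undefined] by linarith
  obtain B where B: "B \<ge> 0" "\<And>i z. i < N \<Longrightarrow> \<bar>increment i z\<bar> \<le> B" using increment_bounded by blast
  \<comment> \<open>The increments of the corrected logarithmic distance; by the cohomology their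
    average is at most \<open>- c\<close> at every pair.\<close>
  define H where "H i z = increment i z + g (pair_step i z) - g z" for i z
  define D where "D = B + 2 * G + 1"
  have D: "D \<ge> 1" using B(1) \<open>G \<ge> 0\<close> by (simp add: D_def)
  have H_le: "\<bar>H i z\<bar> \<le> D" if "i < N" for i z
    using B(2)[OF that, of z] G[of z] G[of "pair_step i z"] unfolding H_def D_def by linarith
  have H_mean: "(\<Sum>i<N. p i * H i z) \<le> - c" for z
  proof -
    have "(\<Sum>i<N. p i * H i z) = pair_drift z + transfer pair_step g z - g z"
      unfolding H_def pair_drift_def transfer_def by (simp add: algebra_simps sum.distrib sum_subtractf flip: sum_distrib_left)
    also have "\<dots> \<le> - c"
      unfolding g_def using n by (subst birkhoff_mean_cohomology) auto
    finally show ?thesis .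
  qed
  \<comment> \<open>\<open>1 / D\<close> makes the quadratic bound for \<open>exp\<close>
    applicable, \<open>c / (2 * D\<^sup>2)\<close> limits the second order term to half of the gain
    \<open>a * c\<close>. The bounds \<beta> and 1 allow the Hoelder estimates and the passage from
    Lipschitz to Hoelder functions.\<close>
  define a where "a = Min {\<beta>, 1, 1 / D, c / (2 * D\<^sup>2)}"
  have a: "a > 0" "a \<le> \<beta>" "a \<le> 1" "a \<le> 1 / D" "a \<le> c / (2 * D\<^sup>2)"
    using \<beta>_pos D n(2) by (auto simp: a_def)
  have aD: "a * D \<le> 1" "a * (a * D\<^sup>2) \<le> a * (c / 2)"
    using a(1,4,5) D by (simp_all add: field_simps)
  \<comment> \<open>The maximum with 1/2 only keeps the rate positive.\<close>
  define r where "r = max (1 - a * c / 2) (1 / 2)"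
  have r: "0 < r" "r < 1" using a(1) n(2) by (auto simp: r_def)
  define R where "R z = pair_dist z powr a * exp (a * g z)" for z
  have R_nonneg: "R z \<ge> 0" for z by (simp add: R_def)
  have step: "transfer pair_step R z \<le> r * R z" for z
  proof -
    have "transfer pair_step R z = (\<Sum>i<N. p i * (R z * exp (a * H i z)))"
      unfolding transfer_def R_def
      by (intro sum.cong refl) (simp add: pair_dist_step a(1) H_def mult_exp_exp algebra_simps)
    also have "\<dots> \<le> (\<Sum>i<N. p i * (R z * (1 + a * H i z + a * (a * D\<^sup>2))))"
    proof (intro sum_mono mult_left_mono R_nonneg)
      fix i assume "i \<in> {..<N}"
      then have Hi: "\<bar>H i z\<bar> \<le> D" using H_le by simp
      have "\<bar>a * H i z\<bar> \<le> a * D" using Hi a(1) by (simp add: abs_mult)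
      then have "\<bar>a * H i z\<bar> \<le> 1" using aD by linarith
      then have "exp (a * H i z) \<le> 1 + a * H i z + (a * H i z)\<^sup>2" by (rule exp_le_quadratic)
      also have "(a * H i z)\<^sup>2 \<le> (a * D)\<^sup>2"
        using \<open>\<bar>a * H i z\<bar> \<le> a * D\<close> by (metis abs_le_square_iff abs_of_nonneg abs_ge_zero order.trans)
      finally show "exp (a * H i z) \<le> 1 + a * H i z + a * (a * D\<^sup>2)"
        by (simp add: power2_eq_square algebra_simps)
    qed simp
    also have "\<dots> = R z * (1 + a * (\<Sum>i<N. p i * H i z) + a * (a * D\<^sup>2))"
    proof -
      have "(\<Sum>i<N. p i * (R z * (1 + a * H i z + a * (a * D\<^sup>2))))
          = (\<Sum>i<N. p i * (R z * (1 + a * (a * D\<^sup>2))) + R z * a * (p i * H i z))"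
        by (intro sum.cong refl) (simp add: algebra_simps)
      also have "\<dots> = R z * (1 + a * (a * D\<^sup>2)) + R z * a * (\<Sum>i<N. p i * H i z)"
        by (simp add: sum.distrib sum_distrib_left)
      finally show ?thesis by (simp add: algebra_simps)
    qed
    also have "\<dots> \<le> R z * r"
    proof (intro mult_left_mono R_nonneg)
      have "a * (\<Sum>i<N. p i * H i z) \<le> a * (- c)" using H_mean a(1) by (intro mult_left_mono) auto
      then have "1 + a * (\<Sum>i<N. p i * H i z) + a * (a * D\<^sup>2) \<le> 1 - a * c / 2" using aD(2) by simp
      then show "1 + a * (\<Sum>i<N. p i * H i z) + a * (a * D\<^sup>2) \<le> r" by (simp add: r_def)
    qed
    finally show ?thesis by (simp add: mult.commute)
  qed
  have pow: "transfer_pow pair_step k R z \<le> r ^ k * R z" for k z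
  proof (induction k arbitrary: z)
    case (Suc k)
    have "transfer_pow pair_step (Suc k) R z \<le> transfer pair_step (\<lambda>z. r ^ k * R z) z"
      using Suc by (auto intro: transfer_mono)
    also have "\<dots> = r ^ k * transfer pair_step R z" by (rule transfer_cmult)
    also have "\<dots> \<le> r ^ k * (r * R z)" using step r by (intro mult_left_mono) auto
    finally show ?case by (simp add: mult_ac)
  qed simp
  show thesis
  proof (rule that[OF a(1-3) _ r])
    show "0 \<le> exp (a * G) * exp (a * G)" by simp
    fix k z
    have lower: "pair_dist z powr a \<le> exp (a * G) * R z + 0" for z
    proof -
      have "0 \<le> a * G + a * g z" using G[of z] a(1) by (simp flip: distrib_left)
      then have "pair_dist z powr a * 1 \<le> pair_dist z powr a * exp (a * G + a * g z)"
        by (intro mult_left_mono) auto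
      then show ?thesis by (simp add: R_def exp_add mult_ac)
    qed
    have upper: "R z \<le> exp (a * G)" for z
    proof -
      have "pair_dist z powr a \<le> 1" using pair_dist_bounds[of z] a(1) by (intro powr_le1) auto
      moreover have "exp (a * g z) \<le> exp (a * G)" using G[of z] a(1) by (simp add: abs_le_iff)
      ultimately have "R z \<le> 1 * exp (a * G)" unfolding R_def by (intro mult_mono) auto
      then show ?thesis by simp
    qed
    have "transfer_pow pair_step k (\<lambda>z. pair_dist z powr a) z \<le> transfer_pow pair_step k (\<lambda>z. exp (a * G) * R z + 0 * 0) z"
      using lower by (intro transfer_pow_mono) simp
    also have "\<dots> = exp (a * G) * transfer_pow pair_step k R z"
      by (subst transfer_pow_linear) simp
    also have "\<dots> \<le> exp (a * G) * (r ^ k * exp (a * G))"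
      using pow[of k z] upper[of z] r by (intro mult_left_mono) (auto intro: order.trans mult_left_mono)
    finally show "transfer_pow pair_step k (\<lambda>z. pair_dist z powr a) z \<le> exp (a * G) * exp (a * G) * r ^ k"
      by (simp add: mult_ac)
  qed
qed

end

section \<open>Stationary measures and the Lyapunov exponent\<close>

context circle_system
begin

text \<open>The convolution of \<open>\<mu>\<close> and \<open>\<nu>\<close>, that is, the average
  of the push-forwards in the stationarity equation. As the image of a product measure it is a
  probability measure at once, and Fubini's theorem gives its integrals.\<close>

definition mix :: "circle measure \<Rightarrow> circle measure" where
  "mix \<nu> = distr (\<mu> \<Otimes>\<^sub>M \<nu>) borel (\<lambda>(i, x). f i x)"

lemma measurable_symbol_pair:
  assumes \<nu>: "borel_prob \<nu>" and h: "\<And>i. i < N \<Longrightarrow> h i \<in> measurable borel M"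
  shows "(\<lambda>(i, x). h i x) \<in> measurable (\<mu> \<Otimes>\<^sub>M \<nu>) M"
proof -
  have "sets (\<mu> \<Otimes>\<^sub>M \<nu>) = sets (count_space {..<N} \<Otimes>\<^sub>M borel)"
    using borel_probD(2)[OF \<nu>] by (intro sets_pair_measure_cong) auto
  moreover have "(\<lambda>(i, x). h i x) \<in> measurable (count_space {..<N} \<Otimes>\<^sub>M borel) M"
    by (rule measurable_pair_measure_countable1) (auto intro: h)
  ultimately show ?thesis using measurable_cong_sets by blast
qed

lemma borel_prob_mix:
  assumes \<nu>: "borel_prob \<nu>"
  shows "borel_prob (mix \<nu>)"
proof -
  interpret \<mu>: prob_space \<mu> by (rule prob_space_\<mu>)
  interpret \<nu>: prob_space \<nu> by (rule borel_probD[OF \<nu>])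
  interpret pair_prob_space \<mu> \<nu> by unfold_locales
  show ?thesis
    unfolding mix_def by (intro borel_prob_distr measurable_symbol_pair[OF \<nu>] measurable_f prob_space_axioms)
qed

lemma integral_mix:
  fixes h :: "circle \<Rightarrow> real"
  assumes \<nu>: "borel_prob \<nu>" and h: "h \<in> borel_measurable borel" and B: "\<And>x. \<bar>h x\<bar> \<le> B"
  shows "integral\<^sup>L (mix \<nu>) h = (\<Sum>i<N. p i * (\<integral>x. h (f i x) \<partial>\<nu>))"
proof -
  interpret \<mu>: prob_space \<mu> by (rule prob_space_\<mu>)
  interpret \<nu>: prob_space \<nu> by (rule borel_probD[OF \<nu>])
  interpret PP: pair_prob_space \<mu> \<nu> by unfold_locales
  have meas: "(\<lambda>(i, x). h (f i x)) \<in> borel_measurable (\<mu> \<Otimes>\<^sub>M \<nu>)"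
    by (intro measurable_symbol_pair[OF \<nu>] measurable_compose[OF measurable_f h])
  have "integral\<^sup>L (mix \<nu>) h = (\<integral>z. h (case z of (i, x) \<Rightarrow> f i x) \<partial>(\<mu> \<Otimes>\<^sub>M \<nu>))"
    unfolding mix_def by (intro integral_distr measurable_symbol_pair[OF \<nu>] measurable_f h)
  also have "\<dots> = (\<integral>(i, x). h (f i x) \<partial>(\<mu> \<Otimes>\<^sub>M \<nu>))"
    by (intro Bochner_Integration.integral_cong) auto
  also have "\<dots> = (\<integral>i. (\<integral>x. h (f i x) \<partial>\<nu>) \<partial>\<mu>)"
    using PP.integral_fst'[of "\<lambda>(i, x). h (f i x)"] meas B
    by (simp add: PP.integrable_const_bound[of _ B] split_beta')
  finally show ?thesis by (simp add: integral_\<mu>)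
qed

lemma stationary_iff_mix: "stationary N f \<mu> \<nu> \<longleftrightarrow> borel_prob \<nu> \<and> mix \<nu> = \<nu>"
proof -
  have eq: "measure (mix \<nu>) A = (\<Sum>i<N. p i * measure (distr \<nu> borel (f i)) A)"
    if \<nu>: "borel_prob \<nu>" and A: "A \<in> sets borel" for A
  proof -
    have "measure (mix \<nu>) A = integral\<^sup>L (mix \<nu>) (indicator A)"
      using A borel_probD[OF borel_prob_mix[OF \<nu>]] by simp
    also have "\<dots> = (\<Sum>i<N. p i * (\<integral>x. indicator A (f i x) \<partial>\<nu>))"
      using A by (intro integral_mix[OF \<nu>, of _ 1]) auto
    also have "\<dots> = (\<Sum>i<N. p i * measure (distr \<nu> borel (f i)) A)"
    proof (intro sum.cong refl arg_cong2[of _ _ _ _ "(*)"])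
      fix i assume "i \<in> {..<N}"
      then have "f i \<in> borel_measurable \<nu>" by (intro borel_prob_measurable[OF \<nu>] measurable_f) simp
      then have "integral\<^sup>L (distr \<nu> borel (f i)) (indicator A :: circle \<Rightarrow> real) = (\<integral>x. indicator A (f i x) \<partial>\<nu>)"
        using A by (intro integral_distr) auto
      then show "(\<integral>x. indicator A (f i x) \<partial>\<nu>) = measure (distr \<nu> borel (f i)) A" using A by simp
    qed
    finally show ?thesis .
  qed
  show ?thesis
  proof (cases "borel_prob \<nu>")
    case True
    interpret \<nu>: prob_space \<nu> by (rule borel_probD[OF True])
    interpret M: prob_space "mix \<nu>" by (rule borel_probD[OF borel_prob_mix[OF True]])
    have "mix \<nu> = \<nu> \<longleftrightarrow> (\<forall>A\<in>sets borel. measure \<nu> A = measure (mix \<nu>) A)"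
    proof
      assume "\<forall>A\<in>sets borel. measure \<nu> A = measure (mix \<nu>) A"
      then show "mix \<nu> = \<nu>"
        using borel_probD[OF True] borel_probD[OF borel_prob_mix[OF True]]
        by (intro measure_eqI) (auto simp: \<nu>.emeasure_eq_measure M.emeasure_eq_measure)
    qed simp
    then show ?thesis unfolding stationary_def using True eq[OF True] by auto
  qed (simp add: stationary_def)
qed

lemma stationary_integral_transfer:
  assumes \<nu>: "stationary N f \<mu> \<nu>" and v: "continuous_on UNIV v"
  shows "(\<integral>x. transfer_pow f k v x \<partial>\<nu>) = (\<integral>x. v x \<partial>\<nu>)"
proof (induction k)
  case (Suc k)
  have bp: "borel_prob \<nu>" "mix \<nu> = \<nu>" using \<nu> by (auto simp: stationary_iff_mix)
  let ?w = "transfer_pow f k v"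
  have w: "continuous_on UNIV ?w" by (intro continuous_transfer_pow continuous_f v)
  obtain B where B: "\<And>x. \<bar>?w x\<bar> \<le> B" using continuous_on_circle_bounded[OF w] by blast
  have "(\<integral>x. transfer_pow f (Suc k) v x \<partial>\<nu>) = (\<Sum>i<N. p i * (\<integral>x. ?w (f i x) \<partial>\<nu>))"
    unfolding transfer_pow_Suc
    by (subst Bochner_Integration.integral_sum)
      (auto intro!: integrable_mult_right integrable_continuous_circle[OF bp(1)] continuous_on_compose2[OF w continuous_f])
  also have "\<dots> = integral\<^sup>L (mix \<nu>) ?w"
    by (intro integral_mix[OF bp(1) _ B, symmetric] borel_measurable_continuous_onI w)
  finally show ?case using Suc bp by simp
qed simp

text \<open>Serves as approximating sequence for a stationary measure; its integrals are values of
  transfer iterates at the starting point.\<close>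

definition trajectory_law :: "circle \<Rightarrow> nat \<Rightarrow> circle measure" where
  "trajectory_law x n = distr P borel (\<lambda>w. fiber_iter f w n x)"

lemma borel_prob_trajectory_law: "borel_prob (trajectory_law x n)"
  unfolding trajectory_law_def
  by (intro borel_prob_distr prob_space_P measurable_finitary[OF finitary_fiber_iter]) simp

lemma integral_trajectory_law:
  assumes "v \<in> borel_measurable borel"
  shows "integral\<^sup>L (trajectory_law x n) v = transfer_pow f n v x"
  unfolding trajectory_law_def integral_fiber_iter[symmetric]
  by (intro integral_distr measurable_finitary[OF finitary_fiber_iter] assms) simp

end

text \<open>Fixes the constants furnished by \<open>pair_dist_contraction\<close>, so that the
  consequences of the spectral gap share the same exponent and rate.\<close>

locale contracting_system = circle_holder_system N \<mu> f \<beta> for N \<mu> f \<beta> +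
  fixes a C r :: real
  assumes exponent: "0 < a" "a \<le> \<beta>" "a \<le> 1" and C_nonneg: "0 \<le> C" and rate: "0 < r" "r < 1"
    and contraction: "transfer_pow pair_step k (\<lambda>z. pair_dist z powr a) z \<le> C * r ^ k"
begin

text \<open>Both trajectories are driven by the same word, so the difference of the two iterates is
  a single iterate on pairs.\<close>

lemma transfer_oscillation:
  assumes "K \<ge> 0" "\<And>x y. \<bar>v x - v y\<bar> \<le> K * dist x y powr a"
  shows "\<bar>transfer_pow f k v x - transfer_pow f k v y\<bar> \<le> K * C * r ^ k"
proof -
  have "\<bar>transfer_pow pair_step k (\<lambda>z. v (fst z)) (x, y) - transfer_pow pair_step k (\<lambda>z. v (snd z)) (x, y)\<bar>
      \<le> K * transfer_pow pair_step k (\<lambda>z. pair_dist z powr a) (x, y) + 0"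
    using assms(2) by (intro transfer_pow_abs_diff_le) (simp add: pair_dist_def)
  also have "\<dots> \<le> K * (C * r ^ k)"
    using contraction assms(1) by (simp add: mult_left_mono)
  finally show ?thesis by (simp add: transfer_pair_fst transfer_pair_snd mult.assoc)
qed

lemma lipschitz_imp_holder:
  fixes v :: "circle \<Rightarrow> real"
  assumes "\<And>x y. \<bar>v x - v y\<bar> \<le> L * dist x y"
  shows "\<bar>v x - v y\<bar> \<le> max L 0 * dist x y powr a"
proof -
  have "dist x y \<le> dist x y powr a"
    using powr_mono'[of a 1 "dist x y"] exponent dist_circle_le_half[of x y] by simp
  then have "L * dist x y \<le> max L 0 * dist x y powr a" by (intro mult_mono) auto
  with assms show ?thesis by (rule order.trans)
qed

lemma rate_tendsto_0: "(\<lambda>k. K * r ^ k) \<longlonglongrightarrow> 0"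
  using tendsto_mult_right_zero[OF LIMSEQ_power_zero[of r], of K] rate by simp

text \<open>A weak limit of the laws themselves, without time averages: consecutive iterates of a
  test function differ at \<open>x0\<close> by an average of oscillations, which decay
  geometrically.\<close>

lemma stationary_exists: "\<exists>\<nu>. stationary N f \<mu> \<nu>"
proof -
  define x0 :: circle where "x0 = undefined"
  obtain s \<nu> where s: "strict_mono (s :: nat \<Rightarrow> nat)" and \<nu>: "borel_prob \<nu>"
    and lim: "\<And>v :: circle \<Rightarrow> real. continuous_on UNIV v \<Longrightarrow>
      (\<lambda>n. integral\<^sup>L (trajectory_law x0 (s n)) v) \<longlonglongrightarrow> integral\<^sup>L \<nu> v"
    using circle_weak_compactness[of "trajectory_law x0", OF borel_prob_trajectory_law] by blast
  have "mix \<nu> = \<nu>"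
  proof (rule borel_prob_eqI_lipschitz[OF borel_prob_mix[OF \<nu>] \<nu>])
    fix L and v :: "circle \<Rightarrow> real"
    assume bnd: "\<And>x. 0 \<le> v x \<and> v x \<le> 1" and lip: "\<And>x y. \<bar>v x - v y\<bar> \<le> L * dist x y"
    define K where "K = max L 0"
    have v: "continuous_on UNIV v" by (rule lipschitz_imp_continuous_on[OF lip])
    have Tv: "continuous_on UNIV (transfer f v)"
      using continuous_transfer_pow[of f v 1] continuous_f v by simp
    have meas: "v \<in> borel_measurable borel" "transfer f v \<in> borel_measurable borel"
      by (intro borel_measurable_continuous_onI v Tv)+
    have osc: "\<bar>transfer_pow f k v x - transfer_pow f k v y\<bar> \<le> K * C * r ^ k" for k x y
      by (rule transfer_oscillation) (use lipschitz_imp_holder[OF lip] in \<open>auto simp: K_def\<close>)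
    have "(\<lambda>n. transfer_pow f (s n) (transfer f v) x0 - transfer_pow f (s n) v x0) \<longlonglongrightarrow> 0"
    proof (rule Lim_null_comparison)
      show "(\<lambda>n. K * C * r ^ s n) \<longlonglongrightarrow> 0"
        using LIMSEQ_subseq_LIMSEQ[OF rate_tendsto_0 s] by (simp add: comp_def)
      have "\<bar>transfer_pow f k (transfer f v) x0 - transfer_pow f k v x0\<bar> \<le> K * C * r ^ k" for k
      proof -
        have "transfer_pow f k (transfer f v) x0 = transfer_pow f (Suc k) v x0"
          by (simp only: funpow_Suc_right comp_apply)
        then have "transfer_pow f k (transfer f v) x0 - transfer_pow f k v x0
            = (\<Sum>i<N. p i * (transfer_pow f k v (f i x0) - transfer_pow f k v x0))"
          unfolding transfer_pow_Suc by (simp add: right_diff_distrib sum_subtractf)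
        moreover have "\<bar>\<Sum>i<N. p i * (transfer_pow f k v (f i x0) - transfer_pow f k v x0)\<bar> \<le> K * C * r ^ k"
          by (intro weighted_abs_le osc)
        ultimately show ?thesis by simp
      qed
      then show "\<forall>\<^sub>F n in sequentially. norm (transfer_pow f (s n) (transfer f v) x0 - transfer_pow f (s n) v x0)
          \<le> K * C * r ^ s n" by simp
    qed
    moreover have "(\<lambda>n. transfer_pow f (s n) (transfer f v) x0 - transfer_pow f (s n) v x0)
        \<longlonglongrightarrow> integral\<^sup>L \<nu> (transfer f v) - integral\<^sup>L \<nu> v"
      using tendsto_diff[OF lim[OF Tv] lim[OF v]] by (simp add: integral_trajectory_law meas)
    ultimately have "integral\<^sup>L \<nu> (transfer f v) = integral\<^sup>L \<nu> v"
      using LIMSEQ_unique by fastforce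
    moreover have "integral\<^sup>L (mix \<nu>) v = integral\<^sup>L \<nu> (transfer f v)"
    proof -
      have "integral\<^sup>L (mix \<nu>) v = (\<Sum>i<N. p i * (\<integral>x. v (f i x) \<partial>\<nu>))"
        using bnd by (intro integral_mix[OF \<nu> meas(1), of 1]) (auto simp: abs_le_iff intro: order.trans[of _ 0])
      also have "\<dots> = (\<integral>x. (\<Sum>i<N. p i * v (f i x)) \<partial>\<nu>)"
        by (subst Bochner_Integration.integral_sum)
          (auto intro!: integrable_mult_right integrable_continuous_circle[OF \<nu>] continuous_on_compose2[OF v continuous_f])
      finally show ?thesis by (simp add: transfer_def[abs_def])
    qed
    ultimately show "integral\<^sup>L (mix \<nu>) v = integral\<^sup>L \<nu> v" by simp
  qed
  with \<nu> show ?thesis using stationary_iff_mix by blast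
qed

text \<open>The oscillation bound is integrated over the second point; stationarity turns the
  integral of the iterate into that of \<open>v\<close>.\<close>

lemma transfer_pow_near_stationary_mean:
  assumes \<nu>: "stationary N f \<mu> \<nu>" and v: "continuous_on UNIV v"
    and K: "K \<ge> 0" "\<And>x y. \<bar>v x - v y\<bar> \<le> K * dist x y powr a"
  shows "\<bar>transfer_pow f k v x - (\<integral>x. v x \<partial>\<nu>)\<bar> \<le> K * C * r ^ k"
proof -
  have bp: "borel_prob \<nu>" using \<nu> by (simp add: stationary_def)
  interpret prob_space \<nu> by (rule borel_probD[OF bp])
  have int: "integrable \<nu> (transfer_pow f k v)"
    by (intro integrable_continuous_circle[OF bp] continuous_transfer_pow continuous_f v)
  have "\<bar>transfer_pow f k v x - (\<integral>y. transfer_pow f k v y \<partial>\<nu>)\<bar>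
      = \<bar>\<integral>y. transfer_pow f k v x - transfer_pow f k v y \<partial>\<nu>\<bar>"
    using int by (simp add: prob_space)
  also have "\<dots> \<le> (\<integral>y. \<bar>transfer_pow f k v x - transfer_pow f k v y\<bar> \<partial>\<nu>)"
    by (rule integral_abs_bound)
  also have "\<dots> \<le> (\<integral>y. K * C * r ^ k \<partial>\<nu>)"
    using int by (intro integral_mono transfer_oscillation K) auto
  finally show ?thesis by (simp add: prob_space stationary_integral_transfer[OF \<nu> v])
qed

lemma stationary_unique:
  assumes \<nu>: "stationary N f \<mu> \<nu>" and \<nu>': "stationary N f \<mu> \<nu>'"
  shows "\<nu> = \<nu>'"
proof (rule borel_prob_eqI_lipschitz)
  show "borel_prob \<nu>" "borel_prob \<nu>'" using assms by (auto simp: stationary_def)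
  fix L and v :: "circle \<Rightarrow> real" assume lip: "\<And>x y. \<bar>v x - v y\<bar> \<le> L * dist x y"
  have lim: "(\<lambda>k. transfer_pow f k v undefined) \<longlonglongrightarrow> integral\<^sup>L \<rho> v" if "stationary N f \<mu> \<rho>" for \<rho>
  proof (rule LIM_zero_cancel, rule Lim_null_comparison[OF _ rate_tendsto_0])
    show "\<forall>\<^sub>F k in sequentially. norm (transfer_pow f k v undefined - integral\<^sup>L \<rho> v) \<le> max L 0 * C * r ^ k"
      using transfer_pow_near_stationary_mean[OF that lipschitz_imp_continuous_on[OF lip], of "max L 0"]
        lipschitz_imp_holder[OF lip] by simp
  qed
  show "integral\<^sup>L \<nu> v = integral\<^sup>L \<nu>' v" by (rule LIMSEQ_unique[OF lim[OF \<nu>] lim[OF \<nu>']])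
qed

lemma stationary_stationary_measure: "stationary N f \<mu> (stationary_measure N f \<mu>)"
  unfolding stationary_measure_def using theI'[of "stationary N f \<mu>"] stationary_exists stationary_unique by blast

abbreviation \<gamma> :: real where "\<gamma> \<equiv> fiber_lyapunov_exponent N f \<mu>"

lemma lyapunov_exponent_eq: "\<gamma> = (\<integral>x. log_drift x \<partial>stationary_measure N f \<mu>)"
proof -
  let ?\<nu> = "stationary_measure N f \<mu>"
  let ?h = "\<lambda>i x. ln \<bar>circle_deriv (f i) x\<bar>"
  have \<nu>: "borel_prob ?\<nu>" using stationary_stationary_measure by (simp add: stationary_def)
  interpret P: prob_space P by (rule prob_space_P)
  interpret \<nu>: prob_space ?\<nu> by (rule borel_probD[OF \<nu>])
  interpret PP: pair_prob_space P ?\<nu> by unfold_locales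
  obtain B where B: "B \<ge> 0" "\<And>i z. i < N \<Longrightarrow> \<bar>increment i z\<bar> \<le> B" using increment_bounded by blast
  have h_le: "\<bar>?h i x\<bar> \<le> B" if "i < N" for i x
    using B(2)[OF that, of "(x, x)"] by (simp add: increment_def log_ratio_def)
  have c: "(\<lambda>w. w 0) \<in> measurable P \<mu>"
    unfolding bernoulli_measure_def by (rule measurable_component_singleton) simp
  have proj: "(\<lambda>z. (fst z 0, snd z)) \<in> measurable (P \<Otimes>\<^sub>M ?\<nu>) (\<mu> \<Otimes>\<^sub>M ?\<nu>)"
    by (intro measurable_Pair measurable_compose[OF measurable_fst c] measurable_snd)
  have h_meas: "(\<lambda>(i, x). ?h i x) \<in> borel_measurable (\<mu> \<Otimes>\<^sub>M ?\<nu>)"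
    by (intro measurable_symbol_pair[OF \<nu>] borel_measurable_continuous_onI continuous_log_deriv)
  have meas: "(\<lambda>(w, x). ?h (w 0) x) \<in> borel_measurable (P \<Otimes>\<^sub>M ?\<nu>)"
    using measurable_compose[OF proj h_meas] by (simp add: split_beta')
  have "integrable (P \<Otimes>\<^sub>M ?\<nu>) (\<lambda>(w, x). ?h (w 0) x)"
    using meas h_le by (intro PP.integrable_const_bound[of _ B]) (auto intro!: AE_I2 simp: space_pair_measure space_P)
  then have "\<gamma> = (\<integral>w. (\<integral>x. ?h (w 0) x \<partial>?\<nu>) \<partial>P)"
    using PP.integral_fst'[of "\<lambda>(w, x). ?h (w 0) x"] by (simp add: fiber_lyapunov_exponent_def)
  also have "\<dots> = (\<Sum>i<N. p i * (\<integral>x. ?h i x \<partial>?\<nu>))"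
    by (subst integral_P_unfold[of 1]) (auto simp: finitary_def P.prob_space)
  also have "\<dots> = (\<integral>x. log_drift x \<partial>?\<nu>)"
    unfolding log_drift_def
    by (subst Bochner_Integration.integral_sum)
      (auto intro!: integrable_mult_right integrable_continuous_circle[OF \<nu>] continuous_log_deriv)
  finally show ?thesis .
qed

text \<open>By stationarity the integral of the Birkhoff sum of length \<open>n\<close> is
  \<open>n * \<gamma>\<close>. Its integrand is bounded by the averaged drift estimate on the
  diagonal, where \<open>pair_drift\<close> is \<open>log_drift\<close>.\<close>

lemma lyapunov_exponent_negative: "\<gamma> < 0"
proof -
  let ?\<nu> = "stationary_measure N f \<mu>"
  have st: "stationary N f \<mu> ?\<nu>" by (rule stationary_stationary_measure)
  then have \<nu>: "borel_prob ?\<nu>" by (simp add: stationary_def)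
  interpret \<nu>: prob_space ?\<nu> by (rule borel_probD[OF \<nu>])
  obtain n c where n: "n > 0" "c > 0" "\<And>z. birkhoff pair_step n pair_drift z / real n \<le> - c"
    using pair_drift_mean_negative by blast
  have diag: "transfer_pow pair_step k pair_drift (x, x) = transfer_pow f k log_drift x" for k x
  proof (induction k arbitrary: x)
    case (Suc k)
    then show ?case by (simp add: transfer_pow_Suc pair_step_def del: funpow.simps)
  qed (simp add: pair_drift_diag)
  have "birkhoff f n log_drift x / real n \<le> - c" for x
    using n(3)[of "(x, x)"] by (simp add: birkhoff_def diag)
  then have le: "birkhoff f n log_drift x \<le> - c * n" for x using n(1) by (simp add: pos_divide_le_eq)
  have int: "integrable ?\<nu> (transfer_pow f k log_drift)" for k
    by (intro integrable_continuous_circle[OF \<nu>] continuous_transfer_pow continuous_f continuous_log_drift)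
  have "n * \<gamma> = (\<Sum>k<n. \<integral>x. transfer_pow f k log_drift x \<partial>?\<nu>)"
    by (simp add: stationary_integral_transfer[OF st continuous_log_drift] lyapunov_exponent_eq)
  also have "\<dots> = (\<integral>x. birkhoff f n log_drift x \<partial>?\<nu>)"
    unfolding birkhoff_def using int by (subst Bochner_Integration.integral_sum) auto
  also have "\<dots> \<le> (\<integral>x. - c * n \<partial>?\<nu>)"
    using int le by (intro integral_mono) (auto simp: birkhoff_def[abs_def])
  also have "\<dots> = n * (- c)" by (simp add: \<nu>.prob_space)
  finally have "\<gamma> \<le> - c" using n(1) by (simp only: mult_le_cancel_left_pos of_nat_0_less_iff)
  with n(2) show ?thesis by simp
qed

text \<open>Hoelder control of \<open>pair_drift\<close> is available at the diagonal only.
  Replacing it by \<open>log_drift\<close> of the first point costs a power of the distance, which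
  the iteration contracts, and \<open>log_drift\<close> itself is a Hoelder function on the
  circle.\<close>

lemma pair_drift_convergence:
  obtains D where "D \<ge> 0" "\<And>k z. \<bar>transfer_pow pair_step k pair_drift z - \<gamma>\<bar> \<le> D * r ^ k"
proof -
  obtain K where K: "K \<ge> 0" "\<And>z. \<bar>pair_drift z - log_drift (fst z)\<bar> \<le> K * pair_dist z powr a"
    "\<And>z. \<bar>log_drift (fst z) - log_drift (snd z)\<bar> \<le> K * pair_dist z powr a"
    using pair_drift_holder[OF exponent(1,2)] by blast
  show thesis
  proof (rule that)
    show "0 \<le> 2 * (K * C)" using K(1) C_nonneg by simp
    fix k z
    have "\<bar>transfer_pow pair_step k pair_drift z - transfer_pow pair_step k (\<lambda>z. log_drift (fst z)) z\<bar>
        \<le> K * transfer_pow pair_step k (\<lambda>z. pair_dist z powr a) z + 0"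
      using K(2) by (intro transfer_pow_abs_diff_le) simp
    also have "\<dots> \<le> K * C * r ^ k"
      using contraction[of k z] K(1) by (simp add: mult_left_mono mult.assoc)
    finally have "\<bar>transfer_pow pair_step k pair_drift z - transfer_pow f k log_drift (fst z)\<bar> \<le> K * C * r ^ k"
      by (simp add: transfer_pair_fst)
    moreover have "\<bar>transfer_pow f k log_drift (fst z) - \<gamma>\<bar> \<le> K * C * r ^ k"
      unfolding lyapunov_exponent_eq
    proof (rule transfer_pow_near_stationary_mean[OF stationary_stationary_measure continuous_log_drift K(1)])
      fix x y show "\<bar>log_drift x - log_drift y\<bar> \<le> K * dist x y powr a"
        using K(3)[of "(x, y)"] by (simp add: pair_dist_def)
    qed
    ultimately show "\<bar>transfer_pow pair_step k pair_drift z - \<gamma>\<bar> \<le> 2 * (K * C) * r ^ k" by linarith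
  qed
qed

end

section \<open>Large deviations\<close>

context circle_holder_system
begin

text \<open>The chain rule. Existence and nonvanishing are carried through the induction because
  \<open>circle_deriv\<close> is a definite description and the logarithm of a product splits only
  for nonzero factors.\<close>

lemma has_deriv_fiber_iter:
  assumes w: "\<And>k. w k < N"
  shows "\<exists>D. D \<noteq> 0 \<and> circle_has_deriv (fiber_iter f w n) D x \<and>
    ln \<bar>D\<bar> = cocycle pair_step increment w n (x, x)"
proof (induction n)
  case 0
  have "circle_has_deriv id 1 x"
    unfolding circle_has_deriv_def circle_lift_def
    by (intro exI[of _ id]) (auto simp: id_def intro!: continuous_intros derivative_eq_intros)
  then show ?case by (intro exI[of _ 1]) (simp add: cocycle_def id_def)
next
  case (Suc n)
  then obtain D where D: "D \<noteq> 0" "circle_has_deriv (fiber_iter f w n) D x"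
    "ln \<bar>D\<bar> = cocycle pair_step increment w n (x, x)" by blast
  let ?y = "fiber_iter f w n x"
  let ?E = "circle_deriv (f (w n)) ?y"
  have E: "circle_has_deriv (f (w n)) ?E ?y"
    by (intro circle_C1_has_deriv circle_C1_diffeo_C1 diffeo w)
  have "?E \<noteq> 0" by (intro deriv_nonzero w)
  then show ?case
    using D circle_has_deriv_comp[OF E D(2)]
    by (intro exI[of _ "?E * D"])
      (simp add: cocycle_def increment_def fiber_iter_pair_step log_ratio_def abs_mult ln_mult add.commute comp_def)
qed

lemma ln_deriv_fiber_iter:
  assumes "w \<in> space P"
  shows "ln \<bar>circle_deriv (fiber_iter f w n) x\<bar> = cocycle pair_step increment w n (x, x)"
  using has_deriv_fiber_iter[of w n x] assms circle_deriv_eq by (auto simp: space_P)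

lemma fiber_iter_neq:
  assumes "w \<in> space P" "x \<noteq> y"
  shows "fiber_iter f w n x \<noteq> fiber_iter f w n y"
proof (induction n)
  case (Suc n)
  have "inj (f (w n))"
    using assms(1) diffeo[of "w n"] by (auto simp: space_P circle_C1_diffeo_def bij_def)
  with Suc show ?case by (auto dest: injD)
qed (use assms in simp)

lemma ln_dist_fiber_iter:
  assumes w: "w \<in> space P" and neq: "x \<noteq> y"
  shows "ln (dist (fiber_iter f w n x) (fiber_iter f w n y) / dist x y)
    = cocycle pair_step increment w n (x, y)"
proof (induction n)
  case 0
  show ?case using neq by (simp add: cocycle_def)
next
  case (Suc n)
  let ?x = "fiber_iter f w n x" and ?y = "fiber_iter f w n y"
  have pos: "dist x y > 0" "dist ?x ?y > 0" "dist (f (w n) ?x) (f (w n) ?y) > 0"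
    using neq fiber_iter_neq[OF w neq, of n] fiber_iter_neq[OF w neq, of "Suc n"] by auto
  have "ln (dist (f (w n) ?x) (f (w n) ?y) / dist x y)
      = ln (dist ?x ?y / dist x y) + ln (dist (f (w n) ?x) (f (w n) ?y) / dist ?x ?y)"
    using pos by (simp add: ln_div)
  then show ?case
    using Suc fiber_iter_neq[OF w neq, of n]
    by (simp add: cocycle_def increment_def fiber_iter_pair_step log_ratio_def)
qed

end

context contracting_system
begin

section \<open>The Poisson equation and exponential moments\<close>

lemma sum_rate_le: "(\<Sum>k<n. r ^ k) \<le> 1 / (1 - r)"
  using sum_le_suminf[of "\<lambda>k. r ^ k" "{..<n}"] rate by (simp add: suminf_geometric summable_geometric)

lemma birkhoff_near_lyapunov:
  obtains D where "\<And>n z. \<bar>birkhoff pair_step n pair_drift z - real n * \<gamma>\<bar> \<le> D"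
proof -
  obtain D where D: "D \<ge> 0" "\<And>k z. \<bar>transfer_pow pair_step k pair_drift z - \<gamma>\<bar> \<le> D * r ^ k"
    using pair_drift_convergence by blast
  have "\<bar>birkhoff pair_step n pair_drift z - real n * \<gamma>\<bar> \<le> D * (1 / (1 - r))" for n z
  proof -
    have "\<bar>birkhoff pair_step n pair_drift z - real n * \<gamma>\<bar> = \<bar>\<Sum>k<n. transfer_pow pair_step k pair_drift z - \<gamma>\<bar>"
      by (simp add: birkhoff_def sum_subtractf)
    also have "\<dots> \<le> (\<Sum>k<n. D * r ^ k)"
      by (intro order.trans[OF sum_abs] sum_mono D(2))
    also have "\<dots> \<le> D * (1 / (1 - r))"
      unfolding sum_distrib_left[symmetric] using sum_rate_le D(1) by (rule mult_left_mono)
    finally show ?thesis .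
  qed
  then show thesis by (rule that)
qed

text \<open>\<open>g\<close> is the sum over all k of the k-th iterate of \<open>pair_drift\<close>
  minus \<open>\<gamma>\<close>, which converges geometrically; applying \<open>transfer\<close>
  removes the term k = 0.\<close>

lemma poisson_equation:
  obtains g G where "\<And>z. \<bar>g z\<bar> \<le> G" "\<And>z. pair_drift z - \<gamma> + transfer pair_step g z - g z = 0"
proof -
  obtain D where D: "D \<ge> 0" "\<And>k z. \<bar>transfer_pow pair_step k pair_drift z - \<gamma>\<bar> \<le> D * r ^ k"
    using pair_drift_convergence by blast
  define e where "e k z = transfer_pow pair_step k pair_drift z - \<gamma>" for k z
  have sr: "summable (\<lambda>k. D * r ^ k)" using rate by (intro summable_mult summable_geometric) simp
  have abs_e: "summable (\<lambda>k. \<bar>e k z\<bar>)" for z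
    by (rule summable_comparison_test'[OF sr]) (use D(2) in \<open>simp add: e_def\<close>)
  then have e: "summable (\<lambda>k. e k z)" for z by (rule summable_rabs_cancel)
  have trans: "transfer pair_step (e k) z = e (Suc k) z" for k z
    unfolding e_def[abs_def] by (simp add: transfer_diff)
  show thesis
  proof (rule that)
    fix z
    have "\<bar>\<Sum>k. e k z\<bar> \<le> (\<Sum>k. \<bar>e k z\<bar>)" by (rule summable_rabs[OF abs_e])
    also have "\<dots> \<le> (\<Sum>k. D * r ^ k)"
      by (intro suminf_le abs_e sr) (use D(2) in \<open>simp add: e_def\<close>)
    finally show "\<bar>\<Sum>k. e k z\<bar> \<le> (\<Sum>k. D * r ^ k)" .
    have "transfer pair_step (\<lambda>z. \<Sum>k. e k z) z = (\<Sum>k. transfer pair_step (e k) z)"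
      unfolding transfer_def by (simp add: suminf_sum suminf_mult summable_mult e)
    also have "\<dots> = (\<Sum>k. e (Suc k) z)" by (simp add: trans)
    also have "\<dots> = (\<Sum>k. e k z) - e 0 z" by (rule suminf_split_head[OF e])
    finally show "pair_drift z - \<gamma> + transfer pair_step (\<lambda>z. \<Sum>k. e k z) z - (\<Sum>k. e k z) = 0"
      by (simp add: e_def)
  qed
qed

lemma exponential_moment:
  obtains D G where "D \<ge> 1" "G \<ge> 0"
    "\<And>t n z. \<bar>t\<bar> * D \<le> 1 \<Longrightarrow>
      (\<integral>w. exp (t * (cocycle pair_step increment w n z - real n * \<gamma>)) \<partial>P)
        \<le> exp (2 * \<bar>t\<bar> * G + real n * (t * D)\<^sup>2)"
proof -
  obtain g G where G: "\<And>z. \<bar>g z\<bar> \<le> G" and g: "\<And>z. pair_drift z - \<gamma> + transfer pair_step g z - g z = 0"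
    using poisson_equation by blast
  have "G \<ge> 0" using G[of undefined] by linarith
  obtain B where B: "B \<ge> 0" "\<And>i z. i < N \<Longrightarrow> \<bar>increment i z\<bar> \<le> B" using increment_bounded by blast
  define D where "D = B + \<bar>\<gamma>\<bar> + 2 * G + 1"
  have "D \<ge> 1" using B(1) \<open>G \<ge> 0\<close> by (simp add: D_def)
  \<comment> \<open>Martingale differences: bounded by \<open>D\<close>, and of mean zero by the
    Poisson equation. Their sum differs from the centred cocycle by the boundary values of
    \<open>g\<close>.\<close>
  define \<xi> where "\<xi> i z = increment i z - \<gamma> + g (pair_step i z) - g z" for i z
  have \<xi>_le: "\<bar>\<xi> i z\<bar> \<le> D" if "i < N" for i z
    using B(2)[OF that, of z] G[of z] G[of "pair_step i z"] unfolding \<xi>_def D_def by linarith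
  have \<xi>_mean: "(\<Sum>i<N. p i * \<xi> i z) = 0" for z
    using g[of z] unfolding \<xi>_def pair_drift_def transfer_def
    by (simp add: algebra_simps sum.distrib sum_subtractf flip: sum_distrib_left)
  have mgf: "(\<Sum>i<N. p i * exp (t * \<xi> i z)) \<le> exp ((t * D)\<^sup>2)" if t: "\<bar>t\<bar> * D \<le> 1" for t z
  proof -
    have "(\<Sum>i<N. p i * exp (t * \<xi> i z)) \<le> (\<Sum>i<N. p i * (1 + t * \<xi> i z + (t * D)\<^sup>2))"
    proof (intro sum_mono mult_left_mono)
      fix i assume "i \<in> {..<N}"
      then have le: "\<bar>t * \<xi> i z\<bar> \<le> \<bar>t\<bar> * D"
        unfolding abs_mult using \<xi>_le by (intro mult_left_mono) auto
      then have "exp (t * \<xi> i z) \<le> 1 + t * \<xi> i z + (t * \<xi> i z)\<^sup>2"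
        using t by (intro exp_le_quadratic) linarith
      moreover have "(t * \<xi> i z)\<^sup>2 \<le> (t * D)\<^sup>2"
        using le \<open>D \<ge> 1\<close> by (simp add: abs_mult flip: abs_le_square_iff)
      ultimately show "exp (t * \<xi> i z) \<le> 1 + t * \<xi> i z + (t * D)\<^sup>2" by linarith
    qed simp
    also have "\<dots> = (\<Sum>i<N. p i * (1 + (t * D)\<^sup>2) + t * (p i * \<xi> i z))"
      by (intro sum.cong refl) (simp add: algebra_simps)
    also have "\<dots> = 1 + (t * D)\<^sup>2"
      using \<xi>_mean[of z] by (simp add: sum.distrib flip: sum_distrib_left)
    also have "\<dots> \<le> exp ((t * D)\<^sup>2)" by (rule exp_ge_add_one_self)
    finally show ?thesis .
  qed
  \<comment> \<open>The term \<open>t * g z\<close> closes the induction: the value of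
    \<open>g\<close> after the first step combines with the first increment into
    \<open>\<xi> i z\<close>.\<close>
  have moment: "(\<integral>w. exp (t * (cocycle pair_step increment w n z - real n * \<gamma>)) \<partial>P)
      \<le> exp (\<bar>t\<bar> * G + t * g z + real n * (t * D)\<^sup>2)" if t: "\<bar>t\<bar> * D \<le> 1" for t n z
  proof (induction n arbitrary: z)
    case 0
    have "\<bar>t * g z\<bar> \<le> \<bar>t\<bar> * G" unfolding abs_mult by (intro mult_left_mono G) simp
    then have "0 \<le> \<bar>t\<bar> * G + t * g z" by linarith
    then show ?case by (simp add: cocycle_def prob_space.prob_space[OF prob_space_P])
  next
    case (Suc n)
    have "(\<integral>w. exp (t * (cocycle pair_step increment w (Suc n) z - real (Suc n) * \<gamma>)) \<partial>P)
        = (\<Sum>i<N. p i * (exp (t * (increment i z - \<gamma>)) *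
            (\<integral>w. exp (t * (cocycle pair_step increment w n (pair_step i z) - real n * \<gamma>)) \<partial>P)))"
    proof (subst integral_P_unfold[OF finitary_cocycle[of "Suc n" "\<lambda>s. exp (t * (s - real (Suc n) * \<gamma>))"]],
        intro sum.cong refl arg_cong2[of _ _ _ _ "(*)"])
      fix i
      have "exp (t * (cocycle pair_step increment (case_nat i w) (Suc n) z - real (Suc n) * \<gamma>))
          = exp (t * (increment i z - \<gamma>)) * exp (t * (cocycle pair_step increment w n (pair_step i z) - real n * \<gamma>))" for w
        unfolding cocycle_case_nat by (simp add: algebra_simps flip: exp_add)
      then show "(\<integral>w. exp (t * (cocycle pair_step increment (case_nat i w) (Suc n) z - real (Suc n) * \<gamma>)) \<partial>P)
          = exp (t * (increment i z - \<gamma>)) * (\<integral>w. exp (t * (cocycle pair_step increment w n (pair_step i z) - real n * \<gamma>)) \<partial>P)"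
        by simp
    qed
    also have "\<dots> \<le> (\<Sum>i<N. p i * (exp (t * (increment i z - \<gamma>)) *
        exp (\<bar>t\<bar> * G + t * g (pair_step i z) + real n * (t * D)\<^sup>2)))"
      by (intro sum_mono mult_left_mono Suc) auto
    also have "\<dots> = (\<Sum>i<N. exp (\<bar>t\<bar> * G + t * g z + real n * (t * D)\<^sup>2) * (p i * exp (t * \<xi> i z)))"
      by (intro sum.cong refl) (simp add: \<xi>_def algebra_simps flip: exp_add)
    also have "\<dots> = exp (\<bar>t\<bar> * G + t * g z + real n * (t * D)\<^sup>2) * (\<Sum>i<N. p i * exp (t * \<xi> i z))"
      by (rule sum_distrib_left[symmetric])
    also have "\<dots> \<le> exp (\<bar>t\<bar> * G + t * g z + real n * (t * D)\<^sup>2) * exp ((t * D)\<^sup>2)"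
      by (intro mult_left_mono mgf t) simp
    also have "\<dots> = exp (\<bar>t\<bar> * G + t * g z + real (Suc n) * (t * D)\<^sup>2)"
      by (simp add: algebra_simps flip: exp_add)
    finally show ?case .
  qed
  show thesis
  proof (rule that[OF \<open>D \<ge> 1\<close> \<open>G \<ge> 0\<close>])
    fix t n z assume t: "\<bar>t\<bar> * D \<le> 1"
    have "\<bar>t * g z\<bar> \<le> \<bar>t\<bar> * G" unfolding abs_mult by (intro mult_left_mono G) simp
    then have "t * g z \<le> \<bar>t\<bar> * G" by linarith
    then show "(\<integral>w. exp (t * (cocycle pair_step increment w n z - real n * \<gamma>)) \<partial>P)
        \<le> exp (2 * \<bar>t\<bar> * G + real n * (t * D)\<^sup>2)"
      by (intro order.trans[OF moment[OF t]] exp_le_cancel_iff[THEN iffD2]) linarith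
  qed
qed

lemma large_deviations:
  obtains h \<epsilon>\<^sub>0 c where "h > 0" "\<epsilon>\<^sub>0 > 0" "c > 0"
    "\<And>z \<epsilon> n. 0 < \<epsilon> \<Longrightarrow> \<epsilon> < \<epsilon>\<^sub>0 \<Longrightarrow> n \<ge> 1 \<Longrightarrow>
      measure P {w \<in> space P. \<bar>1 / real n * cocycle pair_step increment w n z - \<gamma>\<bar> > \<epsilon>}
        \<le> c * exp (- (real n * h * \<epsilon>\<^sup>2))"
proof -
  obtain D G where D: "D \<ge> 1" and G: "G \<ge> 0" and mgf: "\<And>t n z. \<bar>t\<bar> * D \<le> 1 \<Longrightarrow>
      (\<integral>w. exp (t * (cocycle pair_step increment w n z - real n * \<gamma>)) \<partial>P)
        \<le> exp (2 * \<bar>t\<bar> * G + real n * (t * D)\<^sup>2)"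
    using exponential_moment by blast
  interpret prob_space P by (rule prob_space_P)
  show thesis
  proof (rule that)
    \<comment> \<open>The exponent per step is the square of t D minus t times \<epsilon>, minimal
      at \<open>t = \<epsilon> / (2 * D\<^sup>2)\<close> with value
      \<open>- \<epsilon>\<^sup>2 / (4 * D\<^sup>2)\<close>. The range below \<open>2 * D\<close>
      ensures \<open>t * D \<le> 1\<close>. The factor 2 counts the two tails, and
      \<open>exp (2 * G)\<close> bounds the boundary terms since \<open>t \<le> 1\<close>.\<close>
    show "1 / (4 * D\<^sup>2) > 0" "2 * D > 0" "2 * exp (2 * G) > 0" using D by auto
    fix z \<epsilon> and n :: nat assume \<epsilon>: "0 < \<epsilon>" "\<epsilon> < 2 * D" and n: "n \<ge> 1"
    define t where "t = \<epsilon> / (2 * D\<^sup>2)"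
    have t: "t > 0" using \<epsilon> D by (simp add: t_def)
    have tD: "t * D \<le> 1" using \<epsilon> D by (simp add: t_def field_simps power2_eq_square)
    have "t * 1 \<le> t * D" using D t by (intro mult_left_mono) auto
    then have t1: "t \<le> 1" using tD by linarith
    let ?S = "\<lambda>w. cocycle pair_step increment w n z - real n * \<gamma>"
    let ?E = "\<lambda>s. {w \<in> space P. exp (s * ?S w) \<ge> exp (t * (real n * \<epsilon>))}"
    have int: "integrable P (\<lambda>w. exp (s * ?S w))" for s
      by (rule integrable_finitary[OF finitary_cocycle])
    have E_sets: "?E s \<in> sets P" for s
      using int by (intro borel_measurable_le) auto
    have E_le: "measure P (?E s) \<le> exp (2 * G) * exp (- (real n * (1 / (4 * D\<^sup>2)) * \<epsilon>\<^sup>2))" if s: "\<bar>s\<bar> = t" for s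
    proof -
      have "measure P (?E s) \<le> (\<integral>w. exp (s * ?S w) \<partial>P) / exp (t * (real n * \<epsilon>))"
        by (rule integral_Markov_inequality_measure[OF int sets.empty_sets]) auto
      also have "\<dots> \<le> exp (2 * \<bar>s\<bar> * G + real n * (s * D)\<^sup>2) / exp (t * (real n * \<epsilon>))"
        using s tD by (intro divide_right_mono mgf) auto
      also have "\<dots> = exp (2 * t * G + (real n * (t * D)\<^sup>2 - t * (real n * \<epsilon>)))"
        using s by (simp add: power_mult_distrib flip: exp_diff power2_abs[of s])
      also have "real n * (t * D)\<^sup>2 - t * (real n * \<epsilon>) = - (real n * (1 / (4 * D\<^sup>2)) * \<epsilon>\<^sup>2)"
        using D by (simp add: t_def field_simps power2_eq_square)
      also have "exp (2 * t * G + - (real n * (1 / (4 * D\<^sup>2)) * \<epsilon>\<^sup>2)) \<le> exp (2 * G + - (real n * (1 / (4 * D\<^sup>2)) * \<epsilon>\<^sup>2))"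
        using t1 G mult_right_mono[of t 1 G] by simp
      also have "\<dots> = exp (2 * G) * exp (- (real n * (1 / (4 * D\<^sup>2)) * \<epsilon>\<^sup>2))" by (rule exp_add)
      finally show ?thesis .
    qed
    have "{w \<in> space P. \<bar>1 / real n * cocycle pair_step increment w n z - \<gamma>\<bar> > \<epsilon>} \<subseteq> ?E t \<union> ?E (- t)"
    proof
      fix w assume "w \<in> {w \<in> space P. \<bar>1 / real n * cocycle pair_step increment w n z - \<gamma>\<bar> > \<epsilon>}"
      then have w: "w \<in> space P" "\<epsilon> < \<bar>1 / real n * cocycle pair_step increment w n z - \<gamma>\<bar>" by auto
      have "1 / real n * cocycle pair_step increment w n z - \<gamma> = ?S w / real n"
        using n by (simp add: field_simps)
      then have "real n * \<epsilon> < \<bar>?S w\<bar>" using w(2) n by (simp add: field_simps)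
      then have "real n * \<epsilon> \<le> ?S w \<or> real n * \<epsilon> \<le> - ?S w" by linarith
      then have "t * (real n * \<epsilon>) \<le> t * ?S w \<or> t * (real n * \<epsilon>) \<le> - t * ?S w"
        using t by (metis less_imp_le minus_mult_commute mult_left_mono)
      then show "w \<in> ?E t \<union> ?E (- t)" using w(1) by auto
    qed
    then have "measure P {w \<in> space P. \<bar>1 / real n * cocycle pair_step increment w n z - \<gamma>\<bar> > \<epsilon>}
        \<le> measure P (?E t \<union> ?E (- t))"
      by (intro finite_measure_mono sets.Un E_sets)
    also have "\<dots> \<le> measure P (?E t) + measure P (?E (- t))"
      by (intro measure_Un_le E_sets)
    also have "\<dots> \<le> 2 * exp (2 * G) * exp (- (real n * (1 / (4 * D\<^sup>2)) * \<epsilon>\<^sup>2))"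
      using E_le[of t] E_le[of "- t"] t by simp
    finally show "measure P {w \<in> space P. \<bar>1 / real n * cocycle pair_step increment w n z - \<gamma>\<bar> > \<epsilon>}
        \<le> 2 * exp (2 * G) * exp (- (real n * (1 / (4 * D\<^sup>2)) * \<epsilon>\<^sup>2))" .
  qed
qed

text \<open>The expected cocycle stays within a bounded distance of \<open>n * \<gamma>\<close>. The
  constant \<open>b\<close> accommodates \<open>ln (dist x y)\<close>, by which the logarithmic
  distance differs from the cocycle.\<close>

lemma mean_cocycle_tendsto:
  "(\<lambda>n. 1 / real n * ((\<integral>w. cocycle pair_step increment w n z \<partial>P) + b)) \<longlonglongrightarrow> \<gamma>"
proof -
  obtain D where D: "\<And>n z. \<bar>birkhoff pair_step n pair_drift z - real n * \<gamma>\<bar> \<le> D"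
    using birkhoff_near_lyapunov by blast
  have pd: "pair_drift = (\<lambda>z. \<Sum>i<N. p i * increment i z)" by (simp add: fun_eq_iff pair_drift_def)
  have "(\<lambda>n. (D + \<bar>b\<bar>) / real n) \<longlonglongrightarrow> 0" by (rule lim_const_over_n)
  then show ?thesis
  proof (rule LIM_zero_cancel[OF Lim_null_comparison[rotated]])
    show "\<forall>\<^sub>F n in sequentially. norm (1 / real n * ((\<integral>w. cocycle pair_step increment w n z \<partial>P) + b) - \<gamma>)
        \<le> (D + \<bar>b\<bar>) / real n"
      using eventually_gt_at_top[of 0]
    proof eventually_elim
      case (elim n)
      have "(\<integral>w. cocycle pair_step increment w n z \<partial>P) = birkhoff pair_step n pair_drift z"
        unfolding pd by (rule integral_cocycle)
      then have "1 / real n * ((\<integral>w. cocycle pair_step increment w n z \<partial>P) + b) - \<gamma>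
          = (birkhoff pair_step n pair_drift z - real n * \<gamma> + b) / real n"
        using elim by (simp add: field_simps)
      moreover have "\<bar>birkhoff pair_step n pair_drift z - real n * \<gamma> + b\<bar> \<le> D + \<bar>b\<bar>"
        using D[of n z] by linarith
      ultimately show ?case by (simp add: divide_right_mono)
    qed
  qed
qed

section \<open>Limits and tail estimates for distances and derivatives\<close>

lemma ln_dist_mean_tendsto:
  assumes "x \<noteq> y"
  shows "(\<lambda>n. 1 / real n * (\<integral>w. ln (dist (fiber_iter f w n x) (fiber_iter f w n y)) \<partial>P)) \<longlonglongrightarrow> \<gamma>"
proof -
  interpret prob_space P by (rule prob_space_P)
  have "(\<integral>w. ln (dist (fiber_iter f w n x) (fiber_iter f w n y)) \<partial>P)
      = (\<integral>w. cocycle pair_step increment w n (x, y) \<partial>P) + ln (dist x y)" for n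
  proof -
    have "(\<integral>w. ln (dist (fiber_iter f w n x) (fiber_iter f w n y)) \<partial>P)
        = (\<integral>w. cocycle pair_step increment w n (x, y) + ln (dist x y) \<partial>P)"
      using assms by (intro Bochner_Integration.integral_cong refl)
        (simp add: ln_dist_fiber_iter[symmetric] fiber_iter_neq ln_div)
    also have "\<dots> = (\<integral>w. cocycle pair_step increment w n (x, y) \<partial>P) + ln (dist x y)"
      using integrable_finitary[OF finitary_cocycle[of n "\<lambda>s. s" pair_step increment "(x, y)"]] by (simp add: prob_space)
    finally show ?thesis .
  qed
  then show ?thesis using mean_cocycle_tendsto by simp
qed

lemma ln_deriv_mean_tendsto:
  "(\<lambda>n. 1 / real n * (\<integral>w. ln \<bar>circle_deriv (fiber_iter f w n) x\<bar> \<partial>P)) \<longlonglongrightarrow> \<gamma>"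
proof -
  have "(\<integral>w. ln \<bar>circle_deriv (fiber_iter f w n) x\<bar> \<partial>P) = (\<integral>w. cocycle pair_step increment w n (x, x) \<partial>P)" for n
    by (intro Bochner_Integration.integral_cong refl) (simp add: ln_deriv_fiber_iter)
  then show ?thesis using mean_cocycle_tendsto[of "(x, x)" 0] by simp
qed

text \<open>The constants of \<open>large_deviations\<close> do not depend on the pair, so one
  choice serves the diagonal pair \<open>(x, x)\<close> and the pair \<open>(x, y)\<close>
  alike.\<close>

lemma fiber_large_deviations:
  "\<exists>h \<epsilon>\<^sub>0 c. h > 0 \<and> \<epsilon>\<^sub>0 > 0 \<and> c > 0 \<and>
    (\<forall>x \<epsilon> n. 0 < \<epsilon> \<and> \<epsilon> < \<epsilon>\<^sub>0 \<and> n \<ge> 1 \<longrightarrow>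
      measure P {w \<in> space P. \<bar>1 / real n * ln \<bar>circle_deriv (fiber_iter f w n) x\<bar> - \<gamma>\<bar> > \<epsilon>}
        \<le> c * exp (- (real n * h * \<epsilon>\<^sup>2)) \<and>
      (\<forall>y. y \<noteq> x \<longrightarrow>
        measure P {w \<in> space P.
            \<bar>1 / real n * ln (dist (fiber_iter f w n x) (fiber_iter f w n y) / dist x y) - \<gamma>\<bar> > \<epsilon>}
          \<le> c * exp (- (real n * h * \<epsilon>\<^sup>2 / 4))))"
proof -
  obtain h \<epsilon>\<^sub>0 c where pos: "h > 0" "\<epsilon>\<^sub>0 > 0" "c > 0" and
    ld: "\<And>z \<epsilon> n. 0 < \<epsilon> \<Longrightarrow> \<epsilon> < \<epsilon>\<^sub>0 \<Longrightarrow> n \<ge> 1 \<Longrightarrow>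
      measure P {w \<in> space P. \<bar>1 / real n * cocycle pair_step increment w n z - \<gamma>\<bar> > \<epsilon>}
        \<le> c * exp (- (real n * h * \<epsilon>\<^sup>2))"
    using large_deviations by blast
  show ?thesis
  proof (rule exI[of _ h], rule exI[of _ \<epsilon>\<^sub>0], rule exI[of _ c], intro conjI allI impI pos)
    fix x \<epsilon> and n :: nat assume \<epsilon>: "0 < \<epsilon> \<and> \<epsilon> < \<epsilon>\<^sub>0 \<and> n \<ge> 1"
    have "{w \<in> space P. \<bar>1 / real n * ln \<bar>circle_deriv (fiber_iter f w n) x\<bar> - \<gamma>\<bar> > \<epsilon>}
        = {w \<in> space P. \<bar>1 / real n * cocycle pair_step increment w n (x, x) - \<gamma>\<bar> > \<epsilon>}"
      by (intro Collect_cong conj_cong refl) (simp only: ln_deriv_fiber_iter)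
    with ld \<epsilon> show "measure P {w \<in> space P. \<bar>1 / real n * ln \<bar>circle_deriv (fiber_iter f w n) x\<bar> - \<gamma>\<bar> > \<epsilon>}
        \<le> c * exp (- (real n * h * \<epsilon>\<^sup>2))" by simp
    fix y assume "y \<noteq> x"
    then have neq: "x \<noteq> y" by simp
    have "{w \<in> space P. \<bar>1 / real n * ln (dist (fiber_iter f w n x) (fiber_iter f w n y) / dist x y) - \<gamma>\<bar> > \<epsilon>}
        = {w \<in> space P. \<bar>1 / real n * cocycle pair_step increment w n (x, y) - \<gamma>\<bar> > \<epsilon>}"
      by (intro Collect_cong conj_cong refl) (simp only: ln_dist_fiber_iter[OF _ neq])
    then have "measure P {w \<in> space P. \<bar>1 / real n * ln (dist (fiber_iter f w n x) (fiber_iter f w n y) / dist x y) - \<gamma>\<bar> > \<epsilon>}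
        \<le> c * exp (- (real n * h * \<epsilon>\<^sup>2))"
      using ld \<epsilon> by simp
    also have "\<dots> \<le> c * exp (- (real n * h * \<epsilon>\<^sup>2 / 4))"
      using pos by (intro mult_left_mono) auto
    finally show "measure P {w \<in> space P. \<bar>1 / real n * ln (dist (fiber_iter f w n x) (fiber_iter f w n y) / dist x y) - \<gamma>\<bar> > \<epsilon>}
        \<le> c * exp (- (real n * h * \<epsilon>\<^sup>2 / 4))" .
  qed
qed

end

theorem theorem1p11:
  fixes N :: nat and f :: "nat \<Rightarrow> circle \<Rightarrow> circle" and \<beta> :: real and \<mu> :: "nat measure"
  assumes "\<beta> > 0"
    and "\<forall>i<N. circle_C1_holder_diffeo \<beta> (f i)"
    and "proximal N f"
    and "\<not> (\<exists>m. borel_prob m \<and> (\<forall>i<N. distr m borel (f i) = m))"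
    and "nondegenerate_prob N \<mu>"
  defines "P \<equiv> bernoulli_measure \<mu>"
    and "\<gamma> \<equiv> fiber_lyapunov_exponent N f \<mu>"
  shows "(\<forall>x y. x \<noteq> y \<longrightarrow>
        (\<lambda>n. 1 / real n * (\<integral>w. ln (dist (fiber_iter f w n x) (fiber_iter f w n y)) \<partial>P)) \<longlonglongrightarrow> \<gamma> \<and>
        (\<lambda>n. 1 / real n * (\<integral>w. ln \<bar>circle_deriv (fiber_iter f w n) x\<bar> \<partial>P)) \<longlonglongrightarrow> \<gamma> \<and>
        \<gamma> < 0)
    \<and> (\<exists>h \<epsilon>\<^sub>0 c. h > 0 \<and> \<epsilon>\<^sub>0 > 0 \<and> c > 0 \<and>
        (\<forall>x \<epsilon> n. 0 < \<epsilon> \<and> \<epsilon> < \<epsilon>\<^sub>0 \<and> n \<ge> 1 \<longrightarrow>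
          measure P {w \<in> space P.
              \<bar>1 / real n * ln \<bar>circle_deriv (fiber_iter f w n) x\<bar> - \<gamma>\<bar> > \<epsilon>}
            \<le> c * exp (- (real n * h * \<epsilon>\<^sup>2)) \<and>
          (\<forall>y. y \<noteq> x \<longrightarrow>
            measure P {w \<in> space P.
                \<bar>1 / real n * ln (dist (fiber_iter f w n x) (fiber_iter f w n y) / dist x y) - \<gamma>\<bar> > \<epsilon>}
              \<le> c * exp (- (real n * h * \<epsilon>\<^sup>2 / 4)))))"
proof -
  interpret circle_holder_system N \<mu> f \<beta>
    using assms(1-5) by unfold_locales (auto simp: circle_C1_holder_diffeo_def)
  obtain a C r where "0 < a" "a \<le> \<beta>" "a \<le> 1" "0 \<le> C" "0 < r" "r < 1"
    "\<And>k z. transfer_pow pair_step k (\<lambda>z. pair_dist z powr a) z \<le> C * r ^ k"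
    using pair_dist_contraction by blast
  then interpret contracting_system N \<mu> f \<beta> a C r
    by unfold_locales
  show ?thesis
    unfolding P_def \<gamma>_def
    using ln_dist_mean_tendsto ln_deriv_mean_tendsto lyapunov_exponent_negative fiber_large_deviations by blast
qed

end
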